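(* Let $G$ be a finite group, let $T$ be a multiplicatively cohomological $G$-Tambara functor with Jacobson radical $J$. If $M$ is a $T$-module such that $JM=M$, then $M=0$.
   Context: A $G$-Tambara functor $T$ assigns to each finite $G$-set $X$ a commutative ring $T(X)$ and to each $G$-map $f\colon X\to Y$ a ring homomorphism $f^*\colon T(Y)\to T(X)$ (restriction), a homomorphism of additive groups $f_+\colon T(X)\to T(Y)$ (transfer) and a homomorphism of multiplicative monoids $f_\times\colon T(X)\to T(Y)$ (norm) such that: $f^*$ is contravariantly functorial and $f_+,f_\times$ are covariantly functorial; $T(X\amalg Y)\cong T(X)\times T(Y)$ via the restrictions, and $T(\emptyset)=0$; for each pullback square with $f\colon X\to Y$, $g\colon Y'\to Y$, $X'=X\times_Y Y'$ and projections $f'\colon X'\to Y'$, $g'\colon X'\to X$ one has $g^*f_+=f'_+g'^*$ and $g^*f_\times=f'_\times g'^*$; and for $q\colon A\to X$, $f\colon X\to Y$, setting $\Pi=\{(y,s): y\in Y,\ s\colon f^{-1}(y)\to A,\ q\circ s=\mathrm{id}\}$, with $p\colon\Pi\to Y$ and $r\colon X\times_Y\Pi\to\Pi$ the projections and $e\colon X\times_Y\Pi\to A$, $(x,(y,s))\mapsto s(x)$, one has $f_\times q_+=p_+r_\times e^*$. Maps of Tambara functors are families of ring homomorphisms commuting with all operations. For $H\le K\le G$, $\mathrm{res}^K_H$, $\mathrm{tr}^K_H$, $\mathrm{nm}^K_H$ are the restriction, transfer and norm along the projection $G/H\to G/K$. $T$ is multiplicatively cohomological if for all $H\le K\le G$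 the composite $\mathrm{nm}^K_H\circ\mathrm{res}^K_H$ on $T(G/K)$ is the $|K/H|$-th power map. An ideal $I$ of $T$ is a collection of ring ideals $I(G/H)\subseteq T(G/H)$ that occurs as the levelwise kernel of a map of Tambara functors with source $T$. An ideal is maximal if it is proper ($\neq T$) and not properly contained in another proper ideal. The Jacobson radical $J(T)$ is the (levelwise) intersection of all maximal ideals of $T$. A $G$-Mackey functor $M$ is defined like a Tambara functor but with values abelian groups and only additive restrictions and transfers $f^*,f_+$ (functoriality, additivity on disjoint unions, and base change for pullback squares). The box product $\boxtimes$ is the symmetric monoidal product of Mackey functors (Day convolution): maps $M\boxtimes N\to P$ correspond to families of bilinear maps $M(X)\times N(X)\to P(X)$, $(m,n)\mapsto m\cdot n$, with $f^*(m\cdot n)=f^*m\cdot f^*n$, $f_+(m\cdot f^*n)=f_+m\cdot n$, $f_+(f^*m\cdot n)=m\cdot f_+n$. Every Tambara functor is a commutative monoid for $\boxtimes$. A $T$-module is a Mackey functor $M$ with an associative unital action $T\boxtimes M\to M$. For an ideal $I\subseteq T$, $IM\subseteq M$ is the image of the composite $I\boxtimes M\to T\boxtimes M\to M$.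
   Formalization: The T-module M is additionally assumed to be finitely generated; without this the claim fails, e.g. for G trivial, T the ring Z localized at p, and M = Q, where JM = M but M is nonzero. *)

theory Defs
  imports
    "HOL-Algebra.Group_Action"
    "HOL-Algebra.QuotRing"
    "HOL-Algebra.Free_Abelian_Groups"
begin

section \<open>Finite G-sets\<close>

text \<open>
  The points of all finite \<open>G\<close>-sets are drawn from one infinite type. Every finite \<open>G\<close>-set is
  isomorphic to one whose points lie in this type, so the resulting category is equivalent to
  that of all finite \<open>G\<close>-sets; the type is chosen so that coset spaces (paired with \<open>0\<close>) are objects.
  All axioms below are stated for arbitrary coproducts, pullbacks and dependent products,
  not for chosen ones, and so do not depend on the choice of the type.
\<close>

type_synonym 'g pt = "'g set \<times> nat"
type_synonym 'g gset = "'g pt set \<times> ('g \<Rightarrow> 'g pt \<Rightarrow> 'g pt)"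

abbreviation pts :: "'g gset \<Rightarrow> 'g pt set" where "pts \<equiv> fst"
abbreviation act :: "'g gset \<Rightarrow> 'g \<Rightarrow> 'g pt \<Rightarrow> 'g pt" where "act \<equiv> snd"

definition fin_gset :: "('g, 'b) monoid_scheme \<Rightarrow> 'g gset \<Rightarrow> bool" where
  "fin_gset G X \<longleftrightarrow> finite (pts X) \<and> group_action G (pts X) (act X)"

definition gmap :: "('g, 'b) monoid_scheme \<Rightarrow> 'g gset \<Rightarrow> 'g gset \<Rightarrow> ('g pt \<Rightarrow> 'g pt) set" where
  "gmap G X Y = {f \<in> pts X \<rightarrow>\<^sub>E pts Y.
     \<forall>g \<in> carrier G. \<forall>x \<in> pts X. f (act X g x) = act Y g (f x)}"

definition gmap_id :: "'g gset \<Rightarrow> 'g pt \<Rightarrow> 'g pt" where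
  "gmap_id X = (\<lambda>x \<in> pts X. x)"

definition coset_gset :: "('g, 'b) monoid_scheme \<Rightarrow> 'g set \<Rightarrow> 'g gset" where
  "coset_gset G H =
    (let E = (\<lambda>g. (g <#\<^bsub>G\<^esub> H, 0)) ` carrier G in (E, \<lambda>g. \<lambda>p \<in> E. (g <#\<^bsub>G\<^esub> fst p, 0)))"

text \<open>For \<open>H \<subseteq> K\<close> the product set \<open>(gH)K\<close> is the coset \<open>gK\<close>.\<close>

definition coset_proj :: "('g, 'b) monoid_scheme \<Rightarrow> 'g set \<Rightarrow> 'g set \<Rightarrow> 'g pt \<Rightarrow> 'g pt" where
  "coset_proj G H K = (\<lambda>p \<in> pts (coset_gset G H). (fst p <#>\<^bsub>G\<^esub> K, 0))"

definition is_coproduct ::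
    "('g, 'b) monoid_scheme \<Rightarrow> 'g gset \<Rightarrow> 'g gset \<Rightarrow> 'g gset
      \<Rightarrow> ('g pt \<Rightarrow> 'g pt) \<Rightarrow> ('g pt \<Rightarrow> 'g pt) \<Rightarrow> bool" where
  "is_coproduct G X Y W i j \<longleftrightarrow>
     fin_gset G X \<and> fin_gset G Y \<and> fin_gset G W \<and> i \<in> gmap G X W \<and> j \<in> gmap G Y W \<and>
     inj_on i (pts X) \<and> inj_on j (pts Y) \<and>
     i ` pts X \<inter> j ` pts Y = {} \<and> i ` pts X \<union> j ` pts Y = pts W"

text \<open>
  \<open>is_pullback G X Y Y' X' f g f' g'\<close>: the square with \<open>f: X \<rightarrow> Y\<close>, \<open>g: Y' \<rightarrow> Y\<close>, \<open>f': X' \<rightarrow> Y'\<close>,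
  \<open>g': X' \<rightarrow> X\<close> is a pullback.
\<close>

definition is_pullback ::
    "('g, 'b) monoid_scheme \<Rightarrow> 'g gset \<Rightarrow> 'g gset \<Rightarrow> 'g gset \<Rightarrow> 'g gset
      \<Rightarrow> ('g pt \<Rightarrow> 'g pt) \<Rightarrow> ('g pt \<Rightarrow> 'g pt) \<Rightarrow> ('g pt \<Rightarrow> 'g pt) \<Rightarrow> ('g pt \<Rightarrow> 'g pt) \<Rightarrow> bool" where
  "is_pullback G X Y Y' X' f g f' g' \<longleftrightarrow>
     fin_gset G X \<and> fin_gset G Y \<and> fin_gset G Y' \<and> fin_gset G X' \<and>
     f \<in> gmap G X Y \<and> g \<in> gmap G Y' Y \<and> f' \<in> gmap G X' Y' \<and> g' \<in> gmap G X' X \<and>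
     bij_betw (\<lambda>v. (g' v, f' v)) (pts X') {(x, y') \<in> pts X \<times> pts Y'. f x = g y'}"

text \<open>
  For \<open>q: A \<rightarrow> X\<close> and \<open>f: X \<rightarrow> Y\<close>: \<open>P\<close> with \<open>p: P \<rightarrow> Y\<close> is a copy of
  \<open>\<Pi> = {(y,s). y \<in> Y, s: f\<^sup>-\<^sup>1(y) \<rightarrow> A, q \<circ> s = id}\<close>, \<open>W\<close> with projections \<open>k: W \<rightarrow> X\<close>, \<open>r: W \<rightarrow> P\<close> is a
  copy of \<open>X \<times>\<^sub>Y \<Pi>\<close>, and \<open>e: W \<rightarrow> A\<close> is the evaluation \<open>(x,(y,s)) \<mapsto> s(x)\<close>. The identification of
  \<open>P\<close> with \<open>\<Pi>\<close> sends \<open>w\<close> to \<open>p w\<close> and the section \<open>x \<mapsto> e(x,w)\<close>; the \<open>THE\<close> term is the point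
  \<open>(x,w)\<close> of \<open>W\<close>. The identification transports the conjugation action on \<open>\<Pi>\<close> because
  \<open>p\<close>, \<open>k\<close>, \<open>r\<close>, \<open>e\<close> are equivariant.
\<close>

definition is_exponential ::
    "('g, 'b) monoid_scheme \<Rightarrow> 'g gset \<Rightarrow> 'g gset \<Rightarrow> 'g gset \<Rightarrow> 'g gset \<Rightarrow> 'g gset
      \<Rightarrow> ('g pt \<Rightarrow> 'g pt) \<Rightarrow> ('g pt \<Rightarrow> 'g pt) \<Rightarrow> ('g pt \<Rightarrow> 'g pt) \<Rightarrow> ('g pt \<Rightarrow> 'g pt)
      \<Rightarrow> ('g pt \<Rightarrow> 'g pt) \<Rightarrow> ('g pt \<Rightarrow> 'g pt) \<Rightarrow> bool" where
  "is_exponential G A X Y P W q f p r k e \<longleftrightarrow>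
     fin_gset G A \<and> q \<in> gmap G A X \<and> is_pullback G X Y P W f p r k \<and>
     e \<in> gmap G W A \<and> (\<forall>v \<in> pts W. q (e v) = k v) \<and>
     bij_betw
       (\<lambda>w. (p w, \<lambda>x \<in> {x \<in> pts X. f x = p w}. e (THE v. v \<in> pts W \<and> k v = x \<and> r v = w)))
       (pts P)
       (SIGMA y : pts Y. \<Pi>\<^sub>E x \<in> {x \<in> pts X. f x = y}. {a \<in> pts A. q a = x})"


section \<open>Mackey functors\<close>

text \<open>
  For \<open>f: X \<rightarrow> Y\<close>, \<open>mres M X Y f\<close> maps \<open>M(Y)\<close> to \<open>M(X)\<close> and \<open>mtr M X Y f\<close> maps \<open>M(X)\<close> to \<open>M(Y)\<close>.
  The abelian groups \<open>mval M X\<close> are groups in the sense of the library, hence written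
  multiplicatively.
\<close>

record ('g, 'm) mackey =
  mval :: "'g gset \<Rightarrow> 'm monoid"
  mres :: "'g gset \<Rightarrow> 'g gset \<Rightarrow> ('g pt \<Rightarrow> 'g pt) \<Rightarrow> 'm \<Rightarrow> 'm"
  mtr :: "'g gset \<Rightarrow> 'g gset \<Rightarrow> ('g pt \<Rightarrow> 'g pt) \<Rightarrow> 'm \<Rightarrow> 'm"

locale mackey_functor =
  fixes G :: "('g, 'b) monoid_scheme" and M :: "('g, 'm) mackey"
  assumes val_comm_group: "fin_gset G X \<Longrightarrow> comm_group (mval M X)"
    and res_hom: "\<lbrakk>fin_gset G X; fin_gset G Y; f \<in> gmap G X Y\<rbrakk>
      \<Longrightarrow> mres M X Y f \<in> hom (mval M Y) (mval M X)"
    and tr_hom: "\<lbrakk>fin_gset G X; fin_gset G Y; f \<in> gmap G X Y\<rbrakk>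
      \<Longrightarrow> mtr M X Y f \<in> hom (mval M X) (mval M Y)"
    and res_id: "\<lbrakk>fin_gset G X; m \<in> carrier (mval M X)\<rbrakk> \<Longrightarrow> mres M X X (gmap_id X) m = m"
    and tr_id: "\<lbrakk>fin_gset G X; m \<in> carrier (mval M X)\<rbrakk> \<Longrightarrow> mtr M X X (gmap_id X) m = m"
    and res_comp: "\<lbrakk>fin_gset G X; fin_gset G Y; fin_gset G Z; f \<in> gmap G X Y; g \<in> gmap G Y Z;
        m \<in> carrier (mval M Z)\<rbrakk>
      \<Longrightarrow> mres M X Z (compose (pts X) g f) m = mres M X Y f (mres M Y Z g m)"
    and tr_comp: "\<lbrakk>fin_gset G X; fin_gset G Y; fin_gset G Z; f \<in> gmap G X Y; g \<in> gmap G Y Z;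
        m \<in> carrier (mval M X)\<rbrakk>
      \<Longrightarrow> mtr M X Z (compose (pts X) g f) m = mtr M Y Z g (mtr M X Y f m)"
    and additive: "is_coproduct G X Y W i j
      \<Longrightarrow> bij_betw (\<lambda>m. (mres M X W i m, mres M Y W j m))
            (carrier (mval M W)) (carrier (mval M X) \<times> carrier (mval M Y))"
    and additive_empty: "\<lbrakk>fin_gset G X; pts X = {}\<rbrakk> \<Longrightarrow> carrier (mval M X) = {\<one>\<^bsub>mval M X\<^esub>}"
    and base_change: "\<lbrakk>is_pullback G X Y Y' X' f g f' g'; m \<in> carrier (mval M X)\<rbrakk>
      \<Longrightarrow> mres M Y' Y g (mtr M X Y f m) = mtr M X' Y' f' (mres M X' X g' m)"

definition mackey_zero :: "('g, 'b) monoid_scheme \<Rightarrow> ('g, 'm) mackey \<Rightarrow> bool" where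
  "mackey_zero G M \<longleftrightarrow> (\<forall>X. fin_gset G X \<longrightarrow> carrier (mval M X) = {\<one>\<^bsub>mval M X\<^esub>})"


section \<open>Tambara functors\<close>

record ('g, 'r) tambara =
  tval :: "'g gset \<Rightarrow> 'r ring"
  tres :: "'g gset \<Rightarrow> 'g gset \<Rightarrow> ('g pt \<Rightarrow> 'g pt) \<Rightarrow> 'r \<Rightarrow> 'r"
  ttr :: "'g gset \<Rightarrow> 'g gset \<Rightarrow> ('g pt \<Rightarrow> 'g pt) \<Rightarrow> 'r \<Rightarrow> 'r"
  tnm :: "'g gset \<Rightarrow> 'g gset \<Rightarrow> ('g pt \<Rightarrow> 'g pt) \<Rightarrow> 'r \<Rightarrow> 'r"

definition additive_part :: "('g, 'r) tambara \<Rightarrow> ('g, 'r) mackey" where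
  "additive_part T = \<lparr>mval = \<lambda>X. add_monoid (tval T X), mres = tres T, mtr = ttr T\<rparr>"

locale tambara_functor =
  additive: mackey_functor G "additive_part T"
  for G :: "('g, 'b) monoid_scheme" and T :: "('g, 'r) tambara" +
  assumes val_cring: "fin_gset G X \<Longrightarrow> cring (tval T X)"
    and res_ring_hom: "\<lbrakk>fin_gset G X; fin_gset G Y; f \<in> gmap G X Y\<rbrakk>
      \<Longrightarrow> tres T X Y f \<in> ring_hom (tval T Y) (tval T X)"
    and nm_hom: "\<lbrakk>fin_gset G X; fin_gset G Y; f \<in> gmap G X Y\<rbrakk>
      \<Longrightarrow> tnm T X Y f \<in> hom (tval T X) (tval T Y)"
    and nm_one: "\<lbrakk>fin_gset G X; fin_gset G Y; f \<in> gmap G X Y\<rbrakk>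
      \<Longrightarrow> tnm T X Y f \<one>\<^bsub>tval T X\<^esub> = \<one>\<^bsub>tval T Y\<^esub>"
    and nm_id: "\<lbrakk>fin_gset G X; x \<in> carrier (tval T X)\<rbrakk> \<Longrightarrow> tnm T X X (gmap_id X) x = x"
    and nm_comp: "\<lbrakk>fin_gset G X; fin_gset G Y; fin_gset G Z; f \<in> gmap G X Y; g \<in> gmap G Y Z;
        x \<in> carrier (tval T X)\<rbrakk>
      \<Longrightarrow> tnm T X Z (compose (pts X) g f) x = tnm T Y Z g (tnm T X Y f x)"
    and nm_base_change: "\<lbrakk>is_pullback G X Y Y' X' f g f' g'; x \<in> carrier (tval T X)\<rbrakk>
      \<Longrightarrow> tres T Y' Y g (tnm T X Y f x) = tnm T X' Y' f' (tres T X' X g' x)"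
    and nm_tr: "\<lbrakk>is_exponential G A X Y P W q f p r k e; a \<in> carrier (tval T A)\<rbrakk>
      \<Longrightarrow> tnm T X Y f (ttr T A X q a) = ttr T P Y p (tnm T W P r (tres T W A e a))"

locale tambara_map =
  fixes G :: "('g, 'b) monoid_scheme" and T :: "('g, 'r) tambara" and S :: "('g, 's) tambara"
    and \<phi> :: "'g gset \<Rightarrow> 'r \<Rightarrow> 's"
  assumes map_ring_hom: "fin_gset G X \<Longrightarrow> \<phi> X \<in> ring_hom (tval T X) (tval S X)"
    and map_res: "\<lbrakk>fin_gset G X; fin_gset G Y; f \<in> gmap G X Y; y \<in> carrier (tval T Y)\<rbrakk>
      \<Longrightarrow> \<phi> X (tres T X Y f y) = tres S X Y f (\<phi> Y y)"
    and map_tr: "\<lbrakk>fin_gset G X; fin_gset G Y; f \<in> gmap G X Y; x \<in> carrier (tval T X)\<rbrakk>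
      \<Longrightarrow> \<phi> Y (ttr T X Y f x) = ttr S X Y f (\<phi> X x)"
    and map_nm: "\<lbrakk>fin_gset G X; fin_gset G Y; f \<in> gmap G X Y; x \<in> carrier (tval T X)\<rbrakk>
      \<Longrightarrow> \<phi> Y (tnm T X Y f x) = tnm S X Y f (\<phi> X x)"

definition mult_cohomological :: "('g, 'b) monoid_scheme \<Rightarrow> ('g, 'r) tambara \<Rightarrow> bool" where
  "mult_cohomological G T \<longleftrightarrow>
    (\<forall>H K. subgroup H G \<and> subgroup K G \<and> H \<subseteq> K \<longrightarrow>
      (\<forall>x \<in> carrier (tval T (coset_gset G K)).
        tnm T (coset_gset G H) (coset_gset G K) (coset_proj G H K)
          (tres T (coset_gset G H) (coset_gset G K) (coset_proj G H K) x)
        = x [^]\<^bsub>tval T (coset_gset G K)\<^esub> card ((\<lambda>g. g <#\<^bsub>G\<^esub> H) ` K)))"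


section \<open>Ideals and the Jacobson radical\<close>

text \<open>
  An ideal is recorded by its values at all finite \<open>G\<close>-sets; by additivity these are determined by
  the values at the orbits \<open>G/H\<close>, compatibly with inclusions. It suffices to let the target
  take values in rings of sets of elements of \<open>T\<close>: the levelwise image of any map out of \<open>T\<close> is again a
  Tambara functor with the same kernel, and it is isomorphic to the levelwise quotient ring
  (\<open>FactRing\<close>), whose elements are cosets.
\<close>

definition tambara_ideal ::
    "('g, 'b) monoid_scheme \<Rightarrow> ('g, 'r) tambara \<Rightarrow> ('g gset \<Rightarrow> 'r set) \<Rightarrow> bool" where
  "tambara_ideal G T I \<longleftrightarrow>
    (\<exists>(S :: ('g, 'r set) tambara) \<phi>. tambara_functor G S \<and> tambara_map G T S \<phi> \<and>
      (\<forall>X. fin_gset G X \<longrightarrow> I X = a_kernel (tval T X) (tval S X) (\<phi> X)))"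

definition proper_ideal ::
    "('g, 'b) monoid_scheme \<Rightarrow> ('g, 'r) tambara \<Rightarrow> ('g gset \<Rightarrow> 'r set) \<Rightarrow> bool" where
  "proper_ideal G T I \<longleftrightarrow>
    tambara_ideal G T I \<and> (\<exists>X. fin_gset G X \<and> I X \<noteq> carrier (tval T X))"

definition maximal_tambara_ideal ::
    "('g, 'b) monoid_scheme \<Rightarrow> ('g, 'r) tambara \<Rightarrow> ('g gset \<Rightarrow> 'r set) \<Rightarrow> bool" where
  "maximal_tambara_ideal G T I \<longleftrightarrow>
    proper_ideal G T I \<and>
    (\<forall>I'. proper_ideal G T I' \<and> (\<forall>X. fin_gset G X \<longrightarrow> I X \<subseteq> I' X)
      \<longrightarrow> (\<forall>X. fin_gset G X \<longrightarrow> I' X = I X))"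

definition jacobson ::
    "('g, 'b) monoid_scheme \<Rightarrow> ('g, 'r) tambara \<Rightarrow> 'g gset \<Rightarrow> 'r set" where
  "jacobson G T X = {x \<in> carrier (tval T X). \<forall>I. maximal_tambara_ideal G T I \<longrightarrow> x \<in> I X}"

definition ideal_mackey ::
    "('g, 'r) tambara \<Rightarrow> ('g gset \<Rightarrow> 'r set) \<Rightarrow> ('g, 'r) mackey" where
  "ideal_mackey T I =
    \<lparr>mval = \<lambda>X. (add_monoid (tval T X))\<lparr>carrier := I X\<rparr>, mres = tres T, mtr = ttr T\<rparr>"


section \<open>Pairings, the box product and modules\<close>

text \<open>The families \<open>M(X) \<times> N(X) \<rightarrow> P(X)\<close> that correspond to maps from the box product of \<open>M\<close> and \<open>N\<close> to \<open>P\<close>.\<close>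

locale mackey_pairing =
  fixes G :: "('g, 'b) monoid_scheme"
    and M :: "('g, 'm) mackey" and N :: "('g, 'n) mackey" and P :: "('g, 'p) mackey"
    and \<beta> :: "'g gset \<Rightarrow> 'm \<Rightarrow> 'n \<Rightarrow> 'p"
  assumes pairing_hom_right: "\<lbrakk>fin_gset G X; m \<in> carrier (mval M X)\<rbrakk>
      \<Longrightarrow> \<beta> X m \<in> hom (mval N X) (mval P X)"
    and pairing_hom_left: "\<lbrakk>fin_gset G X; n \<in> carrier (mval N X)\<rbrakk>
      \<Longrightarrow> (\<lambda>m. \<beta> X m n) \<in> hom (mval M X) (mval P X)"
    and pairing_res: "\<lbrakk>fin_gset G X; fin_gset G Y; f \<in> gmap G X Y;
        m \<in> carrier (mval M Y); n \<in> carrier (mval N Y)\<rbrakk>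
      \<Longrightarrow> mres P X Y f (\<beta> Y m n) = \<beta> X (mres M X Y f m) (mres N X Y f n)"
    and pairing_tr_left: "\<lbrakk>fin_gset G X; fin_gset G Y; f \<in> gmap G X Y;
        m \<in> carrier (mval M X); n \<in> carrier (mval N Y)\<rbrakk>
      \<Longrightarrow> mtr P X Y f (\<beta> X m (mres N X Y f n)) = \<beta> Y (mtr M X Y f m) n"
    and pairing_tr_right: "\<lbrakk>fin_gset G X; fin_gset G Y; f \<in> gmap G X Y;
        m \<in> carrier (mval M Y); n \<in> carrier (mval N X)\<rbrakk>
      \<Longrightarrow> mtr P X Y f (\<beta> X (mres M X Y f m) n) = \<beta> Y m (mtr N X Y f n)"

text \<open>
  The value at \<open>X\<close> of the box product is the coend of \<open>M(Y) \<otimes> N(Y)\<close> over finite \<open>G\<close>-sets \<open>Y\<close> over \<open>X\<close>: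
  the abelian group generated by symbols \<open>(Y,f,m,n)\<close> with \<open>f: Y \<rightarrow> X\<close>, standing for
  \<open>f\<^sub>+(m \<otimes> n)\<close>, modulo bilinearity and the two Frobenius relations.
\<close>

type_synonym ('g, 'm, 'n) box_gen = "'g gset \<times> ('g pt \<Rightarrow> 'g pt) \<times> 'm \<times> 'n"

definition box_gens ::
    "('g, 'b) monoid_scheme \<Rightarrow> ('g, 'm) mackey \<Rightarrow> ('g, 'n) mackey \<Rightarrow> 'g gset
      \<Rightarrow> ('g, 'm, 'n) box_gen set" where
  "box_gens G M N X = {(Y, f, m, n).
     fin_gset G Y \<and> f \<in> gmap G Y X \<and> m \<in> carrier (mval M Y) \<and> n \<in> carrier (mval N Y)}"

inductive_set box_rels ::
    "('g, 'b) monoid_scheme \<Rightarrow> ('g, 'm) mackey \<Rightarrow> ('g, 'n) mackey \<Rightarrow> 'g gset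
      \<Rightarrow> (('g, 'm, 'n) box_gen \<Rightarrow>\<^sub>0 int) set"
  for G :: "('g, 'b) monoid_scheme" and M :: "('g, 'm) mackey" and N :: "('g, 'n) mackey"
    and X :: "'g gset" where
  add_left: "\<lbrakk>fin_gset G Y; f \<in> gmap G Y X;
      m \<in> carrier (mval M Y); m' \<in> carrier (mval M Y); n \<in> carrier (mval N Y)\<rbrakk>
    \<Longrightarrow> frag_of (Y, f, m \<otimes>\<^bsub>mval M Y\<^esub> m', n) - (frag_of (Y, f, m, n) + frag_of (Y, f, m', n))
      \<in> box_rels G M N X"
| add_right: "\<lbrakk>fin_gset G Y; f \<in> gmap G Y X;
      m \<in> carrier (mval M Y); n \<in> carrier (mval N Y); n' \<in> carrier (mval N Y)\<rbrakk>
    \<Longrightarrow> frag_of (Y, f, m, n \<otimes>\<^bsub>mval N Y\<^esub> n') - (frag_of (Y, f, m, n) + frag_of (Y, f, m, n'))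
      \<in> box_rels G M N X"
| frobenius_left: "\<lbrakk>fin_gset G Y; fin_gset G Z; g \<in> gmap G Y Z; f \<in> gmap G Z X;
      m \<in> carrier (mval M Y); n \<in> carrier (mval N Z)\<rbrakk>
    \<Longrightarrow> frag_of (Y, compose (pts Y) f g, m, mres N Y Z g n) - frag_of (Z, f, mtr M Y Z g m, n)
      \<in> box_rels G M N X"
| frobenius_right: "\<lbrakk>fin_gset G Y; fin_gset G Z; g \<in> gmap G Y Z; f \<in> gmap G Z X;
      m \<in> carrier (mval M Z); n \<in> carrier (mval N Y)\<rbrakk>
    \<Longrightarrow> frag_of (Y, compose (pts Y) f g, mres M Y Z g m, n) - frag_of (Z, f, m, mtr N Y Z g n)
      \<in> box_rels G M N X"

abbreviation box_free ::
    "('g, 'b) monoid_scheme \<Rightarrow> ('g, 'm) mackey \<Rightarrow> ('g, 'n) mackey \<Rightarrow> 'g gset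
      \<Rightarrow> (('g, 'm, 'n) box_gen \<Rightarrow>\<^sub>0 int) monoid" where
  "box_free G M N X \<equiv> free_Abelian_group (box_gens G M N X)"

definition box_null ::
    "('g, 'b) monoid_scheme \<Rightarrow> ('g, 'm) mackey \<Rightarrow> ('g, 'n) mackey \<Rightarrow> 'g gset
      \<Rightarrow> (('g, 'm, 'n) box_gen \<Rightarrow>\<^sub>0 int) set" where
  "box_null G M N X = generate (box_free G M N X) (box_rels G M N X)"

definition box ::
    "('g, 'b) monoid_scheme \<Rightarrow> ('g, 'm) mackey \<Rightarrow> ('g, 'n) mackey \<Rightarrow> 'g gset
      \<Rightarrow> (('g, 'm, 'n) box_gen \<Rightarrow>\<^sub>0 int) set monoid" where
  "box G M N X = box_free G M N X Mod box_null G M N X"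

text \<open>The map to \<open>P\<close> induced by a pairing sends the class of \<open>(Y,f,m,n)\<close> to \<open>f\<^sub>+(m \<cdot> n)\<close>.\<close>

definition box_lin ::
    "('g, 'p) mackey \<Rightarrow> ('g gset \<Rightarrow> 'm \<Rightarrow> 'n \<Rightarrow> 'p) \<Rightarrow> 'g gset
      \<Rightarrow> (('g, 'm, 'n) box_gen \<Rightarrow>\<^sub>0 int) \<Rightarrow> 'p" where
  "box_lin P \<beta> X c =
    (\<Otimes>\<^bsub>mval P X\<^esub>u \<in> Poly_Mapping.keys c.
      (case u of (Y, f, m, n) \<Rightarrow> mtr P Y X f (\<beta> Y m n)) [^]\<^bsub>mval P X\<^esub> Poly_Mapping.lookup c u)"

definition box_map ::
    "('g, 'p) mackey \<Rightarrow> ('g gset \<Rightarrow> 'm \<Rightarrow> 'n \<Rightarrow> 'p) \<Rightarrow> 'g gset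
      \<Rightarrow> (('g, 'm, 'n) box_gen \<Rightarrow>\<^sub>0 int) set \<Rightarrow> 'p" where
  "box_map P \<beta> X C = the_elem (box_lin P \<beta> X ` C)"

text \<open>
  If \<open>L\<close> is a Mackey subfunctor of \<open>M\<close>, then \<open>box_incl G M N X\<close> is the map from the box product of
  \<open>L\<close> and \<open>N\<close> to that of \<open>M\<close> and \<open>N\<close> induced by the inclusion; it sends the class of a
  formal combination to the class of the same combination.
\<close>

definition box_incl ::
    "('g, 'b) monoid_scheme \<Rightarrow> ('g, 'm) mackey \<Rightarrow> ('g, 'n) mackey \<Rightarrow> 'g gset
      \<Rightarrow> (('g, 'm, 'n) box_gen \<Rightarrow>\<^sub>0 int) set \<Rightarrow> (('g, 'm, 'n) box_gen \<Rightarrow>\<^sub>0 int) set" where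
  "box_incl G M N X C =
    the_elem ((\<lambda>c. box_null G M N X #>\<^bsub>box_free G M N X\<^esub> c) ` C)"

locale tambara_module =
  ring: tambara_functor G T + module: mackey_functor G M +
  action: mackey_pairing G "additive_part T" M M \<mu>
  for G :: "('g, 'b) monoid_scheme" and T :: "('g, 'r) tambara" and M :: "('g, 'm) mackey"
    and \<mu> :: "'g gset \<Rightarrow> 'r \<Rightarrow> 'm \<Rightarrow> 'm" +
  assumes action_assoc: "\<lbrakk>fin_gset G X; s \<in> carrier (tval T X); t \<in> carrier (tval T X);
        m \<in> carrier (mval M X)\<rbrakk>
      \<Longrightarrow> \<mu> X (s \<otimes>\<^bsub>tval T X\<^esub> t) m = \<mu> X s (\<mu> X t m)"
    and action_unit: "\<lbrakk>fin_gset G X; m \<in> carrier (mval M X)\<rbrakk> \<Longrightarrow> \<mu> X \<one>\<^bsub>tval T X\<^esub> m = m"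

definition ideal_mult ::
    "('g, 'b) monoid_scheme \<Rightarrow> ('g, 'r) tambara \<Rightarrow> ('g, 'm) mackey
      \<Rightarrow> ('g gset \<Rightarrow> 'r \<Rightarrow> 'm \<Rightarrow> 'm) \<Rightarrow> ('g gset \<Rightarrow> 'r set) \<Rightarrow> 'g gset \<Rightarrow> 'm set" where
  "ideal_mult G T M \<mu> I X =
    (box_map M \<mu> X \<circ> box_incl G (additive_part T) M X) ` carrier (box G (ideal_mackey T I) M X)"


section \<open>Finitely generated modules\<close>

text \<open>
  Generators may live at different levels. Finite generation cannot be dropped in Nakayama's
  lemma: for trivial \<open>G\<close> a Tambara functor is a commutative ring, always multiplicatively
  cohomological, and for the localization of the integers at a prime \<open>p\<close> the module of rational
  numbers is nonzero but equal to its product with the Jacobson radical \<open>(p)\<close>.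
\<close>

definition submodule ::
    "('g, 'b) monoid_scheme \<Rightarrow> ('g, 'r) tambara \<Rightarrow> ('g, 'm) mackey
      \<Rightarrow> ('g gset \<Rightarrow> 'r \<Rightarrow> 'm \<Rightarrow> 'm) \<Rightarrow> ('g gset \<Rightarrow> 'm set) \<Rightarrow> bool" where
  "submodule G T M \<mu> N \<longleftrightarrow>
    (\<forall>X. fin_gset G X \<longrightarrow> subgroup (N X) (mval M X) \<and>
      (\<forall>t \<in> carrier (tval T X). \<forall>m \<in> N X. \<mu> X t m \<in> N X)) \<and>
    (\<forall>X Y f. fin_gset G X \<and> fin_gset G Y \<and> f \<in> gmap G X Y \<longrightarrow>
      mres M X Y f ` N Y \<subseteq> N X \<and> mtr M X Y f ` N X \<subseteq> N Y)"

definition finitely_generated ::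
    "('g, 'b) monoid_scheme \<Rightarrow> ('g, 'r) tambara \<Rightarrow> ('g, 'm) mackey
      \<Rightarrow> ('g gset \<Rightarrow> 'r \<Rightarrow> 'm \<Rightarrow> 'm) \<Rightarrow> bool" where
  "finitely_generated G T M \<mu> \<longleftrightarrow>
    (\<exists>F. finite F \<and> F \<subseteq> {(X, m). fin_gset G X \<and> m \<in> carrier (mval M X)} \<and>
      (\<forall>N. submodule G T M \<mu> N \<and> (\<forall>(X, m) \<in> F. m \<in> N X)
        \<longrightarrow> (\<forall>X. fin_gset G X \<longrightarrow> N X = carrier (mval M X))))"

end

theory Submission
  imports Defs "HOL-Algebra.Left_Coset" "HOL-Algebra.Divisibility"
begin

text \<open>
  A Tambara ideal is proper as soon as it is proper at \<open>G/e\<close>: the norm along the surjection from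
  \<open>G/e\<close> to the point sends \<open>1\<close> to \<open>1\<close> and \<open>0\<close> to \<open>0\<close>. Hence the maximal invariant ideals \<open>A\<close> of
  \<open>T(G/e)\<close> give maximal Tambara ideals, consisting of the elements all of whose restrictions to \<open>G/e\<close>
  lie in \<open>A\<close>, and it follows that \<open>1 - j\<close> is a unit for every \<open>j \<in> J(G/e)\<close>. If \<open>j \<in> J(G/H)\<close>, then
  \<open>(1 - j)\<^bsup>|H|\<^esup>\<close> is the norm of the restriction of \<open>1 - j\<close> to \<open>G/e\<close>, because \<open>T\<close> is multiplicatively
  cohomological; so \<open>1 - j\<close> is again a unit.

  Now \<open>M(G/H) = 0\<close> follows by induction on \<open>|H|\<close>. Once \<open>M(G/K) = 0\<close> for \<open>|K| < |H|\<close>, the only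
  transfers into \<open>M(G/H)\<close> that matter are those along isomorphisms. Therefore \<open>M(G/H)\<close> is a finitely
  generated \<open>T(G/H)\<close>-module, equal to \<open>J(G/H) M(G/H)\<close>, and the classical Nakayama lemma applies.
\<close>

section \<open>Finite G-sets\<close>

text \<open>The passage from G/e to G/H is the delicate one, and the place where multiplicative
  cohomologicality enters. A maximal Tambara ideal contains every element that restricts to 0 at
  G/e, so J(G/H) can be large: for the Burnside functor of the group G of order two, [G] - 2 lies in
  J at the point, although 1 - ([G] - 2) = 3 - [G] is not a unit there.

  That a family of ideals is a Tambara ideal has to be shown by constructing the quotient functor,
  and the norms are the obstacle: they are not additive, so it is not formal that they respect
  congruence. For a family defined by restriction to G/e, base change reduces the question to norms
  from a G-set W over G/e. Such a W is a disjoint union of copies of G/e, so its norm is a product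
  of restrictions, and congruences can be multiplied.

  The ideal generated by one element of T(G/e) need not be invariant under the automorphisms of G/e.
  The norm to the point followed by restriction turns the element into a multiple of itself that is
  invariant.\<close>

locale finite_group = group G for G :: "('g, 'b) monoid_scheme" (structure) +
  assumes finite_carrier: "finite (carrier G)"
begin

text \<open>Bijectivity comes from the last two laws: \<open>a (inv g)\<close> is a two-sided
  inverse of \<open>a g\<close>. The assumption \<open>ext\<close> is there because
  \<open>Bij S\<close> consists of extensional maps.\<close>

lemma fin_gsetI:
  assumes fin: "finite S"
    and ext: "\<And>g. g \<in> carrier G \<Longrightarrow> a g \<in> extensional S"
    and closed: "\<And>g x. g \<in> carrier G \<Longrightarrow> x \<in> S \<Longrightarrow> a g x \<in> S"
    and one: "\<And>x. x \<in> S \<Longrightarrow> a \<one> x = x"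
    and mult: "\<And>g h x. g \<in> carrier G \<Longrightarrow> h \<in> carrier G \<Longrightarrow> x \<in> S \<Longrightarrow> a (g \<otimes> h) x = a g (a h x)"
  shows "fin_gset G (S, a)"
proof -
  have bij: "a g \<in> Bij S" if g: "g \<in> carrier G" for g
  proof -
    have "bij_betw (a g) S S"
    proof (rule bij_betw_byWitness[where f' = "a (inv g)"])
      show "\<forall>x\<in>S. a (inv g) (a g x) = x"
        using mult[of "inv g" g] g one by simp
      show "\<forall>x\<in>S. a g (a (inv g) x) = x"
        using mult[of g "inv g"] g one by simp
    qed (use g closed in auto)
    then show ?thesis
      using ext[OF g] by (simp add: Bij_def)
  qed
  have "a \<in> hom G (BijGroup S)"
  proof (rule homI)
    fix g h assume gh: "g \<in> carrier G" "h \<in> carrier G"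
    have "a (g \<otimes> h) = compose S (a g) (a h)"
      by (rule extensionalityI[of _ S]) (use gh ext mult in \<open>auto simp: compose_def\<close>)
    then show "a (g \<otimes> h) = a g \<otimes>\<^bsub>BijGroup S\<^esub> a h"
      using bij gh by (simp add: BijGroup_def)
  qed (use bij in \<open>simp add: BijGroup_def\<close>)
  then show ?thesis
    using fin by (simp add: fin_gset_def group_action_def group_hom_def group_hom_axioms_def
        group_BijGroup is_group)
qed

lemma finite_pts [simp]: "fin_gset G X \<Longrightarrow> finite (pts X)"
  by (simp add: fin_gset_def)

lemma fin_gset_action: "fin_gset G X \<Longrightarrow> group_action G (pts X) (act X)"
  by (simp add: fin_gset_def)

lemma act_closed: "\<lbrakk>fin_gset G X; g \<in> carrier G; x \<in> pts X\<rbrakk> \<Longrightarrow> act X g x \<in> pts X"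
  using group_action.element_image fin_gset_action by fastforce

lemma act_one: "\<lbrakk>fin_gset G X; x \<in> pts X\<rbrakk> \<Longrightarrow> act X \<one> x = x"
  using group_action.id_eq_one[OF fin_gset_action] by (metis restrict_apply')

lemma act_mult:
  "\<lbrakk>fin_gset G X; g \<in> carrier G; h \<in> carrier G; x \<in> pts X\<rbrakk> \<Longrightarrow> act X (g \<otimes> h) x = act X g (act X h x)"
  using group_action.composition_rule[OF fin_gset_action] .

lemma act_inv: "\<lbrakk>fin_gset G X; g \<in> carrier G; x \<in> pts X\<rbrakk> \<Longrightarrow> act X (inv g) (act X g x) = x"
  by (metis act_mult act_one inv_closed l_inv)

lemma gmapI:
  "\<lbrakk>\<And>x. x \<in> pts X \<Longrightarrow> f x \<in> pts Y; f \<in> extensional (pts X);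
    \<And>g x. g \<in> carrier G \<Longrightarrow> x \<in> pts X \<Longrightarrow> f (act X g x) = act Y g (f x)\<rbrakk> \<Longrightarrow> f \<in> gmap G X Y"
  by (auto simp: gmap_def PiE_def)

lemma gmap_closed: "\<lbrakk>f \<in> gmap G X Y; x \<in> pts X\<rbrakk> \<Longrightarrow> f x \<in> pts Y"
  by (auto simp: gmap_def)

lemma gmap_ext: "f \<in> gmap G X Y \<Longrightarrow> f \<in> extensional (pts X)"
  by (auto simp: gmap_def PiE_def)

lemma gmap_equivariant:
  "\<lbrakk>f \<in> gmap G X Y; g \<in> carrier G; x \<in> pts X\<rbrakk> \<Longrightarrow> f (act X g x) = act Y g (f x)"
  by (auto simp: gmap_def)

lemma gmap_eqI: "\<lbrakk>f \<in> gmap G X Y; f' \<in> gmap G X Z; \<And>x. x \<in> pts X \<Longrightarrow> f x = f' x\<rbrakk> \<Longrightarrow> f = f'"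
  by (meson extensionalityI gmap_ext)

lemma gmap_id_closed: "fin_gset G X \<Longrightarrow> gmap_id X \<in> gmap G X X"
  by (rule gmapI) (auto simp: gmap_id_def act_closed)

lemma compose_gmap:
  "\<lbrakk>fin_gset G X; f \<in> gmap G X Y; g \<in> gmap G Y Z\<rbrakk> \<Longrightarrow> compose (pts X) g f \<in> gmap G X Z"
  by (rule gmapI) (auto simp: compose_def gmap_closed gmap_equivariant act_closed)

lemma finite_gmap: "\<lbrakk>fin_gset G X; fin_gset G Y\<rbrakk> \<Longrightarrow> finite (gmap G X Y)"
  by (rule finite_subset[of _ "pts X \<rightarrow>\<^sub>E pts Y"]) (auto simp: gmap_def intro!: finite_PiE)

lemma gmap_inverse:
  assumes X: "fin_gset G X" and Y: "fin_gset G Y" and f: "f \<in> gmap G X Y"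
    and bij: "bij_betw f (pts X) (pts Y)"
  obtains f' where "f' \<in> gmap G Y X" "compose (pts Y) f f' = gmap_id Y"
    "compose (pts X) f' f = gmap_id X"
proof
  let ?f' = "\<lambda>y\<in>pts Y. inv_into (pts X) f y"
  have inv: "?f' y \<in> pts X" "f (?f' y) = y" if "y \<in> pts Y" for y
    using bij that by (auto simp: bij_betw_def inv_into_into f_inv_into_f)
  have inv': "?f' (f x) = x" if "x \<in> pts X" for x
    using bij that f by (auto simp: bij_betw_def gmap_closed)
  show "?f' \<in> gmap G Y X"
  proof (rule gmapI)
    fix g y assume gy: "g \<in> carrier G" "y \<in> pts Y"
    have "?f' (act Y g (f (?f' y))) = act X g (?f' y)"
      using inv(1)[OF gy(2)] inv' gmap_equivariant[OF f gy(1)] act_closed[OF X gy(1)] by metis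
    then show "?f' (act Y g y) = act X g (?f' y)"
      unfolding inv(2)[OF gy(2)] .
  qed (use inv in auto)
  show "compose (pts Y) f ?f' = gmap_id Y"
    using inv by (auto simp: compose_def gmap_id_def fun_eq_iff restrict_def)
  show "compose (pts X) ?f' f = gmap_id X"
    unfolding compose_def gmap_id_def using inv' by (intro restrict_ext) blast
qed

section \<open>Coset spaces and equivariant maps between them\<close>

lemma pts_coset: "pts (coset_gset G H) = (\<lambda>g. (g <# H, 0)) ` carrier G"
  by (simp add: coset_gset_def Let_def)

lemma act_coset:
  assumes "H \<subseteq> carrier G" "g \<in> carrier G" "k \<in> carrier G"
  shows "act (coset_gset G H) g (k <# H, 0) = ((g \<otimes> k) <# H, 0)"
  using assms by (auto simp: coset_gset_def Let_def lcos_m_assoc)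

lemma fin_gset_coset:
  assumes "subgroup H G"
  shows "fin_gset G (coset_gset G H)"
proof -
  note H = subgroup.subset[OF assms]
  have "fin_gset G (pts (coset_gset G H), act (coset_gset G H))"
    by (rule fin_gsetI)
      (auto simp: pts_coset act_coset[OF H] m_assoc finite_carrier,
        auto simp: coset_gset_def Let_def)
  then show ?thesis by simp
qed

lemma pts_coset_nonempty: "pts (coset_gset G H) \<noteq> {}"
  by (auto simp: pts_coset)

lemma card_pts_coset:
  assumes "subgroup H G"
  shows "card (pts (coset_gset G H)) * card H = order G"
proof -
  have "pts (coset_gset G H) = (\<lambda>C. (C, 0)) ` (lcosets H)"
    by (auto simp: pts_coset LCOSETS_def)
  then show ?thesis
    using l_lagrange[OF finite_carrier assms] by (simp add: card_image inj_on_def)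
qed

lemma lcoset_eq_stabilizes:
  assumes H: "subgroup H G" and X: "fin_gset G X" and x: "x \<in> pts X"
    and stab: "\<And>h. h \<in> H \<Longrightarrow> act X h x = x"
    and gk: "g \<in> carrier G" "k \<in> carrier G" "g <# H = k <# H"
  shows "act X g x = act X k x"
proof -
  have "g \<in> k <# H"
    using lcos_self[OF gk(1) H] gk(3) by simp
  then obtain h where "h \<in> H" "g = k \<otimes> h"
    by (auto simp: l_coset_def)
  then show ?thesis
    using act_mult[OF X gk(2) _ x] stab subgroup.mem_carrier[OF H] by simp
qed

text \<open>G/H represents the functor of H-fixed points. The map is written with a chosen
  representative of each coset, and \<open>lcoset_eq_stabilizes\<close> makes its value independent
  of the choice.\<close>

lemma coset_gmap:
  assumes H: "subgroup H G" and X: "fin_gset G X" and x: "x \<in> pts X"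
    and stab: "\<And>h. h \<in> H \<Longrightarrow> act X h x = x"
  obtains i where "i \<in> gmap G (coset_gset G H) X"
    "\<And>g. g \<in> carrier G \<Longrightarrow> i (g <# H, 0) = act X g x"
proof
  note HG = subgroup.subset[OF H]
  let ?i = "\<lambda>p\<in>pts (coset_gset G H). act X (SOME g. g \<in> carrier G \<and> p = (g <# H, 0)) x"
  show i: "?i (g <# H, 0) = act X g x" if g: "g \<in> carrier G" for g
  proof -
    define k where "k = (SOME k. k \<in> carrier G \<and> (g <# H, 0 :: nat) = (k <# H, 0))"
    have "k \<in> carrier G \<and> (g <# H, 0 :: nat) = (k <# H, 0)"
      unfolding k_def by (rule someI[of _ g]) (simp add: g)
    then have "act X k x = act X g x"
      using lcoset_eq_stabilizes[OF H X x stab g, of k] by auto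
    moreover have "(g <# H, 0) \<in> pts (coset_gset G H)"
      using g by (auto simp: pts_coset)
    ultimately show ?thesis
      unfolding k_def by (simp only: restrict_apply')
  qed
  show "?i \<in> gmap G (coset_gset G H) X"
  proof (rule gmapI)
    fix p assume "p \<in> pts (coset_gset G H)"
    then show "?i p \<in> pts X"
      using i act_closed[OF X _ x] unfolding pts_coset by (metis (no_types, lifting) imageE)
  next
    fix g p assume g: "g \<in> carrier G" and "p \<in> pts (coset_gset G H)"
    then obtain k where k: "k \<in> carrier G" "p = (k <# H, 0)"
      by (auto simp: pts_coset)
    show "?i (act (coset_gset G H) g p) = act X g (?i p)"
      using i[of "g \<otimes> k"] i[of k] g k act_mult[OF X g k(1) x] by (simp only: act_coset[OF HG] m_closed)
  qed auto
qed

text \<open>The coset \<open>H\<close> generates the whole orbit, which is the uniqueness half of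
  the universal property of G/H.\<close>

lemma gmap_coset_eqI:
  assumes H: "subgroup H G" and f: "f \<in> gmap G (coset_gset G H) X" "f' \<in> gmap G (coset_gset G H) X"
    and eq: "f (H, 0) = f' (H, 0)"
  shows "f = f'"
proof (rule gmap_eqI[OF f])
  note HG = subgroup.subset[OF H]
  have b: "(\<one> <# H, 0) = (H, 0)" "(H, 0) \<in> pts (coset_gset G H)"
    using lcos_mult_one[OF HG] by (auto simp: pts_coset image_iff intro!: bexI[of _ \<one>])
  fix p assume "p \<in> pts (coset_gset G H)"
  then obtain k where k: "k \<in> carrier G" "p = (k <# H, 0)"
    by (auto simp: pts_coset)
  then have "p = act (coset_gset G H) k (H, 0)"
    using act_coset[OF HG k(1) one_closed] b by simp
  then show "f p = f' p"
    using gmap_equivariant[OF f(1) k(1) b(2)] gmap_equivariant[OF f(2) k(1) b(2)] eq by simp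
qed

text \<open>The image is a nonempty stable subset of a transitive G-set.\<close>

lemma gmap_coset_surj:
  assumes H: "subgroup H G" and X: "fin_gset G X" and ne: "pts X \<noteq> {}"
    and f: "f \<in> gmap G X (coset_gset G H)"
  shows "f ` pts X = pts (coset_gset G H)"
proof
  note HG = subgroup.subset[OF H]
  obtain x where x: "x \<in> pts X" using ne by blast
  then obtain k where k: "k \<in> carrier G" "f x = (k <# H, 0)"
    using gmap_closed[OF f x] by (auto simp: pts_coset)
  show "pts (coset_gset G H) \<subseteq> f ` pts X"
  proof
    fix p assume "p \<in> pts (coset_gset G H)"
    then obtain g where g: "g \<in> carrier G" "p = (g <# H, 0)"
      by (auto simp: pts_coset)
    have "f (act X (g \<otimes> inv k) x) = p"
      using gmap_equivariant[OF f _ x] g k act_coset[OF HG _ k(1)] by (simp add: m_assoc)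
    then show "p \<in> f ` pts X"
      using act_closed[OF X _ x] g k by (intro image_eqI[of _ _ "act X (g \<otimes> inv k) x"]) auto
  qed
qed (use gmap_closed[OF f] in auto)

text \<open>A map from G/K to G/H is onto, so G/H has at most as many points as G/K; Lagrange's
  theorem reverses this into a bound on the subgroups. If the orders agree, it is a surjection
  between finite sets of equal size. This lets the main induction run on the order of H instead of
  on conjugacy classes of subgroups.\<close>

lemma gmap_coset_card:
  assumes K: "subgroup K G" and H: "subgroup H G" and f: "f \<in> gmap G (coset_gset G K) (coset_gset G H)"
  shows "card K \<le> card H"
    and "card K = card H \<Longrightarrow> bij_betw f (pts (coset_gset G K)) (pts (coset_gset G H))"
proof -
  let ?K = "pts (coset_gset G K)" and ?H = "pts (coset_gset G H)"
  note fin = finite_pts[OF fin_gset_coset[OF K]]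
  have surj: "f ` ?K = ?H"
    by (rule gmap_coset_surj[OF H fin_gset_coset[OF K] pts_coset_nonempty f])
  have pos: "card ?H > 0"
    using pts_coset_nonempty finite_pts[OF fin_gset_coset[OF H]] by (simp add: card_gt_0_iff)
  have le: "card ?H \<le> card ?K"
    using card_image_le[OF fin, of f] surj by simp
  have eq: "card ?K * card K = card ?H * card H"
    using card_pts_coset K H by simp
  have "card ?H * card K \<le> card ?H * card H"
    using le eq by (metis mult_le_mono1)
  then show "card K \<le> card H"
    using pos by simp
  assume "card K = card H"
  moreover have "card K > 0"
    using subgroup.one_closed[OF K] finite_subset[OF subgroup.subset[OF K] finite_carrier]
    by (auto simp: card_gt_0_iff)
  ultimately have "card ?K = card ?H"
    using eq by simp
  then show "bij_betw f ?K ?H"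
    using surj fin by (simp add: bij_betw_def eq_card_imp_inj_on)
qed

section \<open>The empty G-set, coproducts and the decomposition into orbits\<close>

definition empty_gset :: "'g gset" where
  "empty_gset = ({}, \<lambda>_ _. undefined)"

lemma empty_gset: "pts empty_gset = {}" "fin_gset G empty_gset"
  unfolding empty_gset_def by (simp, rule fin_gsetI) auto

text \<open>Maps are extensional, so on an empty domain the constant \<open>undefined\<close> is the
  only candidate.\<close>

lemma gmap_empty: "pts X = {} \<Longrightarrow> (\<lambda>_. undefined) \<in> gmap G X Y"
  by (rule gmapI) auto

lemma subgset:
  assumes W: "fin_gset G W" and S: "S \<subseteq> pts W"
    and closed: "\<And>g x. g \<in> carrier G \<Longrightarrow> x \<in> S \<Longrightarrow> act W g x \<in> S"
  shows "fin_gset G (S, \<lambda>g. restrict (act W g) S)"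
    and "(\<lambda>x\<in>S. x) \<in> gmap G (S, \<lambda>g. restrict (act W g) S) W"
proof -
  have mem: "x \<in> pts W" if "x \<in> S" for x
    using that S by auto
  show "fin_gset G (S, \<lambda>g. restrict (act W g) S)"
    by (rule fin_gsetI) (use S finite_subset[OF S] W closed in \<open>auto simp: act_one[OF W mem] act_mult[OF W _ _ mem]\<close>)
  show "(\<lambda>x\<in>S. x) \<in> gmap G (S, \<lambda>g. restrict (act W g) S) W"
    by (rule gmapI) (use mem closed in auto)
qed

text \<open>The complement of the image is stable because \<open>inv g\<close> would carry a point
  of the image back into the image.\<close>

lemma coproduct_complement:
  assumes X: "fin_gset G X" and W: "fin_gset G W" and i: "i \<in> gmap G X W" and inj: "inj_on i (pts X)"
  obtains W' j where "is_coproduct G X W' W i j" "card (pts W') + card (pts X) = card (pts W)"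
proof
  let ?S = "pts W - i ` pts X"
  let ?W' = "(?S, \<lambda>g. restrict (act W g) ?S)"
  have closed: "act W g x \<in> ?S" if gx: "g \<in> carrier G" "x \<in> ?S" for g x
  proof -
    have "False" if y: "y \<in> pts X" "act W g x = i y" for y
    proof -
      have "x = act W (inv g) (i y)"
        using act_inv[OF W gx(1), of x] gx(2) y(2) by simp
      also have "\<dots> = i (act X (inv g) y)"
        using gmap_equivariant[OF i _ y(1)] gx(1) by simp
      finally show False
        using gx act_closed[OF X _ y(1)] by auto
    qed
    then show ?thesis
      using act_closed[OF W gx(1)] gx(2) by auto
  qed
  show "is_coproduct G X ?W' W i (\<lambda>x\<in>?S. x)"
    using subgset[OF W Diff_subset closed] X W i inj gmap_closed[OF i]
    by (auto simp: is_coproduct_def inj_on_def)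
  have "card (i ` pts X) \<le> card (pts W)"
    using gmap_closed[OF i] W by (intro card_mono) auto
  then show "card (pts ?W') + card (pts X) = card (pts W)"
    using card_Diff_subset[of "i ` pts X" "pts W"] X gmap_closed[OF i] card_image[OF inj]
    by (auto simp: image_subset_iff)
qed

text \<open>The summand split off is the orbit of an arbitrary point, with \<open>H\<close> its
  stabilizer. The drop in the number of points drives the inductions over finite G-sets
  below.\<close>

lemma orbit_decomposition:
  assumes W: "fin_gset G W" and ne: "pts W \<noteq> {}"
  obtains H W' i j where "subgroup H G" "is_coproduct G (coset_gset G H) W' W i j"
    "card (pts W') < card (pts W)"
proof -
  obtain w where w: "w \<in> pts W" using ne by blast
  let ?H = "stabilizer G (act W) w"
  have H: "subgroup ?H G"
    using group_action.stabilizer_subgroup[OF fin_gset_action[OF W] w] .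
  have stab: "act W h w = w" if "h \<in> ?H" for h
    using that by (simp add: stabilizer_def)
  obtain i where i: "i \<in> gmap G (coset_gset G ?H) W"
    and iv: "\<And>g. g \<in> carrier G \<Longrightarrow> i (g <# ?H, 0) = act W g w"
    using coset_gmap[OF H W w stab] by blast
  have "inj_on i (pts (coset_gset G ?H))"
  proof (rule inj_onI)
    fix p q assume "p \<in> pts (coset_gset G ?H)" "q \<in> pts (coset_gset G ?H)" and eq: "i p = i q"
    then obtain g k where g: "g \<in> carrier G" "p = (g <# ?H, 0)" and k: "k \<in> carrier G" "q = (k <# ?H, 0)"
      by (auto simp: pts_coset)
    have "act W (inv g \<otimes> k) w = w"
      using eq g k iv act_mult[OF W _ _ w] act_inv[OF W g(1) w] by simp
    then have "inv g \<otimes> k \<in> ?H"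
      using g k by (simp add: stabilizer_def)
    then have "k \<in> g <# ?H"
      using g k by (auto simp: l_coset_def inv_solve_left' intro!: bexI[of _ "inv g \<otimes> k"] simp flip: m_assoc)
    then show "p = q"
      using g k l_repr_independence[OF _ g(1) H] by simp
  qed
  from coproduct_complement[OF fin_gset_coset[OF H] W i this]
  obtain W' j where c: "is_coproduct G (coset_gset G ?H) W' W i j"
    "card (pts W') + card (pts (coset_gset G ?H)) = card (pts W)" .
  moreover have "card (pts (coset_gset G ?H)) > 0"
    using pts_coset_nonempty finite_pts[OF fin_gset_coset[OF H]] by (simp add: card_gt_0_iff)
  ultimately show thesis
    using that[OF H c(1)] by simp
qed

section \<open>Pullbacks\<close>

lemma transported_gset:
  fixes S :: "'c set"
  assumes fin: "finite S"
    and closed: "\<And>g x. g \<in> carrier G \<Longrightarrow> x \<in> S \<Longrightarrow> a g x \<in> S"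
    and one: "\<And>x. x \<in> S \<Longrightarrow> a \<one> x = x"
    and mult: "\<And>g h x. g \<in> carrier G \<Longrightarrow> h \<in> carrier G \<Longrightarrow> x \<in> S \<Longrightarrow> a (g \<otimes> h) x = a g (a h x)"
  obtains X b where "fin_gset G X" "bij_betw b (pts X) S"
    "\<And>g v. g \<in> carrier G \<Longrightarrow> v \<in> pts X \<Longrightarrow> b (act X g v) = a g (b v)"
proof -
  obtain n :: "'c \<Rightarrow> nat" where n: "inj_on n S"
    using finite_imp_inj_to_nat_seg[OF fin] by blast
  \<comment> \<open>A set of pairs with an action has to be copied into the fixed type of points.
    The numbering \<open>n\<close> alone keeps the points apart, and the empty set merely fills the
    first component.\<close>
  define c :: "'c \<Rightarrow> 'g pt" where "c = (\<lambda>x. ({}, n x))"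
  have c: "inj_on c S"
    using n by (auto simp: c_def inj_on_def)
  let ?b = "inv_into S c"
  let ?X = "(c ` S, \<lambda>g. \<lambda>v\<in>c ` S. c (a g (?b v)))"
  have "fin_gset G ?X"
  proof (rule fin_gsetI)
    fix g h v assume "g \<in> carrier G" "h \<in> carrier G" "v \<in> c ` S"
    then show "(\<lambda>v\<in>c ` S. c (a (g \<otimes> h) (?b v))) v
        = (\<lambda>v\<in>c ` S. c (a g (?b v))) ((\<lambda>v\<in>c ` S. c (a h (?b v))) v)"
      using mult closed inv_into_f_f[OF c] by (elim imageE) simp
  qed (use fin c closed one in auto)
  moreover have "bij_betw ?b (pts ?X) S"
    using c by (simp add: bij_betw_inv_into inj_on_imp_bij_betw)
  moreover have "?b (act ?X g v) = a g (?b v)" if "g \<in> carrier G" "v \<in> pts ?X" for g v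
    using that c closed by auto
  ultimately show thesis by (rule that)
qed

lemma pullback_exists:
  assumes X: "fin_gset G X" and Y: "fin_gset G Y" and Y': "fin_gset G Y'"
    and f: "f \<in> gmap G X Y" and g: "g \<in> gmap G Y' Y"
  obtains X' f' g' where "is_pullback G X Y Y' X' f g f' g'"
proof -
  let ?S = "{(x, y') \<in> pts X \<times> pts Y'. f x = g y'}"
  let ?a = "\<lambda>h (x, y'). (act X h x, act Y' h y')"
  obtain X' b where X': "fin_gset G X'" and b: "bij_betw b (pts X') ?S"
    and ba: "\<And>g v. g \<in> carrier G \<Longrightarrow> v \<in> pts X' \<Longrightarrow> b (act X' g v) = ?a g (b v)"
  proof (rule transported_gset[of ?S ?a])
    show "finite ?S"
      by (rule finite_subset[of _ "pts X \<times> pts Y'"]) (use X Y' in auto)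
    show "?a h p \<in> ?S" if h: "h \<in> carrier G" and p: "p \<in> ?S" for h p
    proof -
      obtain x y where "p = (x, y)" "x \<in> pts X" "y \<in> pts Y'" "f x = g y"
        using p by auto
      then show ?thesis
        using act_closed[OF X h] act_closed[OF Y' h] gmap_equivariant[OF f h] gmap_equivariant[OF g h]
        by simp
    qed
    show "?a \<one> p = p" if "p \<in> ?S" for p
      using that X Y' by (auto simp: act_one)
    show "?a (h \<otimes> k) p = ?a h (?a k p)" if "h \<in> carrier G" "k \<in> carrier G" "p \<in> ?S" for h k p
      using that X Y' by (auto simp: act_mult)
  qed (use that in blast)
  have mem: "b v \<in> ?S" if "v \<in> pts X'" for v
    by (rule bspec[OF bij_betwE[OF b] that])
  have "is_pullback G X Y Y' X' f g (\<lambda>v\<in>pts X'. snd (b v)) (\<lambda>v\<in>pts X'. fst (b v))"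
    unfolding is_pullback_def
  proof (intro conjI X Y Y' X' f g)
    show "(\<lambda>v\<in>pts X'. snd (b v)) \<in> gmap G X' Y'" "(\<lambda>v\<in>pts X'. fst (b v)) \<in> gmap G X' X"
      by (rule gmapI; use mem in \<open>simp add: ba act_closed[OF X'] case_prod_beta mem_Times_iff\<close>)+
    show "bij_betw (\<lambda>v. ((\<lambda>v\<in>pts X'. fst (b v)) v, (\<lambda>v\<in>pts X'. snd (b v)) v)) (pts X') ?S"
      using b by (rule bij_betw_cong[THEN iffD1, rotated]) auto
  qed
  then show thesis by (rule that)
qed

lemma pullbackD:
  assumes "is_pullback G X Y Y' X' f g f' g'"
  shows "fin_gset G X" "fin_gset G Y" "fin_gset G Y'" "fin_gset G X'"
    "f \<in> gmap G X Y" "g \<in> gmap G Y' Y" "f' \<in> gmap G X' Y'" "g' \<in> gmap G X' X"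
  using assms by (auto simp: is_pullback_def)

text \<open>The kernel pair of an injection is the diagonal. Base change along this square says that
  transfer or norm along \<open>f\<close>, followed by restriction along \<open>f\<close>, is the
  identity.\<close>

lemma pullback_mono:
  assumes X: "fin_gset G X" and Y: "fin_gset G Y" and f: "f \<in> gmap G X Y" and inj: "inj_on f (pts X)"
  shows "is_pullback G X Y X X f f (gmap_id X) (gmap_id X)"
  using assms gmap_id_closed[OF X]
  by (auto simp: is_pullback_def gmap_id_def bij_betw_def inj_on_def image_iff)

lemma coproduct_sym: "is_coproduct G X Y W i j \<Longrightarrow> is_coproduct G Y X W j i"
  by (auto simp: is_coproduct_def)

text \<open>The two summands have disjoint images. Base change along this square makes the passage
  from one summand to the other factor through the trivial value at the empty G-set.\<close>

lemma coproduct_pullback_empty: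
  assumes "is_coproduct G X Y W i j"
  shows "is_pullback G X W Y empty_gset i j (\<lambda>_. undefined) (\<lambda>_. undefined)"
  using assms gmap_empty[OF empty_gset(1)] empty_gset
  by (auto simp: is_coproduct_def is_pullback_def bij_betw_def)

end

section \<open>Restrictions, transfers and norms along orbits\<close>

locale finite_group_mackey = finite_group G + mackey_functor G M
  for G :: "('g, 'b) monoid_scheme" (structure) and M :: "('g, 'm) mackey"
begin

lemma val_group: "fin_gset G X \<Longrightarrow> group (mval M X)"
  using val_comm_group comm_group.axioms(2) by blast

lemma res_closed:
  "\<lbrakk>fin_gset G X; fin_gset G Y; f \<in> gmap G X Y; m \<in> carrier (mval M Y)\<rbrakk>
    \<Longrightarrow> mres M X Y f m \<in> carrier (mval M X)"
  using res_hom hom_in_carrier by fastforce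

lemma tr_closed:
  "\<lbrakk>fin_gset G X; fin_gset G Y; f \<in> gmap G X Y; m \<in> carrier (mval M X)\<rbrakk>
    \<Longrightarrow> mtr M X Y f m \<in> carrier (mval M Y)"
  using tr_hom hom_in_carrier by fastforce

lemma tr_one:
  "\<lbrakk>fin_gset G X; fin_gset G Y; f \<in> gmap G X Y\<rbrakk> \<Longrightarrow> mtr M X Y f \<one>\<^bsub>mval M X\<^esub> = \<one>\<^bsub>mval M Y\<^esub>"
  using hom_one[OF tr_hom] val_group by blast

lemma res_one:
  "\<lbrakk>fin_gset G X; fin_gset G Y; f \<in> gmap G X Y\<rbrakk> \<Longrightarrow> mres M X Y f \<one>\<^bsub>mval M Y\<^esub> = \<one>\<^bsub>mval M X\<^esub>"
  using hom_one[OF res_hom] val_group by blast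

lemma res_tr_mono:
  assumes "fin_gset G X" "fin_gset G Y" "f \<in> gmap G X Y" "inj_on f (pts X)" "m \<in> carrier (mval M X)"
  shows "mres M X Y f (mtr M X Y f m) = m"
  using base_change[OF pullback_mono] assms by (simp add: res_id tr_id)

text \<open>For the inverse \<open>f'\<close> of \<open>f\<close>, restricting along
  \<open>f\<close> and then along \<open>f'\<close> changes nothing, while restricting along
  \<open>f\<close> undoes the transfer. Thus a set that absorbs restrictions absorbs these transfers
  as well.\<close>

lemma tr_bij:
  assumes X: "fin_gset G X" and Y: "fin_gset G Y" and f: "f \<in> gmap G X Y"
    and bij: "bij_betw f (pts X) (pts Y)"
  obtains f' where "f' \<in> gmap G Y X"
    "\<And>m. m \<in> carrier (mval M X) \<Longrightarrow> mtr M X Y f m = mres M Y X f' m"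
proof -
  obtain f' where f': "f' \<in> gmap G Y X" "compose (pts Y) f f' = gmap_id Y"
    using gmap_inverse[OF X Y f bij] by metis
  have "mtr M X Y f m = mres M Y X f' m" if m: "m \<in> carrier (mval M X)" for m
    using res_comp[OF Y X Y f'(1) f tr_closed[OF X Y f m]] f'(2) res_id[OF Y tr_closed[OF X Y f m]]
      res_tr_mono[OF X Y f _ m] bij by (simp add: bij_betw_def)
  then show thesis using that[OF f'(1)] by blast
qed

context
  fixes X Y W i j
  assumes copr: "is_coproduct G X Y W i j"
begin

lemma coproductD:
  "fin_gset G X" "fin_gset G Y" "fin_gset G W" "i \<in> gmap G X W" "j \<in> gmap G Y W"
  "inj_on i (pts X)" "inj_on j (pts Y)"
  using copr by (auto simp: is_coproduct_def)

lemma res_tr_disjoint: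
  assumes "m \<in> carrier (mval M X)"
  shows "mres M Y W j (mtr M X W i m) = \<one>\<^bsub>mval M Y\<^esub>"
proof -
  note e = gmap_empty[OF empty_gset(1)]
  have "mres M empty_gset X (\<lambda>_. undefined) m = \<one>\<^bsub>mval M empty_gset\<^esub>"
    using res_closed[OF empty_gset(2) coproductD(1) e assms] additive_empty[OF empty_gset(2,1)] by simp
  then show ?thesis
    using base_change[OF coproduct_pullback_empty[OF copr] assms] tr_one[OF empty_gset(2) coproductD(2) e]
    by simp
qed

end

text \<open>Both sides have the same restrictions to the two summands: a transfer from a summand
  restricts to the identity there and to the neutral element on the other one. Additivity then
  identifies the two sides.\<close>

lemma coproduct_decomposition:
  assumes c: "is_coproduct G X Y W i j" and w: "w \<in> carrier (mval M W)"
  shows "w = mtr M X W i (mres M X W i w) \<otimes>\<^bsub>mval M W\<^esub> mtr M Y W j (mres M Y W j w)" (is "w = ?v")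
proof -
  note D = coproductD[OF c]
  note c' = coproduct_sym[OF c]
  interpret X: group "mval M X" by (rule val_group[OF D(1)])
  interpret Y: group "mval M Y" by (rule val_group[OF D(2)])
  interpret W: group "mval M W" by (rule val_group[OF D(3)])
  note rc = res_closed[OF D(1,3,4) w] res_closed[OF D(2,3,5) w]
  note tc = tr_closed[OF D(1,3,4) rc(1)] tr_closed[OF D(2,3,5) rc(2)]
  have "mres M X W i ?v = mres M X W i w"
    using hom_mult[OF res_hom[OF D(1,3,4)] tc] res_tr_mono[OF D(1,3,4,6) rc(1)]
      res_tr_disjoint[OF c' rc(2)] rc by simp
  moreover have "mres M Y W j ?v = mres M Y W j w"
    using hom_mult[OF res_hom[OF D(2,3,5)] tc] res_tr_mono[OF D(2,3,5,7) rc(2)]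
      res_tr_disjoint[OF c rc(1)] rc by simp
  ultimately show ?thesis
    using inj_onD[OF bij_betw_imp_inj_on[OF additive[OF c]], of w ?v] w tc by simp
qed

lemma tr_coproduct:
  assumes c: "is_coproduct G X Y W i j" and Z: "fin_gset G Z" and f: "f \<in> gmap G W Z"
    and w: "w \<in> carrier (mval M W)"
  shows "mtr M W Z f w = mtr M X Z (compose (pts X) f i) (mres M X W i w)
    \<otimes>\<^bsub>mval M Z\<^esub> mtr M Y Z (compose (pts Y) f j) (mres M Y W j w)"
proof -
  note D = coproductD[OF c]
  note rc = res_closed[OF D(1,3,4) w] res_closed[OF D(2,3,5) w]
  note tc = tr_closed[OF D(1,3,4) rc(1)] tr_closed[OF D(2,3,5) rc(2)]
  show ?thesis
    using arg_cong[OF coproduct_decomposition[OF c w], of "mtr M W Z f"]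
      hom_mult[OF tr_hom[OF D(3) Z f] tc] tr_comp[OF D(1,3) Z D(4) f rc(1)]
      tr_comp[OF D(2,3) Z D(5) f rc(2)] by simp
qed

text \<open>Orbits \<open>G/K\<close> of \<open>W\<close> with \<open>|K| < |H|\<close> contribute nothing, and those with \<open>|K| = |H|\<close> map
  isomorphically to \<open>G/H\<close>, so that the transfer is a restriction.\<close>

lemma tr_mem_if_res_mem:
  assumes H: "subgroup H G" and S: "subgroup S (mval M (coset_gset G H))"
    and zero: "\<And>K. \<lbrakk>subgroup K G; card K < card H\<rbrakk>
      \<Longrightarrow> carrier (mval M (coset_gset G K)) = {\<one>\<^bsub>mval M (coset_gset G K)\<^esub>}"
    and W: "fin_gset G W" and f: "f \<in> gmap G W (coset_gset G H)"
    and w: "w \<in> carrier (mval M W)"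
    and res: "\<And>h. h \<in> gmap G (coset_gset G H) W \<Longrightarrow> mres M (coset_gset G H) W h w \<in> S"
  shows "mtr M W (coset_gset G H) f w \<in> S"
  using W f w res
proof (induction "card (pts W)" arbitrary: W f w rule: less_induct)
  case less
  let ?H = "coset_gset G H"
  note W = less.prems(1) and f = less.prems(2) and w = less.prems(3) and res = less.prems(4)
  note FH = fin_gset_coset[OF H]
  show ?case
  proof (cases "pts W = {}")
    case True
    then have "w = \<one>\<^bsub>mval M W\<^esub>"
      using additive_empty[OF W] w by simp
    then show ?thesis
      using tr_one[OF W FH f] subgroup.one_closed[OF S] by simp
  next
    case False
    obtain K W' i j where K: "subgroup K G" and c: "is_coproduct G (coset_gset G K) W' W i j"
      and lt: "card (pts W') < card (pts W)"
      using orbit_decomposition[OF W False] .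
    let ?K = "coset_gset G K"
    note D = coproductD[OF c]
    note fi = compose_gmap[OF D(1,4) f] and fj = compose_gmap[OF D(2,5) f]
    note rc = res_closed[OF D(1,3,4) w] res_closed[OF D(2,3,5) w]
    have "mtr M ?K ?H (compose (pts ?K) f i) (mres M ?K W i w) \<in> S"
    proof (cases "card K < card H")
      case True
      then have "mres M ?K W i w = \<one>\<^bsub>mval M ?K\<^esub>"
        using zero[OF K True] rc(1) by simp
      then show ?thesis
        using tr_one[OF D(1) FH fi] subgroup.one_closed[OF S] by simp
    next
      case False
      then have "card K = card H"
        using gmap_coset_card(1)[OF K H fi] by simp
      then have "bij_betw (compose (pts ?K) f i) (pts ?K) (pts ?H)"
        by (rule gmap_coset_card(2)[OF K H fi])
      then obtain h where h: "h \<in> gmap G ?H ?K"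
        "\<And>m. m \<in> carrier (mval M ?K) \<Longrightarrow> mtr M ?K ?H (compose (pts ?K) f i) m = mres M ?H ?K h m"
        using tr_bij[OF D(1) FH fi] by metis
      show ?thesis
        using h(2)[OF rc(1)] res_comp[OF FH D(1,3) h(1) D(4) w] res[OF compose_gmap[OF FH h(1) D(4)]]
        by simp
    qed
    moreover have "mtr M W' ?H (compose (pts W') f j) (mres M W' W j w) \<in> S"
    proof (rule less.hyps[OF lt D(2) fj rc(2)])
      fix h assume h: "h \<in> gmap G ?H W'"
      show "mres M ?H W' h (mres M W' W j w) \<in> S"
        using res_comp[OF FH D(2,3) h D(5) w] res[OF compose_gmap[OF FH h D(5)]] by simp
    qed
    ultimately show ?thesis
      unfolding tr_coproduct[OF c FH f w] by (rule subgroup.m_closed[OF S])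
  qed
qed

lemma mackey_zero_if_zero_on_orbits:
  assumes zero: "\<And>H. subgroup H G
      \<Longrightarrow> carrier (mval M (coset_gset G H)) = {\<one>\<^bsub>mval M (coset_gset G H)\<^esub>}"
  shows "mackey_zero G M"
proof -
  have "m = \<one>\<^bsub>mval M X\<^esub>" if "fin_gset G X" "m \<in> carrier (mval M X)" for X m
    using that
  proof (induction "card (pts X)" arbitrary: X m rule: less_induct)
    case less
    note X = less.prems(1) and m = less.prems(2)
    show ?case
    proof (cases "pts X = {}")
      case True
      then show ?thesis using additive_empty[OF X] m by simp
    next
      case False
      obtain K W' i j where K: "subgroup K G" and c: "is_coproduct G (coset_gset G K) W' X i j"
        and lt: "card (pts W') < card (pts X)"
        using orbit_decomposition[OF X False] .
      note D = coproductD[OF c]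
      interpret X: group "mval M X" by (rule val_group[OF X])
      have "mres M (coset_gset G K) X i m = \<one>\<^bsub>mval M (coset_gset G K)\<^esub>"
        using zero[OF K] res_closed[OF D(1,3,4) m] by simp
      moreover have "mres M W' X j m = \<one>\<^bsub>mval M W'\<^esub>"
        using less.hyps[OF lt D(2) res_closed[OF D(2,3,5) m]] .
      ultimately show ?thesis
        using coproduct_decomposition[OF c m] tr_one[OF D(1,3,4)] tr_one[OF D(2,3,5)] by simp
    qed
  qed
  then show ?thesis
    unfolding mackey_zero_def using monoid.one_closed[OF group.is_monoid[OF val_group]] by blast
qed

end

section \<open>Norms along bijections, coproducts and surjections\<close>

lemma additive_part_simps [simp]:
  "mval (additive_part T) X = add_monoid (tval T X)"
  "mres (additive_part T) = tres T" "mtr (additive_part T) = ttr T"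
  by (simp_all add: additive_part_def)

locale finite_group_tambara = finite_group G + tambara_functor G T
  for G :: "('g, 'b) monoid_scheme" (structure) and T :: "('g, 'r) tambara"

sublocale finite_group_tambara \<subseteq> mk: finite_group_mackey G "additive_part T"
  by (intro finite_group_mackey.intro finite_group_axioms additive.mackey_functor_axioms)

context finite_group_tambara
begin

lemma val_ring: "fin_gset G X \<Longrightarrow> ring (tval T X)"
  using val_cring cring.axioms(1) by blast

lemma tres_closed:
  "\<lbrakk>fin_gset G X; fin_gset G Y; f \<in> gmap G X Y; x \<in> carrier (tval T Y)\<rbrakk>
    \<Longrightarrow> tres T X Y f x \<in> carrier (tval T X)"
  using mk.res_closed by simp

lemma ttr_closed:
  "\<lbrakk>fin_gset G X; fin_gset G Y; f \<in> gmap G X Y; x \<in> carrier (tval T X)\<rbrakk>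
    \<Longrightarrow> ttr T X Y f x \<in> carrier (tval T Y)"
  using mk.tr_closed by simp

lemma tnm_closed:
  "\<lbrakk>fin_gset G X; fin_gset G Y; f \<in> gmap G X Y; x \<in> carrier (tval T X)\<rbrakk>
    \<Longrightarrow> tnm T X Y f x \<in> carrier (tval T Y)"
  using nm_hom hom_in_carrier by fastforce

lemma tres_comp: "\<lbrakk>fin_gset G X; fin_gset G Y; fin_gset G Z; f \<in> gmap G X Y; g \<in> gmap G Y Z;
    x \<in> carrier (tval T Z)\<rbrakk>
  \<Longrightarrow> tres T X Z (compose (pts X) g f) x = tres T X Y f (tres T Y Z g x)"
  using additive.res_comp by simp

lemma tres_id: "\<lbrakk>fin_gset G X; x \<in> carrier (tval T X)\<rbrakk> \<Longrightarrow> tres T X X (gmap_id X) x = x"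
  using additive.res_id by simp

lemma tval_empty: "\<lbrakk>fin_gset G X; pts X = {}; x \<in> carrier (tval T X); y \<in> carrier (tval T X)\<rbrakk> \<Longrightarrow> x = y"
  using additive.additive_empty[of X] by simp

lemma tres_tnm_mono:
  assumes "fin_gset G X" "fin_gset G Y" "f \<in> gmap G X Y" "inj_on f (pts X)" "x \<in> carrier (tval T X)"
  shows "tres T X Y f (tnm T X Y f x) = x"
  using nm_base_change[OF pullback_mono] assms by (simp add: tres_id nm_id)

lemma tnm_bij:
  assumes X: "fin_gset G X" and Y: "fin_gset G Y" and f: "f \<in> gmap G X Y"
    and bij: "bij_betw f (pts X) (pts Y)"
  obtains f' where "f' \<in> gmap G Y X"
    "\<And>x. x \<in> carrier (tval T X) \<Longrightarrow> tnm T X Y f x = tres T Y X f' x"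
proof -
  obtain f' where f': "f' \<in> gmap G Y X" "compose (pts Y) f f' = gmap_id Y"
    using gmap_inverse[OF X Y f bij] by metis
  have "tnm T X Y f x = tres T Y X f' x" if x: "x \<in> carrier (tval T X)" for x
    using tres_comp[OF Y X Y f'(1) f tnm_closed[OF X Y f x]] f'(2) tres_id[OF Y tnm_closed[OF X Y f x]]
      tres_tnm_mono[OF X Y f _ x] bij by (simp add: bij_betw_def)
  then show thesis using that[OF f'(1)] by blast
qed

lemma tres_tnm_disjoint:
  assumes c: "is_coproduct G X Y W i j" and x: "x \<in> carrier (tval T X)"
  shows "tres T Y W j (tnm T X W i x) = \<one>\<^bsub>tval T Y\<^esub>"
proof -
  note D = mk.coproductD[OF c]
  note e = gmap_empty[OF empty_gset(1)]
  interpret O: ring "tval T empty_gset" by (rule val_ring[OF empty_gset(2)])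
  have "tres T empty_gset X (\<lambda>_. undefined) x = \<one>\<^bsub>tval T empty_gset\<^esub>"
    using tval_empty[OF empty_gset(2,1) tres_closed[OF empty_gset(2) D(1) e x]] by simp
  then show ?thesis
    using nm_base_change[OF coproduct_pullback_empty[OF c] x] nm_one[OF empty_gset(2) D(2) e] by simp
qed

lemma tres_coproduct_eqI:
  assumes c: "is_coproduct G X Y W i j" and "w \<in> carrier (tval T W)" "v \<in> carrier (tval T W)"
    and "tres T X W i w = tres T X W i v" "tres T Y W j w = tres T Y W j v"
  shows "w = v"
  using inj_onD[OF bij_betw_imp_inj_on[OF additive.additive[OF c]], of w v] assms by simp

text \<open>The norm along the inclusion of a summand extends an element by 1 on the other summand,
  as the transfer extends it by 0. So \<open>w\<close> is the product of the norms of its two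
  restrictions.\<close>

lemma tnm_coproduct:
  assumes c: "is_coproduct G X Y W i j" and Z: "fin_gset G Z" and f: "f \<in> gmap G W Z"
    and w: "w \<in> carrier (tval T W)"
  shows "tnm T W Z f w = tnm T X Z (compose (pts X) f i) (tres T X W i w)
    \<otimes>\<^bsub>tval T Z\<^esub> tnm T Y Z (compose (pts Y) f j) (tres T Y W j w)"
proof -
  note D = mk.coproductD[OF c]
  note c' = coproduct_sym[OF c]
  interpret X: ring "tval T X" by (rule val_ring[OF D(1)])
  interpret Y: ring "tval T Y" by (rule val_ring[OF D(2)])
  interpret W: ring "tval T W" by (rule val_ring[OF D(3)])
  note rc = tres_closed[OF D(1,3,4) w] tres_closed[OF D(2,3,5) w]
  note nc = tnm_closed[OF D(1,3,4) rc(1)] tnm_closed[OF D(2,3,5) rc(2)]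
  let ?v = "tnm T X W i (tres T X W i w) \<otimes>\<^bsub>tval T W\<^esub> tnm T Y W j (tres T Y W j w)"
  have "w = ?v"
  proof (rule tres_coproduct_eqI[OF c])
    show "tres T X W i w = tres T X W i ?v"
      using ring_hom_mult[OF res_ring_hom[OF D(1,3,4)] nc] tres_tnm_mono[OF D(1,3,4,6) rc(1)]
        tres_tnm_disjoint[OF c' rc(2)] rc by simp
    show "tres T Y W j w = tres T Y W j ?v"
      using ring_hom_mult[OF res_ring_hom[OF D(2,3,5)] nc] tres_tnm_mono[OF D(2,3,5,7) rc(2)]
        tres_tnm_disjoint[OF c rc(1)] rc by simp
  qed (use w nc in auto)
  from arg_cong[OF this, of "tnm T W Z f"] show ?thesis
    using hom_mult[OF nm_hom[OF D(3) Z f] nc] nm_comp[OF D(1,3) Z D(4) f rc(1)]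
      nm_comp[OF D(2,3) Z D(5) f rc(2)] by simp
qed

text \<open>Zero is a transfer from the empty G-set, so the exponential formula applies with empty
  A. Over a point with nonempty fibre there is no section into the empty set; as \<open>f\<close> is
  onto, the dependent product is empty and the norm is a transfer from the empty G-set. A point
  outside the image would have the empty section and contribute 1 instead.\<close>

lemma tnm_zero:
  assumes X: "fin_gset G X" and Y: "fin_gset G Y" and f: "f \<in> gmap G X Y"
    and surj: "f ` pts X = pts Y"
  shows "tnm T X Y f \<zero>\<^bsub>tval T X\<^esub> = \<zero>\<^bsub>tval T Y\<^esub>"
proof -
  let ?u = "\<lambda>_. undefined"
  note e = gmap_empty[OF empty_gset(1)] and O = empty_gset(2)
  interpret O: ring "tval T empty_gset" by (rule val_ring[OF O])
  have "(\<Pi>\<^sub>E x\<in>{x \<in> pts X. f x = y}. {a \<in> pts empty_gset. ?u a = x}) = {}" if y: "y \<in> pts Y" for y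
  proof -
    obtain x where "x \<in> {x \<in> pts X. f x = y}"
      using y unfolding surj[symmetric] by auto
    then show ?thesis
      unfolding PiE_eq_empty_iff empty_gset(1) by (rule bexI[rotated]) simp
  qed
  then have "is_exponential G empty_gset X Y empty_gset empty_gset ?u f ?u ?u ?u ?u"
    using e O X Y f empty_gset(1)
    by (auto simp: is_exponential_def is_pullback_def bij_betw_def)
  note exp = nm_tr[OF this O.zero_closed]
  have "tnm T empty_gset empty_gset ?u (tres T empty_gset empty_gset ?u \<zero>\<^bsub>tval T empty_gset\<^esub>)
      = \<zero>\<^bsub>tval T empty_gset\<^esub>"
    by (rule tval_empty[OF O empty_gset(1) tnm_closed[OF O O e tres_closed[OF O O e O.zero_closed]]
          O.zero_closed])
  then show ?thesis
    using exp mk.tr_one[OF O X e] mk.tr_one[OF O Y e] by simp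
qed

end

section \<open>Quotients of Tambara functors\<close>

text \<open>Restrictions and transfers are additive, so closure of \<open>I\<close> suffices for
  them to descend to cosets. The norm is not, and its descent is demanded as a congruence between
  two elements.\<close>

locale tambara_congruence = finite_group_tambara G T
  for G :: "('g, 'b) monoid_scheme" (structure) and T :: "('g, 'r) tambara" +
  fixes I :: "'g gset \<Rightarrow> 'r set"
  assumes ideal: "fin_gset G X \<Longrightarrow> ideal (I X) (tval T X)"
    and res_mem: "\<lbrakk>fin_gset G X; fin_gset G Y; f \<in> gmap G X Y; x \<in> I Y\<rbrakk> \<Longrightarrow> tres T X Y f x \<in> I X"
    and tr_mem: "\<lbrakk>fin_gset G X; fin_gset G Y; f \<in> gmap G X Y; x \<in> I X\<rbrakk> \<Longrightarrow> ttr T X Y f x \<in> I Y"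
    and nm_cong: "\<lbrakk>fin_gset G X; fin_gset G Y; f \<in> gmap G X Y; x \<in> carrier (tval T X);
        y \<in> carrier (tval T X); x \<ominus>\<^bsub>tval T X\<^esub> y \<in> I X\<rbrakk>
      \<Longrightarrow> tnm T X Y f x \<ominus>\<^bsub>tval T Y\<^esub> tnm T X Y f y \<in> I Y"
begin

definition proj :: "'g gset \<Rightarrow> 'r \<Rightarrow> 'r set" where
  "proj X x = I X +>\<^bsub>tval T X\<^esub> x"

definition rep :: "'g gset \<Rightarrow> 'r set \<Rightarrow> 'r" where
  "rep X C = (SOME x. x \<in> carrier (tval T X) \<and> proj X x = C)"

text \<open>Values are cosets, hence of the type \<open>'r set\<close> that
  \<open>tambara_ideal\<close> prescribes for its target. The operations use chosen representatives;
  \<open>tres_quot\<close>, \<open>ttr_quot\<close> and \<open>tnm_quot\<close> remove the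
  choice.\<close>

definition quot :: "('g, 'r set) tambara" where
  "quot = \<lparr>tval = \<lambda>X. tval T X Quot I X,
    tres = \<lambda>X Y f C. proj X (tres T X Y f (rep Y C)),
    ttr = \<lambda>X Y f C. proj Y (ttr T X Y f (rep X C)),
    tnm = \<lambda>X Y f C. proj Y (tnm T X Y f (rep X C))\<rparr>"

lemma tval_quot: "tval quot X = tval T X Quot I X"
  by (simp add: quot_def)

lemma proj_eq_iff:
  "\<lbrakk>fin_gset G X; x \<in> carrier (tval T X); y \<in> carrier (tval T X)\<rbrakk>
    \<Longrightarrow> proj X x = proj X y \<longleftrightarrow> x \<ominus>\<^bsub>tval T X\<^esub> y \<in> I X"
  using ring.quotient_eq_iff_same_a_r_cos[OF val_ring ideal] by (simp add: proj_def)

lemma proj_hom: "fin_gset G X \<Longrightarrow> proj X \<in> ring_hom (tval T X) (tval quot X)"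
  using ideal.rcos_ring_hom[OF ideal] unfolding proj_def[abs_def] tval_quot by blast

lemma carrier_quot: "carrier (tval quot X) = proj X ` carrier (tval T X)"
  by (auto simp: tval_quot FactRing_def A_RCOSETS_def' proj_def)

lemma rep:
  assumes "x \<in> carrier (tval T X)"
  shows "rep X (proj X x) \<in> carrier (tval T X)" "proj X (rep X (proj X x)) = proj X x"
  using someI[of "\<lambda>y. y \<in> carrier (tval T X) \<and> proj X y = proj X x", OF conjI[OF assms refl]]
  by (auto simp: rep_def)

lemma rep_cong:
  "\<lbrakk>fin_gset G X; x \<in> carrier (tval T X)\<rbrakk> \<Longrightarrow> rep X (proj X x) \<ominus>\<^bsub>tval T X\<^esub> x \<in> I X"
  using proj_eq_iff rep by metis

lemma tres_quot:
  assumes X: "fin_gset G X" and Y: "fin_gset G Y" and f: "f \<in> gmap G X Y" and x: "x \<in> carrier (tval T Y)"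
  shows "tres quot X Y f (proj Y x) = proj X (tres T X Y f x)"
proof -
  interpret ring_hom_ring "tval T Y" "tval T X" "tres T X Y f"
    by (intro ring_hom_ringI2 val_ring res_ring_hom X Y f)
  show ?thesis
    using res_mem[OF X Y f rep_cong[OF Y x]] rep(1)[OF x] x
    by (simp add: quot_def proj_eq_iff[OF X] a_minus_def)
qed

lemma ttr_minus:
  assumes X: "fin_gset G X" and Y: "fin_gset G Y" and f: "f \<in> gmap G X Y"
    and xy: "x \<in> carrier (tval T X)" "y \<in> carrier (tval T X)"
  shows "ttr T X Y f (x \<ominus>\<^bsub>tval T X\<^esub> y) = ttr T X Y f x \<ominus>\<^bsub>tval T Y\<^esub> ttr T X Y f y"
proof -
  interpret X: ring "tval T X" by (rule val_ring[OF X])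
  interpret Y: ring "tval T Y" by (rule val_ring[OF Y])
  have hom: "ttr T X Y f \<in> hom (add_monoid (tval T X)) (add_monoid (tval T Y))"
    using additive.tr_hom[OF X Y f] by simp
  interpret h: group_hom "add_monoid (tval T X)" "add_monoid (tval T Y)" "ttr T X Y f"
    by (intro group_hom.intro group_hom_axioms.intro X.a_group Y.a_group hom)
  show ?thesis
    using hom_mult[OF hom, of x "\<ominus>\<^bsub>tval T X\<^esub> y"] h.hom_inv[of y, folded a_inv_def] xy
    by (simp add: a_minus_def)
qed

lemma ttr_quot:
  assumes X: "fin_gset G X" and Y: "fin_gset G Y" and f: "f \<in> gmap G X Y" and x: "x \<in> carrier (tval T X)"
  shows "ttr quot X Y f (proj X x) = proj Y (ttr T X Y f x)"
  using tr_mem[OF X Y f rep_cong[OF X x]] rep(1)[OF x] x ttr_closed[OF X Y f]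
  by (simp add: quot_def proj_eq_iff[OF Y] ttr_minus[OF X Y f])

lemma tnm_quot:
  assumes X: "fin_gset G X" and Y: "fin_gset G Y" and f: "f \<in> gmap G X Y" and x: "x \<in> carrier (tval T X)"
  shows "tnm quot X Y f (proj X x) = proj Y (tnm T X Y f x)"
  using nm_cong[OF X Y f _ x rep_cong[OF X x]] rep(1)[OF x] x tnm_closed[OF X Y f]
  by (simp add: quot_def proj_eq_iff[OF Y])

lemma tres_quot_ring_hom:
  assumes X: "fin_gset G X" and Y: "fin_gset G Y" and f: "f \<in> gmap G X Y"
  shows "tres quot X Y f \<in> ring_hom (tval quot Y) (tval quot X)"
proof -
  interpret Y: ring "tval T Y" by (rule val_ring[OF Y])
  note h = res_ring_hom[OF X Y f]
  note simps = tres_quot[OF X Y f] ring_hom_mult[OF proj_hom[OF Y], symmetric]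
    ring_hom_add[OF proj_hom[OF Y], symmetric] ring_hom_mult[OF proj_hom[OF X], symmetric]
    ring_hom_add[OF proj_hom[OF X], symmetric] ring_hom_one[OF proj_hom[OF X], symmetric]
    ring_hom_one[OF proj_hom[OF Y], symmetric] ring_hom_mult[OF h] ring_hom_add[OF h] ring_hom_one[OF h]
    ring_hom_closed[OF h]
  show ?thesis
    by (rule ring_hom_memI) (auto simp: simps carrier_quot)
qed

lemma ttr_quot_hom:
  assumes X: "fin_gset G X" and Y: "fin_gset G Y" and f: "f \<in> gmap G X Y"
  shows "ttr quot X Y f \<in> hom (add_monoid (tval quot X)) (add_monoid (tval quot Y))"
proof -
  interpret X: ring "tval T X" by (rule val_ring[OF X])
  have h: "ttr T X Y f (x \<oplus>\<^bsub>tval T X\<^esub> y) = ttr T X Y f x \<oplus>\<^bsub>tval T Y\<^esub> ttr T X Y f y"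
    if "x \<in> carrier (tval T X)" "y \<in> carrier (tval T X)" for x y
    using hom_mult[OF additive.tr_hom[OF X Y f]] that by simp
  note simps = ttr_quot[OF X Y f] ring_hom_add[OF proj_hom[OF X], symmetric]
    ring_hom_add[OF proj_hom[OF Y], symmetric] h ttr_closed[OF X Y f]
  show ?thesis
    by (rule homI) (auto simp: simps carrier_quot)
qed

lemma tnm_quot_hom:
  assumes X: "fin_gset G X" and Y: "fin_gset G Y" and f: "f \<in> gmap G X Y"
  shows "tnm quot X Y f \<in> hom (tval quot X) (tval quot Y)"
proof -
  interpret X: ring "tval T X" by (rule val_ring[OF X])
  note simps = tnm_quot[OF X Y f] ring_hom_mult[OF proj_hom[OF X], symmetric]
    ring_hom_mult[OF proj_hom[OF Y], symmetric] hom_mult[OF nm_hom[OF X Y f]] tnm_closed[OF X Y f]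
  show ?thesis
    by (rule homI) (auto simp: simps carrier_quot)
qed

text \<open>By \<open>coproduct_decomposition\<close>, \<open>w\<close> is a sum of transfers of
  elements of \<open>I\<close>. This gives injectivity in the additivity axiom of the
  quotient.\<close>

lemma coproduct_mem:
  assumes c: "is_coproduct G X Y W i j" and w: "w \<in> carrier (tval T W)"
    and mem: "tres T X W i w \<in> I X" "tres T Y W j w \<in> I Y"
  shows "w \<in> I W"
proof -
  note D = mk.coproductD[OF c]
  show ?thesis
    using mk.coproduct_decomposition[OF c] w
      additive_subgroup.a_closed[OF ideal.axioms(1)[OF ideal[OF D(3)]] tr_mem[OF D(1,3,4) mem(1)] tr_mem[OF D(2,3,5) mem(2)]] by simp
qed

lemma quot_additive:
  assumes c: "is_coproduct G X Y W i j"
  shows "bij_betw (\<lambda>m. (tres quot X W i m, tres quot Y W j m))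
    (carrier (tval quot W)) (carrier (tval quot X) \<times> carrier (tval quot Y))"
  unfolding bij_betw_def
proof
  note D = mk.coproductD[OF c]
  note r = tres_closed[OF D(1,3,4)] tres_closed[OF D(2,3,5)]
  note q = tres_quot[OF D(1,3,4)] tres_quot[OF D(2,3,5)]
  show "inj_on (\<lambda>m. (tres quot X W i m, tres quot Y W j m)) (carrier (tval quot W))"
  proof (rule inj_onI)
    fix m m' assume "m \<in> carrier (tval quot W)" "m' \<in> carrier (tval quot W)"
      and eq: "(tres quot X W i m, tres quot Y W j m) = (tres quot X W i m', tres quot Y W j m')"
    then obtain w v where w: "w \<in> carrier (tval T W)" "m = proj W w"
      and v: "v \<in> carrier (tval T W)" "m' = proj W v"
      by (auto simp: carrier_quot)
    interpret W: ring "tval T W" by (rule val_ring[OF D(3)])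
    interpret hX: ring_hom_ring "tval T W" "tval T X" "tres T X W i"
      by (intro ring_hom_ringI2 val_ring res_ring_hom D)
    interpret hY: ring_hom_ring "tval T W" "tval T Y" "tres T Y W j"
      by (intro ring_hom_ringI2 val_ring res_ring_hom D)
    have "w \<ominus>\<^bsub>tval T W\<^esub> v \<in> I W"
    proof (rule coproduct_mem[OF c])
      show "tres T X W i (w \<ominus>\<^bsub>tval T W\<^esub> v) \<in> I X" "tres T Y W j (w \<ominus>\<^bsub>tval T W\<^esub> v) \<in> I Y"
        using eq w v by (simp_all add: q proj_eq_iff[OF D(1)] proj_eq_iff[OF D(2)] r a_minus_def)
    qed (use w v in simp)
    then show "m = m'"
      using proj_eq_iff[OF D(3)] w v by simp
  qed
  show "(\<lambda>m. (tres quot X W i m, tres quot Y W j m)) ` carrier (tval quot W)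
    = carrier (tval quot X) \<times> carrier (tval quot Y)"
  proof
    show "(\<lambda>m. (tres quot X W i m, tres quot Y W j m)) ` carrier (tval quot W)
      \<subseteq> carrier (tval quot X) \<times> carrier (tval quot Y)"
      using r by (auto simp: carrier_quot q)
    show "carrier (tval quot X) \<times> carrier (tval quot Y)
      \<subseteq> (\<lambda>m. (tres quot X W i m, tres quot Y W j m)) ` carrier (tval quot W)"
    proof
      fix p assume "p \<in> carrier (tval quot X) \<times> carrier (tval quot Y)"
      then obtain x y where xy: "x \<in> carrier (tval T X)" "y \<in> carrier (tval T Y)"
        "p = (proj X x, proj Y y)"
        by (auto simp: carrier_quot)
      then have "(x, y) \<in> (\<lambda>m. (tres T X W i m, tres T Y W j m)) ` carrier (tval T W)"
        using bij_betw_imp_surj_on[OF additive.additive[OF c]] by simp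
      then obtain w where "w \<in> carrier (tval T W)" "x = tres T X W i w" "y = tres T Y W j w"
        by auto
      then show "p \<in> (\<lambda>m. (tres quot X W i m, tres quot Y W j m)) ` carrier (tval quot W)"
        using xy by (intro image_eqI[of _ _ "proj W w"]) (auto simp: q carrier_quot)
    qed
  qed
qed

lemma quot_cring: "fin_gset G X \<Longrightarrow> cring (tval quot X)"
  unfolding tval_quot using ideal.quotient_is_cring[OF ideal val_cring] .

text \<open>The equational axioms descend because all operations commute with the surjections
  \<open>proj\<close>. Additivity is not equational and is supplied by
  \<open>quot_additive\<close>.\<close>

lemma mackey_functor_quot: "mackey_functor G (additive_part quot)"
proof (rule mackey_functor.intro, goal_cases)
  case (1 X)
  interpret cring "tval quot X" by (rule quot_cring[OF 1])
  show ?case unfolding additive_part_simps by (rule a_comm_group)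
next
  case (2 X Y f)
  then show ?case
    using tres_quot_ring_hom by (auto simp: ring_hom_def hom_def)
next
  case (3 X Y f)
  then show ?case using ttr_quot_hom by simp
next
  case (4 X m)
  then show ?case
    by (auto simp: carrier_quot tres_quot gmap_id_closed tres_id)
next
  case (5 X m)
  then show ?case
    using additive.tr_id[OF 5(1)] by (auto simp: carrier_quot ttr_quot gmap_id_closed)
next
  case (6 X Y Z f g m)
  then show ?case
    by (auto simp: carrier_quot tres_quot compose_gmap tres_comp tres_closed)
next
  case (7 X Y Z f g m)
  then show ?case
    using additive.tr_comp[OF 7(1-5)]
    by (auto simp: carrier_quot ttr_quot compose_gmap ttr_closed)
next
  case (8 X Y W i j)
  then show ?case using quot_additive by simp
next
  case (9 X)
  then show ?case
    using additive.additive_empty[OF 9] ring_hom_zero[OF proj_hom[OF 9(1)] val_ring[OF 9(1)] cring.axioms(1)[OF quot_cring[OF 9(1)]]]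
    by (simp add: carrier_quot)
next
  case (10 X Y Y' X' f g f' g' m)
  note D = pullbackD[OF 10(1)]
  show ?case
    using additive.base_change[OF 10(1)] 10(2) D
    by (auto simp: carrier_quot ttr_quot tres_quot ttr_closed tres_closed)
qed

lemma tambara_functor_quot: "tambara_functor G quot"
proof (intro tambara_functor.intro tambara_functor_axioms.intro mackey_functor_quot, goal_cases)
  case (1 X)
  then show ?case by (rule quot_cring)
next
  case (2 X Y f)
  then show ?case by (rule tres_quot_ring_hom)
next
  case (3 X Y f)
  then show ?case by (rule tnm_quot_hom)
next
  case (4 X Y f)
  then show ?case
    using tnm_quot[OF 4 monoid.one_closed] ring.is_monoid[OF val_ring[OF 4(1)]] nm_one[OF 4]
      ring_hom_one[OF proj_hom] by metis
next
  case (5 X x)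
  then show ?case
    by (auto simp: carrier_quot tnm_quot gmap_id_closed nm_id)
next
  case (6 X Y Z f g x)
  then show ?case
    by (auto simp: carrier_quot tnm_quot compose_gmap nm_comp tnm_closed)
next
  case (7 X Y Y' X' f g f' g' x)
  note D = pullbackD[OF 7(1)]
  show ?case
    using nm_base_change[OF 7(1)] 7(2) D
    by (auto simp: carrier_quot tnm_quot tres_quot tnm_closed tres_closed)
next
  case (8 A X Y P W q f p r k e a)
  have "is_pullback G X Y P W f p r k" and A: "fin_gset G A" "q \<in> gmap G A X" "e \<in> gmap G W A"
    using 8(1) by (auto simp: is_exponential_def)
  note D = pullbackD[OF this(1)]
  show ?case
    using nm_tr[OF 8(1)] 8(2) D A
    by (auto simp: carrier_quot tnm_quot tres_quot ttr_quot tnm_closed tres_closed ttr_closed)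
qed

lemma tambara_map_proj: "tambara_map G T quot proj"
  by (rule tambara_map.intro) (simp_all add: proj_hom tres_quot ttr_quot tnm_quot)

lemma tambara_ideal: "tambara_ideal G T I"
  unfolding tambara_ideal_def
proof (rule exI[of _ quot], rule exI[of _ proj], intro conjI allI impI)
  show "tambara_functor G quot" by (rule tambara_functor_quot)
  show "tambara_map G T quot proj" by (rule tambara_map_proj)
  fix X assume X: "fin_gset G X"
  interpret X: ring "tval T X" by (rule val_ring[OF X])
  interpret I: ideal "I X" "tval T X" by (rule ideal[OF X])
  have zero: "\<zero>\<^bsub>tval quot X\<^esub> = I X"
    by (simp add: tval_quot FactRing_def)
  have "x \<in> I X \<longleftrightarrow> x \<in> carrier (tval T X) \<and> proj X x = I X" for x
    using I.rcos_const_imp_mem[of x] X.a_rcos_zero[OF ideal[OF X], of x] I.Icarr[of x]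
    unfolding proj_def by blast
  then show "I X = a_kernel (tval T X) (tval quot X) (proj X)"
    unfolding a_kernel_def' zero by blast
qed

end

section \<open>Units modulo the Jacobson radical\<close>

context finite_group_tambara
begin

abbreviation free_orbit :: "'g gset" where
  "free_orbit \<equiv> coset_gset G {\<one>}"

abbreviation point :: "'g gset" where
  "point \<equiv> coset_gset G (carrier G)"

lemma free_orbit: "fin_gset G free_orbit"
  using fin_gset_coset[OF triv_subgroup] .

lemma point: "fin_gset G point" "pts point = {(carrier G, 0)}"
proof -
  show "fin_gset G point"
    using fin_gset_coset[OF subgroup_self] .
  have "g <# carrier G = carrier G" if g: "g \<in> carrier G" for g
    using l_repr_independence[OF _ one_closed subgroup_self, of g] lcos_mult_one[of "carrier G"] g by simp
  then show "pts point = {(carrier G, 0)}"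
    unfolding pts_coset using one_closed by (auto simp: image_iff intro!: bexI[of _ \<one>])
qed

definition terminal :: "'g gset \<Rightarrow> 'g pt \<Rightarrow> 'g pt" where
  "terminal X = (\<lambda>x\<in>pts X. (carrier G, 0))"

lemma terminal_gmap: "fin_gset G X \<Longrightarrow> terminal X \<in> gmap G X point"
  using act_closed[OF point(1)] act_closed[of X]
  by (intro gmapI) (auto simp: terminal_def point(2))

lemma terminal_unique: "f \<in> gmap G X point \<Longrightarrow> f = terminal X"
  using gmap_closed[of f X point] gmap_ext[of f X point]
  by (intro extensionalityI[of f "pts X"]) (auto simp: terminal_def point(2))

lemma free_orbit_gmap:
  assumes "fin_gset G X" "x \<in> pts X"
  obtains \<phi> where "\<phi> \<in> gmap G free_orbit X" "\<phi> ({\<one>}, 0) = x"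
proof -
  have "act X h x = x" if "h \<in> {\<one>}" for h
    using that act_one assms by simp
  from coset_gmap[OF triv_subgroup assms this] obtain \<phi> where
    "\<phi> \<in> gmap G free_orbit X" "\<And>g. g \<in> carrier G \<Longrightarrow> \<phi> (g <# {\<one>}, 0) = act X g x"
    by blast
  then show thesis
    using that[of \<phi>] lcos_mult_one[of "{\<one>}"] act_one assms by (metis empty_subsetI insert_subset one_closed)
qed

lemma tambara_ideal_is_ideal:
  assumes I: "tambara_ideal G T I"
  shows "fin_gset G X \<Longrightarrow> ideal (I X) (tval T X)"
    and "\<lbrakk>fin_gset G X; fin_gset G Y; f \<in> gmap G X Y; x \<in> I Y\<rbrakk> \<Longrightarrow> tres T X Y f x \<in> I X"
    and "\<lbrakk>\<one>\<^bsub>tval T free_orbit\<^esub> \<in> I free_orbit; fin_gset G X\<rbrakk> \<Longrightarrow> I X = carrier (tval T X)"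
    and "\<lbrakk>fin_gset G X; fin_gset G Y; f \<in> gmap G X Y; x \<in> I X\<rbrakk> \<Longrightarrow> ttr T X Y f x \<in> I Y"
proof -
  obtain S :: "('g, 'r set) tambara" and \<phi> where S: "tambara_functor G S" and m: "tambara_map G T S \<phi>"
    and ker: "\<And>X. fin_gset G X \<Longrightarrow> I X = a_kernel (tval T X) (tval S X) (\<phi> X)"
    using I unfolding tambara_ideal_def by blast
  interpret S: finite_group_tambara G S
    by (intro finite_group_tambara.intro finite_group_axioms S)
  interpret m: tambara_map G T S \<phi> by (rule m)
  have hom: "ring_hom_ring (tval T X) (tval S X) (\<phi> X)" if "fin_gset G X" for X
    by (intro ring_hom_ringI2 val_ring S.val_ring m.map_ring_hom that)
  show id: "ideal (I X) (tval T X)" if "fin_gset G X" for X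
    using ring_hom_ring.kernel_is_ideal[OF hom[OF that]] ker[OF that] by simp
  have mem: "x \<in> I X \<longleftrightarrow> x \<in> carrier (tval T X) \<and> \<phi> X x = \<zero>\<^bsub>tval S X\<^esub>" if "fin_gset G X" for X x
    using ker[OF that] by (auto simp: a_kernel_def')
  show res: "tres T X Y f x \<in> I X" if "fin_gset G X" "fin_gset G Y" "f \<in> gmap G X Y" "x \<in> I Y" for X Y f x
    using that mem m.map_res[OF that(1-3)] tres_closed[OF that(1-3)] S.mk.res_one[OF that(1-3)] by simp
  show "ttr T X Y f x \<in> I Y" if "fin_gset G X" "fin_gset G Y" "f \<in> gmap G X Y" "x \<in> I X" for X Y f x
    using that mem m.map_tr[OF that(1-3)] ttr_closed[OF that(1-3)] S.mk.tr_one[OF that(1-3)] by simp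
  show "I X = carrier (tval T X)" if one: "\<one>\<^bsub>tval T free_orbit\<^esub> \<in> I free_orbit" and X: "fin_gset G X" for X
  proof -
    note E = free_orbit
    note p = terminal_gmap[OF E]
    interpret E: ring "tval T free_orbit" by (rule val_ring[OF E])
    interpret P: ring "tval T point" by (rule val_ring[OF point(1)])
    \<comment> \<open>The norm of zero is computed in the target \<open>S\<close>, where the image
      of 1 has become 0. Restriction from the point then spreads 1 to every level of the
      ideal.\<close>
    have "\<phi> point \<one>\<^bsub>tval T point\<^esub> = \<zero>\<^bsub>tval S point\<^esub>"
      using m.map_nm[OF E point(1) p E.one_closed] nm_one[OF E point(1) p] one mem[OF E]
        S.tnm_zero[OF E point(1) p gmap_coset_surj[OF subgroup_self E pts_coset_nonempty p]] by simp
    then have "\<one>\<^bsub>tval T point\<^esub> \<in> I point"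
      using mem[OF point(1)] by simp
    from res[OF X point(1) terminal_gmap[OF X] this] have "\<one>\<^bsub>tval T X\<^esub> \<in> I X"
      using ring_hom_one[OF res_ring_hom[OF X point(1) terminal_gmap[OF X]]] by simp
    then show ?thesis
      using ideal.one_imp_carrier[OF id[OF X]] by simp
  qed
qed

section \<open>Tambara ideals cut out at G/e\<close>

definition invariant_ideal :: "'r set \<Rightarrow> bool" where
  "invariant_ideal A \<longleftrightarrow> ideal A (tval T free_orbit) \<and>
    (\<forall>\<phi> \<in> gmap G free_orbit free_orbit. tres T free_orbit free_orbit \<phi> ` A \<subseteq> A)"

text \<open>This is the largest family of subsets that is closed under restriction and has its value
  at G/e inside \<open>A\<close>, which is why it can be maximal.\<close>

definition coinduced :: "'r set \<Rightarrow> 'g gset \<Rightarrow> 'r set" where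
  "coinduced A X = {x \<in> carrier (tval T X). \<forall>\<phi> \<in> gmap G free_orbit X. tres T free_orbit X \<phi> x \<in> A}"

lemma coinduced_free_orbit:
  assumes "invariant_ideal A"
  shows "coinduced A free_orbit = A"
proof -
  interpret ideal A "tval T free_orbit" using assms by (simp add: invariant_ideal_def)
  show ?thesis
    using assms gmap_id_closed[OF free_orbit] Icarr tres_id[OF free_orbit]
    by (auto simp: coinduced_def invariant_ideal_def)
qed

lemma coinduced_ideal:
  assumes A: "ideal A (tval T free_orbit)" and X: "fin_gset G X"
  shows "ideal (coinduced A X) (tval T X)"
proof -
  interpret A: ideal A "tval T free_orbit" by (rule A)
  interpret X: ring "tval T X" by (rule val_ring[OF X])
  have hom: "ring_hom_ring (tval T X) (tval T free_orbit) (tres T free_orbit X \<phi>)"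
    if "\<phi> \<in> gmap G free_orbit X" for \<phi>
    by (intro ring_hom_ringI2 val_ring res_ring_hom X free_orbit that)
  note simps = ring_hom_mult[OF res_ring_hom[OF free_orbit X]] ring_hom_add[OF res_ring_hom[OF free_orbit X]]
    ring_hom_closed[OF res_ring_hom[OF free_orbit X]]
  show ?thesis
  proof (rule idealI[OF X.ring_axioms])
    show "subgroup (coinduced A X) (add_monoid (tval T X))"
    proof (rule X.add.subgroupI)
      show "coinduced A X \<noteq> {}"
        using ring_hom_zero[OF res_ring_hom[OF free_orbit X] val_ring[OF X] val_ring[OF free_orbit]]
        by (auto simp: coinduced_def intro!: exI[of _ "\<zero>\<^bsub>tval T X\<^esub>"])
      show "\<ominus>\<^bsub>tval T X\<^esub> a \<in> coinduced A X" if "a \<in> coinduced A X" for a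
      proof -
        have "tres T free_orbit X \<phi> (\<ominus>\<^bsub>tval T X\<^esub> a) \<in> A" if \<phi>: "\<phi> \<in> gmap G free_orbit X" for \<phi>
        proof -
          interpret ring_hom_ring "tval T X" "tval T free_orbit" "tres T free_orbit X \<phi>"
            by (rule hom[OF \<phi>])
          show ?thesis
            using \<open>a \<in> coinduced A X\<close> \<phi> by (simp add: coinduced_def)
        qed
        then show ?thesis
          using \<open>a \<in> coinduced A X\<close> by (simp add: coinduced_def)
      qed
    qed (auto simp: coinduced_def simps)
  qed (auto simp: coinduced_def simps A.I_l_closed A.I_r_closed)
qed

text \<open>This is the multiplicative counterpart of \<open>tr_mem_if_res_mem\<close> at the
  trivial subgroup. Points of a G-set over G/e have trivial stabilizer, so W splits into copies of
  G/e and both norms are products of restrictions. Their factors are congruent modulo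
  \<open>A\<close> one by one, hence so are the products.\<close>

lemma tnm_free_orbit_cong:
  assumes A: "ideal A (tval T free_orbit)"
    and W: "fin_gset G W" and f: "f \<in> gmap G W free_orbit"
    and w: "w \<in> carrier (tval T W)" and v: "v \<in> carrier (tval T W)"
    and res: "\<And>h. h \<in> gmap G free_orbit W
      \<Longrightarrow> tres T free_orbit W h w \<ominus>\<^bsub>tval T free_orbit\<^esub> tres T free_orbit W h v \<in> A"
  shows "tnm T W free_orbit f w \<ominus>\<^bsub>tval T free_orbit\<^esub> tnm T W free_orbit f v \<in> A"
  using W f w v res
proof (induction "card (pts W)" arbitrary: W f w v rule: less_induct)
  case less
  let ?H = free_orbit
  note W = less.prems(1) and f = less.prems(2) and w = less.prems(3) and v = less.prems(4)
    and res = less.prems(5)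
  note FH = free_orbit
  interpret R: cring "tval T ?H" by (rule val_cring[OF FH])
  interpret A: ideal A "tval T ?H" by (rule A)
  show ?case
  proof (cases "pts W = {}")
    case True
    then have "w = v"
      using tval_empty[OF W] w v by simp
    then show ?thesis
      using tnm_closed[OF W FH f v] R.quotient_eq_iff_same_a_r_cos[OF A] by simp
  next
    case False
    obtain K W' i j where K: "subgroup K G" and c: "is_coproduct G (coset_gset G K) W' W i j"
      and lt: "card (pts W') < card (pts W)"
      using orbit_decomposition[OF W False] .
    let ?K = "coset_gset G K"
    note D = mk.coproductD[OF c]
    note fi = compose_gmap[OF D(1,4) f] and fj = compose_gmap[OF D(2,5) f]
    note rw = tres_closed[OF D(1,3,4) w] tres_closed[OF D(2,3,5) w]
    note rv = tres_closed[OF D(1,3,4) v] tres_closed[OF D(2,3,5) v]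
    let ?a = "tnm T ?K ?H (compose (pts ?K) f i) (tres T ?K W i w)"
    let ?a' = "tnm T ?K ?H (compose (pts ?K) f i) (tres T ?K W i v)"
    let ?b = "tnm T W' ?H (compose (pts W') f j) (tres T W' W j w)"
    let ?b' = "tnm T W' ?H (compose (pts W') f j) (tres T W' W j v)"
    have ab: "?a \<in> carrier (tval T ?H)" "?a' \<in> carrier (tval T ?H)"
      "?b \<in> carrier (tval T ?H)" "?b' \<in> carrier (tval T ?H)"
      using tnm_closed[OF D(1) FH fi] tnm_closed[OF D(2) FH fj] rw rv by auto
    have "?a \<ominus>\<^bsub>tval T ?H\<^esub> ?a' \<in> A"
    proof -
      have "card K > 0"
        using subgroup.one_closed[OF K] finite_subset[OF subgroup.subset[OF K] finite_carrier]
        by (auto simp: card_gt_0_iff)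
      then have "card K = card {\<one>}"
        using gmap_coset_card(1)[OF K triv_subgroup fi] by simp
      then have "bij_betw (compose (pts ?K) f i) (pts ?K) (pts ?H)"
        by (rule gmap_coset_card(2)[OF K triv_subgroup fi])
      then obtain h where h: "h \<in> gmap G ?H ?K"
        "\<And>m. m \<in> carrier (tval T ?K) \<Longrightarrow> tnm T ?K ?H (compose (pts ?K) f i) m = tres T ?H ?K h m"
        using tnm_bij[OF D(1) FH fi] by metis
      show ?thesis
        using h(2)[OF rw(1)] h(2)[OF rv(1)] tres_comp[OF FH D(1,3) h(1) D(4) w]
          tres_comp[OF FH D(1,3) h(1) D(4) v] res[OF compose_gmap[OF FH h(1) D(4)]] by simp
    qed
    moreover have "?b \<ominus>\<^bsub>tval T ?H\<^esub> ?b' \<in> A"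
    proof (rule less.hyps[OF lt D(2) fj rw(2) rv(2)])
      fix h assume h: "h \<in> gmap G ?H W'"
      show "tres T ?H W' h (tres T W' W j w) \<ominus>\<^bsub>tval T ?H\<^esub> tres T ?H W' h (tres T W' W j v) \<in> A"
        using tres_comp[OF FH D(2,3) h D(5) w] tres_comp[OF FH D(2,3) h D(5) v]
          res[OF compose_gmap[OF FH h D(5)]] by simp
    qed
    ultimately have "(?a \<ominus>\<^bsub>tval T ?H\<^esub> ?a') \<otimes>\<^bsub>tval T ?H\<^esub> ?b \<oplus>\<^bsub>tval T ?H\<^esub> ?a' \<otimes>\<^bsub>tval T ?H\<^esub> (?b \<ominus>\<^bsub>tval T ?H\<^esub> ?b') \<in> A"
      using ab by (intro A.a_closed A.I_l_closed A.I_r_closed)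
    moreover have "(?a \<ominus>\<^bsub>tval T ?H\<^esub> ?a') \<otimes>\<^bsub>tval T ?H\<^esub> ?b \<oplus>\<^bsub>tval T ?H\<^esub> ?a' \<otimes>\<^bsub>tval T ?H\<^esub> (?b \<ominus>\<^bsub>tval T ?H\<^esub> ?b')
      = ?a \<otimes>\<^bsub>tval T ?H\<^esub> ?b \<ominus>\<^bsub>tval T ?H\<^esub> ?a' \<otimes>\<^bsub>tval T ?H\<^esub> ?b'"
      using ab by algebra
    ultimately show ?thesis
      unfolding tnm_coproduct[OF c FH f w] tnm_coproduct[OF c FH f v] by simp
  qed
qed

text \<open>Membership is tested after restriction to G/e. Base change moves that restriction past a
  transfer or norm, leaving a transfer or norm from some W to G/e; these are the cases of
  \<open>tr_mem_if_res_mem\<close> and \<open>tnm_free_orbit_cong\<close>.\<close>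

lemma coinduced_congruence:
  assumes A: "ideal A (tval T free_orbit)"
  shows "tambara_congruence G T (coinduced A)"
proof (intro tambara_congruence.intro tambara_congruence_axioms.intro finite_group_tambara_axioms
    coinduced_ideal[OF A])
  note E = free_orbit
  interpret A: ideal A "tval T free_orbit" by (rule A)
  fix X Y f assume X: "fin_gset G X" and Y: "fin_gset G Y" and f: "f \<in> gmap G X Y"
  show "tres T X Y f x \<in> coinduced A X" if "x \<in> coinduced A Y" for x
    using that tres_comp[OF E X Y _ f] compose_gmap[OF E _ f] tres_closed[OF X Y f]
    by (auto simp: coinduced_def) metis
  show "ttr T X Y f x \<in> coinduced A Y" if x: "x \<in> coinduced A X" for x
  proof -
    have xc: "x \<in> carrier (tval T X)"
      using x by (simp add: coinduced_def)
    have "tres T free_orbit Y \<psi> (ttr T X Y f x) \<in> A" if \<psi>: "\<psi> \<in> gmap G free_orbit Y" for \<psi>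
    proof -
      obtain W f' g' where pb: "is_pullback G X Y free_orbit W f \<psi> f' g'"
        using pullback_exists[OF X Y E f \<psi>] .
      then have W: "fin_gset G W" and f': "f' \<in> gmap G W free_orbit" and g': "g' \<in> gmap G W X"
        by (auto simp: is_pullback_def)
      have "mtr (additive_part T) W free_orbit f' (tres T W X g' x) \<in> A"
      proof (rule mk.tr_mem_if_res_mem[OF triv_subgroup _ _ W f'])
        show "subgroup A (mval (additive_part T) free_orbit)"
          using A.a_subgroup by simp
        show "tres T W X g' x \<in> carrier (mval (additive_part T) W)"
          using tres_closed[OF W X g' xc] by simp
        \<comment> \<open>No subgroup has fewer than one element, so the vanishing condition on
          smaller orbits is vacuous.\<close>
        fix K assume "subgroup K G" "card K < card {\<one>}"
        then show "carrier (mval (additive_part T) (coset_gset G K)) = {\<one>\<^bsub>mval (additive_part T) (coset_gset G K)\<^esub>}"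
          using finite_subset[OF subgroup.subset finite_carrier] subgroup.one_closed by fastforce
      next
        fix h assume h: "h \<in> gmap G free_orbit W"
        show "mres (additive_part T) free_orbit W h (tres T W X g' x) \<in> A"
        proof -
          have "tres T free_orbit X (compose (pts free_orbit) g' h) x \<in> A"
            using compose_gmap[OF E h g'] x by (simp add: coinduced_def)
          then show ?thesis
            using tres_comp[OF E W X h g' xc] by simp
        qed
      qed
      then show ?thesis
        using additive.base_change[OF pb] xc by simp
    qed
    then show ?thesis
      using ttr_closed[OF X Y f xc] by (simp add: coinduced_def)
  qed
  show "tnm T X Y f x \<ominus>\<^bsub>tval T Y\<^esub> tnm T X Y f y \<in> coinduced A Y"
    if x: "x \<in> carrier (tval T X)" and y: "y \<in> carrier (tval T X)"
      and xy: "x \<ominus>\<^bsub>tval T X\<^esub> y \<in> coinduced A X" for x y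
  proof -
    interpret Y: ring "tval T Y" by (rule val_ring[OF Y])
    have minus: "tres T free_orbit Z \<psi> (u \<ominus>\<^bsub>tval T Z\<^esub> v)
        = tres T free_orbit Z \<psi> u \<ominus>\<^bsub>tval T free_orbit\<^esub> tres T free_orbit Z \<psi> v"
      if Z: "fin_gset G Z" and \<psi>: "\<psi> \<in> gmap G free_orbit Z"
        and "u \<in> carrier (tval T Z)" "v \<in> carrier (tval T Z)" for Z \<psi> u v
    proof -
      interpret ring_hom_ring "tval T Z" "tval T free_orbit" "tres T free_orbit Z \<psi>"
        by (intro ring_hom_ringI2 val_ring res_ring_hom Z E \<psi>)
      show ?thesis using that by (simp add: a_minus_def)
    qed
    note n = tnm_closed[OF X Y f x] tnm_closed[OF X Y f y]
    have "tres T free_orbit Y \<psi> (tnm T X Y f x \<ominus>\<^bsub>tval T Y\<^esub> tnm T X Y f y) \<in> A"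
      if \<psi>: "\<psi> \<in> gmap G free_orbit Y" for \<psi>
    proof -
      obtain W f' g' where pb: "is_pullback G X Y free_orbit W f \<psi> f' g'"
        using pullback_exists[OF X Y E f \<psi>] .
      then have W: "fin_gset G W" and f': "f' \<in> gmap G W free_orbit" and g': "g' \<in> gmap G W X"
        by (auto simp: is_pullback_def)
      have "tnm T W free_orbit f' (tres T W X g' x) \<ominus>\<^bsub>tval T free_orbit\<^esub> tnm T W free_orbit f' (tres T W X g' y) \<in> A"
      proof (rule tnm_free_orbit_cong[OF A W f' tres_closed[OF W X g' x] tres_closed[OF W X g' y]])
        fix h assume h: "h \<in> gmap G free_orbit W"
        show "tres T free_orbit W h (tres T W X g' x) \<ominus>\<^bsub>tval T free_orbit\<^esub> tres T free_orbit W h (tres T W X g' y) \<in> A"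
        proof -
          have "tres T free_orbit X (compose (pts free_orbit) g' h) (x \<ominus>\<^bsub>tval T X\<^esub> y) \<in> A"
            using compose_gmap[OF E h g'] xy by (simp add: coinduced_def)
          then show ?thesis
            using tres_comp[OF E W X h g' x] tres_comp[OF E W X h g' y]
              minus[OF X compose_gmap[OF E h g'] x y] by simp
        qed
      qed
      then show ?thesis
        using minus[OF Y \<psi> n] nm_base_change[OF pb x] nm_base_change[OF pb y] by simp
    qed
    then show ?thesis
      using n by (simp add: coinduced_def)
  qed
qed

text \<open>A proper ideal above this one is still proper at G/e, so its value there is
  \<open>A\<close> by maximality. Being closed under restriction, it then lies in
  \<open>coinduced A\<close>.\<close>

lemma coinduced_maximal:
  assumes A: "invariant_ideal A" and one: "\<one>\<^bsub>tval T free_orbit\<^esub> \<notin> A"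
    and max: "\<And>B. \<lbrakk>invariant_ideal B; \<one>\<^bsub>tval T free_orbit\<^esub> \<notin> B; A \<subseteq> B\<rbrakk> \<Longrightarrow> B = A"
  shows "maximal_tambara_ideal G T (coinduced A)"
  unfolding maximal_tambara_ideal_def
proof (intro conjI allI impI)
  note E = free_orbit
  interpret R: ring "tval T free_orbit" by (rule val_ring[OF E])
  interpret tambara_congruence G T "coinduced A"
    using coinduced_congruence A by (simp add: invariant_ideal_def)
  show "proper_ideal G T (coinduced A)"
    unfolding proper_ideal_def
    using tambara_ideal coinduced_free_orbit[OF A] one E R.one_closed by metis
  fix I' X assume I': "proper_ideal G T I' \<and> (\<forall>X. fin_gset G X \<longrightarrow> coinduced A X \<subseteq> I' X)"
    and X: "fin_gset G X"
  then have t: "tambara_ideal G T I'"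
    by (simp add: proper_ideal_def)
  have "I' free_orbit = A"
  proof (rule max)
    show "invariant_ideal (I' free_orbit)"
      using tambara_ideal_is_ideal(1)[OF t E] tambara_ideal_is_ideal(2)[OF t E E]
      by (auto simp: invariant_ideal_def)
    show "\<one>\<^bsub>tval T free_orbit\<^esub> \<notin> I' free_orbit"
      using I' tambara_ideal_is_ideal(3)[OF t] by (auto simp: proper_ideal_def)
    show "A \<subseteq> I' free_orbit"
      using I' E coinduced_free_orbit[OF A] by metis
  qed
  then have "I' X \<subseteq> coinduced A X"
    using tambara_ideal_is_ideal(2)[OF t E X] ideal.Icarr[OF tambara_ideal_is_ideal(1)[OF t X]]
    by (auto simp: coinduced_def)
  then show "I' X = coinduced A X"
    using I' X by blast
qed

lemma maximal_invariant_ideal: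
  assumes A: "invariant_ideal A" and one: "\<one>\<^bsub>tval T free_orbit\<^esub> \<notin> A"
  obtains B where "invariant_ideal B" "\<one>\<^bsub>tval T free_orbit\<^esub> \<notin> B" "A \<subseteq> B"
    "\<And>C. \<lbrakk>invariant_ideal C; \<one>\<^bsub>tval T free_orbit\<^esub> \<notin> C; B \<subseteq> C\<rbrakk> \<Longrightarrow> C = B"
proof -
  interpret R: ring "tval T free_orbit" by (rule val_ring[OF free_orbit])
  let ?F = "{B. invariant_ideal B \<and> \<one>\<^bsub>tval T free_orbit\<^esub> \<notin> B \<and> A \<subseteq> B}"
  have "\<exists>M\<in>?F. \<forall>X\<in>?F. M \<subseteq> X \<longrightarrow> X = M"
  proof (rule subset_Zorn_nonempty)
    show "?F \<noteq> {}" using A one by blast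
    fix C assume ne: "C \<noteq> {}" and chain: "subset.chain ?F C"
    have inv: "invariant_ideal B" if "B \<in> C" for B
      using chain that by (auto simp: subset_chain_def)
    have id: "ideal B (tval T free_orbit)" if "B \<in> C" for B
      using inv[OF that] by (simp add: invariant_ideal_def)
    have sub: "additive_subgroup B (tval T free_orbit)" if "B \<in> C" for B
      using ideal.axioms(1)[OF id[OF that]] .
    have "ideal (\<Union>C) (tval T free_orbit)"
    proof (rule idealI[OF R.ring_axioms])
      show "subgroup (\<Union>C) (add_monoid (tval T free_orbit))"
      proof (rule R.add.subgroupI)
        show "\<Union>C \<subseteq> carrier (tval T free_orbit)"
          using ideal.Icarr[OF id] by blast
        show "\<Union>C \<noteq> {}"
          using ne additive_subgroup.zero_closed[OF sub] by blast
        show "\<ominus>\<^bsub>tval T free_orbit\<^esub> a \<in> \<Union>C" if "a \<in> \<Union>C" for a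
          using that additive_subgroup.a_inv_closed[OF sub] by blast
        fix a b assume "a \<in> \<Union>C" "b \<in> \<Union>C"
        then obtain B B' where B: "B \<in> C" "a \<in> B" "B' \<in> C" "b \<in> B'" by blast
        then have "B \<subseteq> B' \<or> B' \<subseteq> B"
          using chain by (auto simp: subset_chain_def)
        then show "a \<oplus>\<^bsub>tval T free_orbit\<^esub> b \<in> \<Union>C"
          using B additive_subgroup.a_closed[OF sub] by blast
      qed
    qed (use ideal.I_l_closed[OF id] ideal.I_r_closed[OF id] in blast)+
    moreover have "tres T free_orbit free_orbit \<phi> ` \<Union>C \<subseteq> \<Union>C" if "\<phi> \<in> gmap G free_orbit free_orbit" for \<phi>
      using inv that unfolding invariant_ideal_def by blast
    moreover have CF: "C \<subseteq> ?F"
      using chain by (simp add: subset_chain_def)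
    have mem: "A \<subseteq> B" "\<one>\<^bsub>tval T free_orbit\<^esub> \<notin> B" if "B \<in> C" for B
      using subsetD[OF CF that] by simp_all
    obtain B where "B \<in> C"
      using ne by blast
    then have "A \<subseteq> \<Union>C"
      using mem(1) Union_upper by (metis order_trans)
    moreover have "\<one>\<^bsub>tval T free_orbit\<^esub> \<notin> \<Union>C"
      using mem(2) by (metis UnionE)
    ultimately show "\<Union>C \<in> ?F"
      by (simp add: invariant_ideal_def)
  qed
  then obtain B where B: "B \<in> ?F" "\<forall>X\<in>?F. B \<subseteq> X \<longrightarrow> X = B"
    by (rule bexE)
  show thesis
  proof (rule that[of B])
    fix C assume "invariant_ideal C" "\<one>\<^bsub>tval T free_orbit\<^esub> \<notin> C" "B \<subseteq> C"
    then show "C = B"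
      using B(1) bspec[OF B(2), of C] subset_trans[of A B C] by simp
  qed (use B(1) in simp_all)
qed

text \<open>The diagonal of \<open>G/e \<times> G/e\<close> contributes the factor \<open>a\<close> to the restriction of the norm of \<open>a\<close>.\<close>

lemma dvd_res_nm:
  assumes a: "a \<in> carrier (tval T free_orbit)"
  obtains z where "z \<in> carrier (tval T free_orbit)"
    "tres T free_orbit point (terminal free_orbit) (tnm T free_orbit point (terminal free_orbit) a)
      = a \<otimes>\<^bsub>tval T free_orbit\<^esub> z"
proof -
  note E = free_orbit
  note p = terminal_gmap[OF E]
  let ?e = "({\<one>}, 0 :: nat)"
  have e: "?e \<in> pts free_orbit"
    using lcos_mult_one[of "{\<one>}"] by (auto simp: pts_coset image_iff intro!: bexI[of _ \<one>])
  obtain W f' g' where pb: "is_pullback G free_orbit point free_orbit W (terminal free_orbit) (terminal free_orbit) f' g'"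
    using pullback_exists[OF E point(1) E p p] .
  then have W: "fin_gset G W" and f': "f' \<in> gmap G W free_orbit" and g': "g' \<in> gmap G W free_orbit"
    and bij: "bij_betw (\<lambda>v. (g' v, f' v)) (pts W) {(x, y'). (x, y') \<in> pts free_orbit \<times> pts free_orbit
      \<and> terminal free_orbit x = terminal free_orbit y'}"
    by (auto simp: is_pullback_def)
  have "(?e, ?e) \<in> (\<lambda>v. (g' v, f' v)) ` pts W"
    using e by (simp add: bij_betw_imp_surj_on[OF bij])
  then obtain d where d: "d \<in> pts W" "g' d = ?e" "f' d = ?e"
    by auto
  \<comment> \<open>\<open>\<delta>\<close> is the diagonal of G/e x G/e. Its composites with both
    projections are maps out of G/e fixing the base coset, hence identities. The cofactor of
    \<open>a\<close> will be the norm over the complement of the diagonal.\<close>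
  obtain \<delta> where \<delta>: "\<delta> \<in> gmap G free_orbit W" "\<delta> ?e = d"
    using free_orbit_gmap[OF W d(1)] .
  have id: "compose (pts free_orbit) f' \<delta> = gmap_id free_orbit"
    "compose (pts free_orbit) g' \<delta> = gmap_id free_orbit"
    by (rule gmap_coset_eqI[OF triv_subgroup compose_gmap[OF E \<delta>(1) f'] gmap_id_closed[OF E]],
        use \<delta>(2) d e in \<open>simp add: compose_def gmap_id_def\<close>,
        rule gmap_coset_eqI[OF triv_subgroup compose_gmap[OF E \<delta>(1) g'] gmap_id_closed[OF E]],
        use \<delta>(2) d e in \<open>simp add: compose_def gmap_id_def\<close>)
  have "inj_on \<delta> (pts free_orbit)"
  proof (rule inj_on_inverseI[of _ f'])
    fix x assume "x \<in> pts free_orbit"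
    then show "f' (\<delta> x) = x"
      using fun_cong[OF id(1), of x] by (simp add: compose_def gmap_id_def)
  qed
  then obtain W' j where c: "is_coproduct G free_orbit W' W \<delta> j"
    using coproduct_complement[OF E W \<delta>(1)] by metis
  note D = mk.coproductD[OF c]
  note ra = tres_closed[OF W E g' a]
  let ?z = "tnm T W' free_orbit (compose (pts W') f' j) (tres T W' W j (tres T W free_orbit g' a))"
  have "?z \<in> carrier (tval T free_orbit)"
    using tnm_closed[OF D(2) E compose_gmap[OF D(2,5) f'] tres_closed[OF D(2,3,5) ra]] .
  moreover have "tres T free_orbit W \<delta> (tres T W free_orbit g' a) = a"
    using tres_comp[OF E W E \<delta>(1) g' a] id(2) tres_id[OF E a] by simp
  then have "tres T free_orbit point (terminal free_orbit) (tnm T free_orbit point (terminal free_orbit) a)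
      = a \<otimes>\<^bsub>tval T free_orbit\<^esub> ?z"
    using nm_base_change[OF pb a] tnm_coproduct[OF c E f' ra] id(1) nm_id[OF E a] by simp
  ultimately show thesis by (rule that)
qed

text \<open>If \<open>a = 1 - y\<close> is no unit, neither is the invariant multiple \<open>n\<close> of \<open>a\<close> given by the norm;
  but \<open>n\<close> is congruent to \<open>1\<close> modulo a maximal invariant ideal that contains \<open>n\<close>.\<close>

lemma jacobson_free_orbit_unit:
  assumes y: "y \<in> jacobson G T free_orbit"
  shows "\<one>\<^bsub>tval T free_orbit\<^esub> \<ominus>\<^bsub>tval T free_orbit\<^esub> y \<in> Units (tval T free_orbit)"
proof (rule ccontr)
  note E = free_orbit
  note p = terminal_gmap[OF E]
  let ?R = "tval T free_orbit" and ?P = "tval T point"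
  interpret R: cring ?R by (rule val_cring[OF E])
  interpret P: cring ?P by (rule val_cring[OF point(1)])
  have yc: "y \<in> carrier ?R"
    using y by (simp add: jacobson_def)
  define a where "a = \<one>\<^bsub>?R\<^esub> \<ominus>\<^bsub>?R\<^esub> y"
  assume "\<one>\<^bsub>?R\<^esub> \<ominus>\<^bsub>?R\<^esub> y \<notin> Units ?R"
  then have a: "a \<notin> Units ?R" "a \<in> carrier ?R"
    using yc by (auto simp: a_def)
  define m where "m = tnm T free_orbit point (terminal free_orbit) a"
  define n where "n = tres T free_orbit point (terminal free_orbit) m"
  have m: "m \<in> carrier ?P"
    unfolding m_def by (rule tnm_closed[OF E point(1) p a(2)])
  have n: "n \<in> carrier ?R"
    unfolding n_def by (rule tres_closed[OF E point(1) p m])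
  obtain z where z: "z \<in> carrier ?R" "n = a \<otimes>\<^bsub>?R\<^esub> z"
    using dvd_res_nm[OF a(2)] unfolding n_def m_def .
  \<comment> \<open>\<open>n\<close> is restricted from the point, and an endomorphism of G/e does
    not change the map to the point.\<close>
  have n_inv: "tres T free_orbit free_orbit \<phi> n = n" if \<phi>: "\<phi> \<in> gmap G free_orbit free_orbit" for \<phi>
    using tres_comp[OF E E point(1) \<phi> p m] terminal_unique[OF compose_gmap[OF E \<phi> p]]
    by (simp add: n_def)
  \<comment> \<open>Invariance of \<open>n\<close> makes its principal ideal invariant. The ideal is
    proper because \<open>n\<close> is a multiple of the non-unit \<open>a\<close>.\<close>
  let ?A = "PIdl\<^bsub>?R\<^esub> n"
  have A: "invariant_ideal ?A"
    unfolding invariant_ideal_def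
  proof (intro conjI ballI R.cgenideal_ideal[OF n] subsetI)
    fix \<phi> x assume \<phi>: "\<phi> \<in> gmap G free_orbit free_orbit" and "x \<in> tres T free_orbit free_orbit \<phi> ` ?A"
    then obtain r where r: "r \<in> carrier ?R" "x = tres T free_orbit free_orbit \<phi> (r \<otimes>\<^bsub>?R\<^esub> n)"
      by (auto simp: cgenideal_def)
    then have "x = tres T free_orbit free_orbit \<phi> r \<otimes>\<^bsub>?R\<^esub> n"
      using ring_hom_mult[OF res_ring_hom[OF E E \<phi>]] n n_inv[OF \<phi>] by simp
    then show "x \<in> ?A"
      using tres_closed[OF E E \<phi> r(1)] by (auto simp: cgenideal_def)
  qed
  have "\<one>\<^bsub>?R\<^esub> \<notin> ?A"
  proof
    assume "\<one>\<^bsub>?R\<^esub> \<in> ?A"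
    then obtain r where r: "r \<in> carrier ?R" "\<one>\<^bsub>?R\<^esub> = r \<otimes>\<^bsub>?R\<^esub> (a \<otimes>\<^bsub>?R\<^esub> z)"
      using z by (auto simp: cgenideal_def)
    then have "a \<otimes>\<^bsub>?R\<^esub> (r \<otimes>\<^bsub>?R\<^esub> z) = \<one>\<^bsub>?R\<^esub>"
      using a(2) z(1) by (simp add: R.m_ac)
    then show False
      using R.unit_factor[OF _ a(2) R.m_closed[OF r(1) z(1)]] a(1) by simp
  qed
  then obtain B where B: "invariant_ideal B" "\<one>\<^bsub>?R\<^esub> \<notin> B" "?A \<subseteq> B"
    "\<And>C. \<lbrakk>invariant_ideal C; \<one>\<^bsub>?R\<^esub> \<notin> C; B \<subseteq> C\<rbrakk> \<Longrightarrow> C = B"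
    using maximal_invariant_ideal[OF A] by metis
  interpret B: ideal B ?R
    using B(1) by (simp add: invariant_ideal_def)
  interpret C: tambara_congruence G T "coinduced B"
    by (rule coinduced_congruence[OF B.is_ideal])
  have "y \<in> coinduced B free_orbit"
    using y coinduced_maximal[OF B(1,2,4)] by (simp add: jacobson_def)
  moreover have "\<one>\<^bsub>?R\<^esub> \<ominus>\<^bsub>?R\<^esub> a = y"
    unfolding a_def using yc by algebra
  \<comment> \<open>Since \<open>y\<close> lies in \<open>B\<close>, the elements 1 and
    \<open>a\<close> are congruent modulo \<open>coinduced B\<close> at G/e. Norms respect this
    congruence, which gives 1 - \<open>m\<close> at the point and, after restriction, 1 -
    \<open>n\<close> in \<open>B\<close>.\<close>
  ultimately have "tnm T free_orbit point (terminal free_orbit) \<one>\<^bsub>?R\<^esub> \<ominus>\<^bsub>?P\<^esub> m \<in> coinduced B point"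
    unfolding m_def using C.nm_cong[OF E point(1) p R.one_closed a(2)] by simp
  then have "tres T free_orbit point (terminal free_orbit) (\<one>\<^bsub>?P\<^esub> \<ominus>\<^bsub>?P\<^esub> m) \<in> B"
    using p by (simp add: coinduced_def nm_one[OF E point(1) p])
  moreover have "tres T free_orbit point (terminal free_orbit) (\<one>\<^bsub>?P\<^esub> \<ominus>\<^bsub>?P\<^esub> m) = \<one>\<^bsub>?R\<^esub> \<ominus>\<^bsub>?R\<^esub> n"
  proof -
    interpret ring_hom_ring ?P ?R "tres T free_orbit point (terminal free_orbit)"
      by (intro ring_hom_ringI2 val_ring res_ring_hom E point p)
    show ?thesis
      using m by (simp add: a_minus_def n_def)
  qed
  moreover have "n \<in> B"
    using B(3) R.cgenideal_self[OF n] by blast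
  ultimately have "(\<one>\<^bsub>?R\<^esub> \<ominus>\<^bsub>?R\<^esub> n) \<oplus>\<^bsub>?R\<^esub> n \<in> B"
    by simp
  moreover have "(\<one>\<^bsub>?R\<^esub> \<ominus>\<^bsub>?R\<^esub> n) \<oplus>\<^bsub>?R\<^esub> n = \<one>\<^bsub>?R\<^esub>"
    using n by algebra
  ultimately show False
    using B(2) by simp
qed

section \<open>The Jacobson radical at arbitrary orbits\<close>

lemma maximal_tambara_idealD: "maximal_tambara_ideal G T I \<Longrightarrow> tambara_ideal G T I"
  by (simp add: maximal_tambara_ideal_def proper_ideal_def)

lemma jacobson_ideal:
  assumes X: "fin_gset G X"
  shows "ideal (jacobson G T X) (tval T X)"
proof -
  interpret X: ring "tval T X" by (rule val_ring[OF X])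
  \<comment> \<open>Adding the whole ring keeps the family nonempty even when there is no maximal
    ideal, and matches the carrier condition in \<open>jacobson\<close>.\<close>
  have "ideal (\<Inter>(insert (carrier (tval T X)) {I X | I. maximal_tambara_ideal G T I})) (tval T X)"
    using tambara_ideal_is_ideal(1)[OF maximal_tambara_idealD X] X.oneideal
    by (intro X.i_Intersect) auto
  moreover have "\<Inter>(insert (carrier (tval T X)) {I X | I. maximal_tambara_ideal G T I}) = jacobson G T X"
    by (auto simp: jacobson_def)
  ultimately show ?thesis by simp
qed

lemma jacobson_res:
  "\<lbrakk>fin_gset G X; fin_gset G Y; f \<in> gmap G X Y; x \<in> jacobson G T Y\<rbrakk> \<Longrightarrow> tres T X Y f x \<in> jacobson G T X"
  using tambara_ideal_is_ideal(2)[OF maximal_tambara_idealD] tres_closed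
  by (auto simp: jacobson_def)

lemma jacobson_tr:
  "\<lbrakk>fin_gset G X; fin_gset G Y; f \<in> gmap G X Y; x \<in> jacobson G T X\<rbrakk> \<Longrightarrow> ttr T X Y f x \<in> jacobson G T Y"
  using tambara_ideal_is_ideal(4)[OF maximal_tambara_idealD] ttr_closed
  by (auto simp: jacobson_def)

lemma coset_proj_gmap:
  assumes H: "subgroup H G"
  shows "coset_proj G {\<one>} H \<in> gmap G free_orbit (coset_gset G H)"
proof (rule gmapI)
  have v: "coset_proj G {\<one>} H (g <# {\<one>}, 0) = (g <# H, 0)" if "g \<in> carrier G" for g
    using that by (auto simp: coset_proj_def pts_coset set_mult_def l_coset_def)
  show "coset_proj G {\<one>} H \<in> extensional (pts free_orbit)"
    by (simp add: coset_proj_def)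
  show "coset_proj G {\<one>} H x \<in> pts (coset_gset G H)" if "x \<in> pts free_orbit" for x
    using that v by (auto simp: pts_coset)
  show "coset_proj G {\<one>} H (act free_orbit g x) = act (coset_gset G H) g (coset_proj G {\<one>} H x)"
    if g: "g \<in> carrier G" and x: "x \<in> pts free_orbit" for g x
  proof -
    obtain k where k: "k \<in> carrier G" "x = (k <# {\<one>}, 0)"
      using x by (auto simp: pts_coset)
    show ?thesis
      using act_coset[OF subgroup.subset[OF H] g k(1)] act_coset[OF _ g k(1), of "{\<one>}"] v g k by simp
  qed
qed

lemma jacobson_orbit_unit:
  assumes coh: "mult_cohomological G T" and H: "subgroup H G" and j: "j \<in> jacobson G T (coset_gset G H)"
  shows "\<one>\<^bsub>tval T (coset_gset G H)\<^esub> \<ominus>\<^bsub>tval T (coset_gset G H)\<^esub> j \<in> Units (tval T (coset_gset G H))"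
proof -
  let ?H = "coset_gset G H" and ?p = "coset_proj G {\<one>} H"
  let ?R = "tval T ?H" and ?E = "tval T free_orbit"
  note E = free_orbit and FH = fin_gset_coset[OF H]
  note p = coset_proj_gmap[OF H]
  interpret R: cring ?R by (rule val_cring[OF FH])
  interpret E: cring ?E by (rule val_cring[OF E])
  interpret r: ring_hom_ring ?R ?E "tres T free_orbit ?H ?p"
    by (intro ring_hom_ringI2 val_ring res_ring_hom E FH p)
  have jc: "j \<in> carrier ?R"
    using j by (simp add: jacobson_def)
  let ?a = "\<one>\<^bsub>?R\<^esub> \<ominus>\<^bsub>?R\<^esub> j"
  have a: "?a \<in> carrier ?R"
    using jc by simp
  have "tres T free_orbit ?H ?p ?a = \<one>\<^bsub>?E\<^esub> \<ominus>\<^bsub>?E\<^esub> tres T free_orbit ?H ?p j"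
    using jc by (simp add: a_minus_def)
  then have "tres T free_orbit ?H ?p ?a \<in> Units ?E"
    using jacobson_free_orbit_unit[OF jacobson_res[OF E FH p j]] by simp
  then obtain u where u: "u \<in> carrier ?E" "tres T free_orbit ?H ?p ?a \<otimes>\<^bsub>?E\<^esub> u = \<one>\<^bsub>?E\<^esub>"
    using E.Units_r_inv_ex by blast
  \<comment> \<open>This is |H|, in the form in which \<open>mult_cohomological\<close> counts
    cosets of the trivial subgroup.\<close>
  let ?k = "card ((\<lambda>g. g <# {\<one>}) ` H)"
  have "tnm T free_orbit ?H ?p (tres T free_orbit ?H ?p ?a) = ?a [^]\<^bsub>?R\<^esub> ?k"
    using coh H a triv_subgroup subgroup.one_closed[OF H] unfolding mult_cohomological_def by simp
  then have "?a [^]\<^bsub>?R\<^esub> ?k \<otimes>\<^bsub>?R\<^esub> tnm T free_orbit ?H ?p u = \<one>\<^bsub>?R\<^esub>"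
    using hom_mult[OF nm_hom[OF E FH p] r.hom_closed[OF a] u(1)] u(2) nm_one[OF E FH p] by simp
  then have unit: "?a [^]\<^bsub>?R\<^esub> ?k \<in> Units ?R"
    using R.unit_factor[OF _ R.nat_pow_closed[OF a] tnm_closed[OF E FH p u(1)], of ?k] by simp
  \<comment> \<open>A positive exponent lets one factor \<open>?a\<close> be split off; a factor of
    a unit is a unit.\<close>
  have "?k > 0"
    using subgroup.one_closed[OF H] finite_subset[OF subgroup.subset[OF H] finite_carrier]
    by (auto simp: card_gt_0_iff)
  then obtain k where k: "?k = Suc k"
    using gr0_implies_Suc by blast
  have "?a [^]\<^bsub>?R\<^esub> ?k = ?a \<otimes>\<^bsub>?R\<^esub> ?a [^]\<^bsub>?R\<^esub> k"
    unfolding k by (simp only: R.nat_pow_Suc R.m_comm[OF R.nat_pow_closed[OF a] a])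
  then show ?thesis
    using R.unit_factor[OF _ a R.nat_pow_closed[OF a, of k]] unit by simp
qed

end

section \<open>The product of an ideal and a module\<close>

lemma (in comm_group) finprod_mem_subgroup:
  assumes S: "subgroup S G" and f: "\<And>x. x \<in> A \<Longrightarrow> f x \<in> S"
  shows "finprod G f A \<in> S"
  using f
proof (induction A rule: infinite_finite_induct)
  case (insert x A)
  then show ?case
    using subgroup.m_closed[OF S] subgroup.mem_carrier[OF S] by (subst finprod_insert) auto
qed (use subgroup.one_closed[OF S] in auto)

text \<open>The right-hand side has the shape of \<open>box_lin\<close>, so the homomorphism given
  by the universal property can be recognized as that explicit formula.\<close>

lemma (in comm_group) hom_free_Abelian_group_eq:
  assumes h: "h \<in> hom (free_Abelian_group S) G" and c: "Poly_Mapping.keys c \<subseteq> S"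
  shows "h c = (\<Otimes>u\<in>Poly_Mapping.keys c. h (frag_of u) [^] Poly_Mapping.lookup c u)"
proof -
  interpret h: group_hom "free_Abelian_group S" G h
    using h by (simp add: group_hom_def group_hom_axioms_def is_group)
  let ?t = "\<lambda>u. frag_cmul (Poly_Mapping.lookup c u) (frag_of u)"
  have "finite K \<Longrightarrow> K \<subseteq> S \<Longrightarrow> h (\<Sum>u\<in>K. ?t u) = (\<Otimes>u\<in>K. h (frag_of u) [^] Poly_Mapping.lookup c u)" for K
  proof (induction K rule: finite_induct)
    case empty
    then show ?case using h.hom_one by simp
  next
    case (insert u K)
    have closed: "h (frag_of v) \<in> carrier G" if "v \<in> insert u K" for v
      using h.hom_closed[of "frag_of v"] insert.prems that by auto
    have t: "?t v \<in> carrier (free_Abelian_group S)" if "v \<in> insert u K" for v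
      using that insert.prems keys_cmul[of "Poly_Mapping.lookup c v" "frag_of v"] by auto
    have sum: "(\<Sum>v\<in>K. ?t v) \<in> carrier (free_Abelian_group S)"
      by (rule sum_closed_free_Abelian_group) (use t in blast)
    have "h (?t u) = h (frag_of u) [^] Poly_Mapping.lookup c u"
      using h.hom_int_pow[of "frag_of u" "Poly_Mapping.lookup c u"] insert.prems by simp
    then have "h (?t u + (\<Sum>v\<in>K. ?t v))
        = h (frag_of u) [^] Poly_Mapping.lookup c u \<otimes> (\<Otimes>v\<in>K. h (frag_of v) [^] Poly_Mapping.lookup c v)"
      using h.hom_mult[OF t[of u] sum] insert by simp
    then show ?case
      using insert.hyps closed by (subst finprod_insert) (auto simp: int_pow_closed)
  qed
  from this[OF finite_keys c] show ?thesis
    using frag_expansion[of c] by (simp add: frag_extend_def)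
qed

lemma ideal_mackey_simps [simp]:
  "carrier (mval (ideal_mackey T I) X) = I X"
  "x \<otimes>\<^bsub>mval (ideal_mackey T I) X\<^esub> y = x \<oplus>\<^bsub>tval T X\<^esub> y"
  "mres (ideal_mackey T I) = tres T" "mtr (ideal_mackey T I) = ttr T"
  by (simp_all add: ideal_mackey_def)

lemma keys_frag_diff: "Poly_Mapping.keys (frag_of a - frag_of b) \<subseteq> {a, b}"
  using keys_diff[of "frag_of a" "frag_of b"] by auto

lemma keys_frag_diff_add: "Poly_Mapping.keys (frag_of a - (frag_of b + frag_of c)) \<subseteq> {a, b, c}"
  using keys_diff[of "frag_of a" "frag_of b + frag_of c"] keys_add[of "frag_of b" "frag_of c"] by auto

text \<open>Relations have to lie in the free group for \<open>generate\<close> to yield a subgroup.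
  The closure assumptions on \<open>L\<close> fit both \<open>additive_part T\<close> and
  \<open>ideal_mackey T J\<close>.\<close>

lemma (in finite_group) keys_box_rels:
  assumes N: "mackey_functor G N"
    and mult: "\<And>Y m m'. \<lbrakk>fin_gset G Y; m \<in> carrier (mval L Y); m' \<in> carrier (mval L Y)\<rbrakk>
      \<Longrightarrow> m \<otimes>\<^bsub>mval L Y\<^esub> m' \<in> carrier (mval L Y)"
    and res: "\<And>Y Z g m. \<lbrakk>fin_gset G Y; fin_gset G Z; g \<in> gmap G Y Z; m \<in> carrier (mval L Z)\<rbrakk>
      \<Longrightarrow> mres L Y Z g m \<in> carrier (mval L Y)"
    and tr: "\<And>Y Z g m. \<lbrakk>fin_gset G Y; fin_gset G Z; g \<in> gmap G Y Z; m \<in> carrier (mval L Y)\<rbrakk>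
      \<Longrightarrow> mtr L Y Z g m \<in> carrier (mval L Z)"
    and c: "c \<in> box_rels G L N X"
  shows "Poly_Mapping.keys c \<subseteq> box_gens G L N X"
proof -
  interpret N: finite_group_mackey G N
    by (intro finite_group_mackey.intro finite_group_axioms N)
  have Nmult: "n \<otimes>\<^bsub>mval N Y\<^esub> n' \<in> carrier (mval N Y)"
    if "fin_gset G Y" "n \<in> carrier (mval N Y)" "n' \<in> carrier (mval N Y)" for Y n n'
    using that group.subgroup_self[OF N.val_group[OF that(1)]] subgroup.m_closed by fast
  from c show ?thesis
  proof cases
    case (add_left Y f m m' n)
    then have "(Y, f, m \<otimes>\<^bsub>mval L Y\<^esub> m', n) \<in> box_gens G L N X"
      "(Y, f, m, n) \<in> box_gens G L N X" "(Y, f, m', n) \<in> box_gens G L N X"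
      using mult[of Y m m'] by (simp_all add: box_gens_def)
    then show ?thesis
      unfolding add_left(1) by (intro order_trans[OF keys_frag_diff_add]) simp
  next
    case (add_right Y f m n n')
    then have "(Y, f, m, n \<otimes>\<^bsub>mval N Y\<^esub> n') \<in> box_gens G L N X"
      "(Y, f, m, n) \<in> box_gens G L N X" "(Y, f, m, n') \<in> box_gens G L N X"
      using Nmult[of Y n n'] by (simp_all add: box_gens_def)
    then show ?thesis
      unfolding add_right(1) by (intro order_trans[OF keys_frag_diff_add]) simp
  next
    case (frobenius_left Y Z g f m n)
    then have "(Y, compose (pts Y) f g, m, mres N Y Z g n) \<in> box_gens G L N X"
      "(Z, f, mtr L Y Z g m, n) \<in> box_gens G L N X"
      using compose_gmap[of Y g Z f X] tr[of Y Z g m] N.res_closed[of Y Z g n] by (simp_all add: box_gens_def)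
    then show ?thesis
      unfolding frobenius_left(1) by (intro order_trans[OF keys_frag_diff]) simp
  next
    case (frobenius_right Y Z g f m n)
    then have "(Y, compose (pts Y) f g, mres L Y Z g m, n) \<in> box_gens G L N X"
      "(Z, f, m, mtr N Y Z g n) \<in> box_gens G L N X"
      using compose_gmap[of Y g Z f X] res[of Y Z g m] N.tr_closed[of Y Z g n] by (simp_all add: box_gens_def)
    then show ?thesis
      unfolding frobenius_right(1) by (intro order_trans[OF keys_frag_diff]) simp
  qed
qed

locale finite_group_module = finite_group G + tambara_module G T M \<mu>
  for G :: "('g, 'b) monoid_scheme" (structure) and T :: "('g, 'r) tambara" and M :: "('g, 'm) mackey"
    and \<mu> :: "'g gset \<Rightarrow> 'r \<Rightarrow> 'm \<Rightarrow> 'm"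

sublocale finite_group_module \<subseteq> tmb: finite_group_tambara G T
  by (intro finite_group_tambara.intro finite_group_axioms ring.tambara_functor_axioms)

sublocale finite_group_module \<subseteq> mdl: finite_group_mackey G M
  by (intro finite_group_mackey.intro finite_group_axioms module.mackey_functor_axioms)

context finite_group_module
begin

section \<open>The map out of the box product induced by the action\<close>

lemma action_closed:
  "\<lbrakk>fin_gset G X; t \<in> carrier (tval T X); m \<in> carrier (mval M X)\<rbrakk> \<Longrightarrow> \<mu> X t m \<in> carrier (mval M X)"
  using action.pairing_hom_right[of X t] hom_in_carrier by fastforce

context
  fixes X :: "'g gset"
  assumes X: "fin_gset G X"
begin

abbreviation gens where "gens \<equiv> box_gens G (additive_part T) M X"
abbreviation nulls where "nulls \<equiv> box_null G (additive_part T) M X"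

definition gen_val where
  "gen_val u = (case u of (Y, f, m, n) \<Rightarrow> mtr M Y X f (\<mu> Y m n))"

lemma gen_val_closed: "u \<in> gens \<Longrightarrow> gen_val u \<in> carrier (mval M X)"
  using mdl.tr_closed[OF _ X] action_closed by (auto simp: gen_val_def box_gens_def)

lemma box_lin_hom: "box_lin M \<mu> X \<in> hom (free_Abelian_group gens) (mval M X)"
  and box_lin_frag_of: "u \<in> gens \<Longrightarrow> box_lin M \<mu> X (frag_of u) = gen_val u"
proof -
  interpret V: comm_group "mval M X" by (rule module.val_comm_group[OF X])
  have "gen_val ` gens \<subseteq> carrier (mval M X)"
    using gen_val_closed by auto
  then obtain h where h: "h \<in> hom (free_Abelian_group gens) (mval M X)"
    and hf: "\<And>u. u \<in> gens \<Longrightarrow> h (frag_of u) = gen_val u"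
    using V.free_Abelian_group_universal[of gen_val gens] by blast
  have eq: "box_lin M \<mu> X c = h c" if "Poly_Mapping.keys c \<subseteq> gens" for c
    unfolding V.hom_free_Abelian_group_eq[OF h that] box_lin_def gen_val_def[symmetric]
    using that hf gen_val_closed by (intro V.finprod_cong') (auto simp: V.int_pow_closed subset_iff)
  show "box_lin M \<mu> X \<in> hom (free_Abelian_group gens) (mval M X)"
  proof (rule homI)
    fix c d assume "c \<in> carrier (free_Abelian_group gens)" "d \<in> carrier (free_Abelian_group gens)"
    then show "box_lin M \<mu> X (c \<otimes>\<^bsub>free_Abelian_group gens\<^esub> d) = box_lin M \<mu> X c \<otimes>\<^bsub>mval M X\<^esub> box_lin M \<mu> X d"
      using hom_mult[OF h, of c d] eq order_trans[OF keys_add[of c d]] by simp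
  qed (use hom_in_carrier[OF h] eq in simp)
  show "box_lin M \<mu> X (frag_of u) = gen_val u" if "u \<in> gens"
    using eq[of "frag_of u"] hf that by simp
qed

lemma keys_rels: "c \<in> box_rels G (additive_part T) M X \<Longrightarrow> Poly_Mapping.keys c \<subseteq> gens"
  using tmb.tres_closed tmb.ttr_closed monoid.m_closed[OF group.is_monoid[OF tmb.mk.val_group]]
  by (elim keys_box_rels[OF module.mackey_functor_axioms, rotated -1]) simp_all

text \<open>The two additive relations are bilinearity of the action followed by a transfer. The two
  Frobenius relations are the corresponding pairing axioms, with functoriality of transfers
  absorbing the composite.\<close>

lemma box_lin_rels:
  assumes c: "c \<in> box_rels G (additive_part T) M X"
  shows "box_lin M \<mu> X c = \<one>\<^bsub>mval M X\<^esub>"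
proof -
  interpret V: comm_group "mval M X" by (rule module.val_comm_group[OF X])
  interpret l: group_hom "free_Abelian_group gens" "mval M X" "box_lin M \<mu> X"
    using box_lin_hom by (simp add: group_hom_def group_hom_axioms_def V.is_group)
  have diff: "box_lin M \<mu> X (a - b) = box_lin M \<mu> X a \<otimes>\<^bsub>mval M X\<^esub> inv\<^bsub>mval M X\<^esub> box_lin M \<mu> X b"
    if "Poly_Mapping.keys a \<subseteq> gens" "Poly_Mapping.keys b \<subseteq> gens" for a b
    using l.hom_mult[of a "- b"] l.hom_inv[of b] that by simp
  have add: "box_lin M \<mu> X (a + b) = box_lin M \<mu> X a \<otimes>\<^bsub>mval M X\<^esub> box_lin M \<mu> X b"
    if "Poly_Mapping.keys a \<subseteq> gens" "Poly_Mapping.keys b \<subseteq> gens" for a b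
    using l.hom_mult[of a b] that by simp
  have rel2: "box_lin M \<mu> X (frag_of u - frag_of v) = \<one>\<^bsub>mval M X\<^esub>"
    if "u \<in> gens" "v \<in> gens" "gen_val u = gen_val v" for u v
    using diff[of "frag_of u" "frag_of v"] that box_lin_frag_of gen_val_closed by simp
  have rel3: "box_lin M \<mu> X (frag_of u - (frag_of v + frag_of w)) = \<one>\<^bsub>mval M X\<^esub>"
    if "u \<in> gens" "v \<in> gens" "w \<in> gens" "gen_val u = gen_val v \<otimes>\<^bsub>mval M X\<^esub> gen_val w" for u v w
  proof -
    have "Poly_Mapping.keys (frag_of v + frag_of w) \<subseteq> gens"
      by (intro order_trans[OF keys_add]) (use that in simp)
    then show ?thesis
      using diff[of "frag_of u" "frag_of v + frag_of w"] add[of "frag_of v" "frag_of w"] that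
        box_lin_frag_of gen_val_closed by simp
  qed
  from c show ?thesis
  proof cases
    case (add_left Y f m m' n)
    interpret R: ring "tval T Y" by (rule tmb.val_ring[OF add_left(2)])
    show ?thesis
      unfolding add_left(1)
    proof (rule rel3)
      have "\<mu> Y (m \<oplus>\<^bsub>tval T Y\<^esub> m') n = \<mu> Y m n \<otimes>\<^bsub>mval M Y\<^esub> \<mu> Y m' n"
        using hom_mult[OF action.pairing_hom_left[OF add_left(2,6)]] add_left by simp
      then show "gen_val (Y, f, m \<otimes>\<^bsub>mval (additive_part T) Y\<^esub> m', n)
        = gen_val (Y, f, m, n) \<otimes>\<^bsub>mval M X\<^esub> gen_val (Y, f, m', n)"
        using hom_mult[OF module.tr_hom[OF add_left(2) X add_left(3)]] add_left action_closed
        by (simp add: gen_val_def)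
    qed (use add_left in \<open>auto simp: box_gens_def\<close>)
  next
    case (add_right Y f m n n')
    interpret V: group "mval M Y" by (rule mdl.val_group[OF add_right(2)])
    show ?thesis
      unfolding add_right(1)
    proof (rule rel3)
      have "\<mu> Y m (n \<otimes>\<^bsub>mval M Y\<^esub> n') = \<mu> Y m n \<otimes>\<^bsub>mval M Y\<^esub> \<mu> Y m n'"
        using hom_mult[OF action.pairing_hom_right[OF add_right(2,4)]] add_right by simp
      then show "gen_val (Y, f, m, n \<otimes>\<^bsub>mval M Y\<^esub> n')
        = gen_val (Y, f, m, n) \<otimes>\<^bsub>mval M X\<^esub> gen_val (Y, f, m, n')"
        using hom_mult[OF module.tr_hom[OF add_right(2) X add_right(3)]] add_right action_closed
        by (simp add: gen_val_def)
    qed (use add_right in \<open>auto simp: box_gens_def\<close>)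
  next
    case (frobenius_left Y Z g f m n)
    note F = frobenius_left
    have m: "m \<in> carrier (tval T Y)" using F by simp
    note n = mdl.res_closed[OF F(2,3,4,7)]
    show ?thesis
      unfolding F(1)
    proof (rule rel2)
      show "gen_val (Y, compose (pts Y) f g, m, mres M Y Z g n)
        = gen_val (Z, f, mtr (additive_part T) Y Z g m, n)"
        using module.tr_comp[OF F(2,3) X F(4,5) action_closed[OF F(2) m n]]
          action.pairing_tr_left[OF F(2,3,4,6,7)] by (simp add: gen_val_def)
    qed (use F n m compose_gmap[OF F(2,4,5)] tmb.ttr_closed[OF F(2,3,4) m] in \<open>auto simp: box_gens_def\<close>)
  next
    case (frobenius_right Y Z g f m n)
    note F = frobenius_right
    have m: "m \<in> carrier (tval T Z)" using F by simp
    note m' = tmb.tres_closed[OF F(2,3,4) m]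
    show ?thesis
      unfolding F(1)
    proof (rule rel2)
      show "gen_val (Y, compose (pts Y) f g, mres (additive_part T) Y Z g m, n)
        = gen_val (Z, f, m, mtr M Y Z g n)"
        using module.tr_comp[OF F(2,3) X F(4,5) action_closed[OF F(2) m' F(7)]]
          action.pairing_tr_right[OF F(2,3,4,6,7)] by (simp add: gen_val_def)
    qed (use F m m' compose_gmap[OF F(2,4,5)] mdl.tr_closed[OF F(2,3,4,7)] in \<open>auto simp: box_gens_def\<close>)
  qed
qed

lemma nulls_subgroup: "subgroup nulls (free_Abelian_group gens)"
  unfolding box_null_def
  by (rule group.generate_is_subgroup[OF group_free_Abelian_group]) (use keys_rels in auto)

lemma box_lin_nulls:
  assumes "c \<in> nulls"
  shows "box_lin M \<mu> X c = \<one>\<^bsub>mval M X\<^esub>"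
proof -
  interpret V: comm_group "mval M X" by (rule module.val_comm_group[OF X])
  interpret l: group_hom "free_Abelian_group gens" "mval M X" "box_lin M \<mu> X"
    using box_lin_hom by (simp add: group_hom_def group_hom_axioms_def V.is_group)
  have "nulls \<subseteq> kernel (free_Abelian_group gens) (mval M X) (box_lin M \<mu> X)"
    unfolding box_null_def
    using group.generate_subgroup_incl[OF group_free_Abelian_group _ l.subgroup_kernel]
      keys_rels box_lin_rels by (auto simp: kernel_def)
  then show ?thesis
    using assms by (auto simp: kernel_def)
qed

section \<open>Elements of the product of an ideal and the module\<close>

context
  fixes J :: "'g gset \<Rightarrow> 'r set"
  assumes J_ideal: "\<And>Y. fin_gset G Y \<Longrightarrow> ideal (J Y) (tval T Y)"
    and J_res: "\<And>Y Z f x. \<lbrakk>fin_gset G Y; fin_gset G Z; f \<in> gmap G Y Z; x \<in> J Z\<rbrakk> \<Longrightarrow> tres T Y Z f x \<in> J Y"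
    and J_tr: "\<And>Y Z f x. \<lbrakk>fin_gset G Y; fin_gset G Z; f \<in> gmap G Y Z; x \<in> J Y\<rbrakk> \<Longrightarrow> ttr T Y Z f x \<in> J Z"
begin

abbreviation J_gens where "J_gens \<equiv> box_gens G (ideal_mackey T J) M X"
abbreviation J_nulls where "J_nulls \<equiv> box_null G (ideal_mackey T J) M X"

lemma J_gens_subset: "J_gens \<subseteq> gens"
  using ideal.Icarr[OF J_ideal] by (auto simp: box_gens_def)

lemma J_rels_subset: "box_rels G (ideal_mackey T J) M X \<subseteq> box_rels G (additive_part T) M X"
proof
  fix c assume "c \<in> box_rels G (ideal_mackey T J) M X"
  then show "c \<in> box_rels G (additive_part T) M X"
  proof cases
    case (add_left Y f m m' n)
    then show ?thesis
      using box_rels.add_left[of G Y f X m "additive_part T" m' n M] ideal.Icarr[OF J_ideal] by simp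
  next
    case (add_right Y f m n n')
    then show ?thesis
      using box_rels.add_right[of G Y f X m "additive_part T" n M n'] ideal.Icarr[OF J_ideal] by simp
  next
    case (frobenius_left Y Z g f m n)
    then show ?thesis
      using box_rels.frobenius_left[of G Y Z g f X m "additive_part T" n M] ideal.Icarr[OF J_ideal] by simp
  next
    case (frobenius_right Y Z g f m n)
    then show ?thesis
      using box_rels.frobenius_right[of G Y Z g f X m "additive_part T" n M] ideal.Icarr[OF J_ideal] by simp
  qed
qed

lemma keys_J_rels: "c \<in> box_rels G (ideal_mackey T J) M X \<Longrightarrow> Poly_Mapping.keys c \<subseteq> J_gens"
  by (rule keys_box_rels[OF module.mackey_functor_axioms])
    (use additive_subgroup.a_closed[OF ideal.axioms(1)[OF J_ideal]] J_res J_tr in auto)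

lemma J_nulls_subset: "J_nulls \<subseteq> nulls"
proof
  interpret N: subgroup nulls "free_Abelian_group gens" by (rule nulls_subgroup)
  fix c assume "c \<in> J_nulls"
  then show "c \<in> nulls"
    unfolding box_null_def[of G "ideal_mackey T J"]
  proof induction
    case one
    then show ?case using N.one_closed by simp
  next
    case (incl h)
    then show ?case
      unfolding box_null_def by (rule generate.incl[OF subsetD[OF J_rels_subset]])
  next
    \<comment> \<open>Inverses in both free groups are negation, but only for elements supported on
      the respective generators; hence the appeal to \<open>keys_J_rels\<close>.\<close>
    case (inv h)
    then have "h \<in> nulls"
      unfolding box_null_def by (rule generate.incl[OF subsetD[OF J_rels_subset]])
    then show ?case
      using N.m_inv_closed[of h] keys_J_rels[OF inv] J_gens_subset by simp
  next
    case (eng h k)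
    then show ?case using N.m_closed[of h k] by simp
  qed
qed

text \<open>An element of JM is the value of \<open>box_lin\<close> on a representative supported on
  generators from \<open>J\<close>, hence a product of powers of transfers of products j n. The work
  lies in showing that \<open>the_elem\<close> in \<open>box_incl\<close> and \<open>box_map\<close>
  is applied to singletons, since null combinations are sent to null ones.\<close>

lemma ideal_mult_subset:
  assumes S: "subgroup S (mval M X)"
    and gen: "\<And>Y f j n. \<lbrakk>fin_gset G Y; f \<in> gmap G Y X; j \<in> J Y; n \<in> carrier (mval M Y)\<rbrakk>
      \<Longrightarrow> mtr M Y X f (\<mu> Y j n) \<in> S"
  shows "ideal_mult G T M \<mu> J X \<subseteq> S"
proof
  interpret V: comm_group "mval M X" by (rule module.val_comm_group[OF X])
  interpret F: group "free_Abelian_group gens" by simp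
  interpret N: subgroup nulls "free_Abelian_group gens" by (rule nulls_subgroup)
  fix v assume "v \<in> ideal_mult G T M \<mu> J X"
  then obtain C where C: "C \<in> carrier (box G (ideal_mackey T J) M X)"
    and v: "v = box_map M \<mu> X (box_incl G (additive_part T) M X C)"
    by (auto simp: ideal_mult_def)
  from C obtain c where cI: "Poly_Mapping.keys c \<subseteq> J_gens" and C: "C = (\<Union>n\<in>J_nulls. {n + c})"
    by (auto simp: box_def FactGroup_def RCOSETS_def r_coset_def)
  have c: "Poly_Mapping.keys c \<subseteq> gens"
    using cI J_gens_subset by blast
  let ?D = "nulls #>\<^bsub>free_Abelian_group gens\<^esub> c"
  have "nulls #>\<^bsub>free_Abelian_group gens\<^esub> c' = ?D" if "c' \<in> C" for c'
  proof -
    have "c' \<in> ?D"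
      using that J_nulls_subset by (auto simp: C r_coset_def)
    then show ?thesis
      using F.repr_independence[OF _ _ nulls_subgroup, of c' c] c by simp
  qed
  moreover have "C \<noteq> {}"
    using generate.one[of "box_free G (ideal_mackey T J) M X"] unfolding C box_null_def by blast
  ultimately have "(\<lambda>c. nulls #>\<^bsub>free_Abelian_group gens\<^esub> c) ` C = {?D}"
    by blast
  then have incl: "box_incl G (additive_part T) M X C = ?D"
    by (simp add: box_incl_def)
  have "box_lin M \<mu> X d = box_lin M \<mu> X c" if d: "d \<in> ?D" for d
  proof -
    obtain n where n: "n \<in> nulls" "d = n + c"
      using d by (auto simp: r_coset_def)
    then have "box_lin M \<mu> X d = box_lin M \<mu> X n \<otimes>\<^bsub>mval M X\<^esub> box_lin M \<mu> X c"
      using hom_mult[OF box_lin_hom, of n c] N.mem_carrier[OF n(1)] c by simp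
    then show ?thesis
      using box_lin_nulls[OF n(1)] hom_in_carrier[OF box_lin_hom, of c] c by simp
  qed
  moreover have "c \<in> ?D"
    using N.one_closed by (force simp: r_coset_def)
  ultimately have "box_lin M \<mu> X ` ?D = {box_lin M \<mu> X c}"
    by blast
  then have "v = box_lin M \<mu> X c"
    using v incl by (simp add: box_map_def)
  also have "\<dots> = (\<Otimes>\<^bsub>mval M X\<^esub>u\<in>Poly_Mapping.keys c. gen_val u [^]\<^bsub>mval M X\<^esub> Poly_Mapping.lookup c u)"
    by (simp add: box_lin_def gen_val_def)
  also have "\<dots> \<in> S"
  proof (rule V.finprod_mem_subgroup[OF S])
    fix u assume "u \<in> Poly_Mapping.keys c"
    then have "u \<in> J_gens" using cI by blast
    then have "gen_val u \<in> S"
      using gen by (auto simp: gen_val_def box_gens_def)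
    then show "gen_val u [^]\<^bsub>mval M X\<^esub> Poly_Mapping.lookup c u \<in> S"
      using V.subgroup_int_pow_closed[OF S] by blast
  qed
  finally show "v \<in> S" .
qed

end

end

end

section \<open>Nakayama's lemma\<close>

text \<open>A module over an ordinary ring whose group is written multiplicatively, as the values of
  a Mackey functor are.\<close>

locale ring_action =
  R: cring R + M: comm_group M
  for R :: "('r, 'c) ring_scheme" and M :: "('m, 'd) monoid_scheme" +
  fixes \<mu> :: "'r \<Rightarrow> 'm \<Rightarrow> 'm"
  assumes hom_right: "r \<in> carrier R \<Longrightarrow> \<mu> r \<in> hom M M"
    and hom_left: "m \<in> carrier M \<Longrightarrow> (\<lambda>r. \<mu> r m) \<in> hom (add_monoid R) M"
    and assoc: "\<lbrakk>r \<in> carrier R; s \<in> carrier R; m \<in> carrier M\<rbrakk> \<Longrightarrow> \<mu> (r \<otimes>\<^bsub>R\<^esub> s) m = \<mu> r (\<mu> s m)"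
    and unit: "m \<in> carrier M \<Longrightarrow> \<mu> \<one>\<^bsub>R\<^esub> m = m"
begin

definition stable_subgroup :: "'m set \<Rightarrow> bool" where
  "stable_subgroup S \<longleftrightarrow> subgroup S M \<and> (\<forall>r \<in> carrier R. \<forall>m \<in> S. \<mu> r m \<in> S)"

lemma closed: "\<lbrakk>r \<in> carrier R; m \<in> carrier M\<rbrakk> \<Longrightarrow> \<mu> r m \<in> carrier M"
  using hom_right hom_in_carrier by fastforce

lemma act_mult_right:
  "\<lbrakk>r \<in> carrier R; m \<in> carrier M; n \<in> carrier M\<rbrakk> \<Longrightarrow> \<mu> r (m \<otimes>\<^bsub>M\<^esub> n) = \<mu> r m \<otimes>\<^bsub>M\<^esub> \<mu> r n"
  using hom_mult[OF hom_right] .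

lemma act_add_left:
  "\<lbrakk>r \<in> carrier R; s \<in> carrier R; m \<in> carrier M\<rbrakk> \<Longrightarrow> \<mu> (r \<oplus>\<^bsub>R\<^esub> s) m = \<mu> r m \<otimes>\<^bsub>M\<^esub> \<mu> s m"
  using hom_mult[OF hom_left, of m r s] by simp

lemma act_zero: "m \<in> carrier M \<Longrightarrow> \<mu> \<zero>\<^bsub>R\<^esub> m = \<one>\<^bsub>M\<^esub>"
  using hom_one[OF hom_left] R.add.is_group M.is_group by simp

lemma act_minus: "\<lbrakk>r \<in> carrier R; m \<in> carrier M\<rbrakk> \<Longrightarrow> \<mu> (\<ominus>\<^bsub>R\<^esub> r) m = inv\<^bsub>M\<^esub> \<mu> r m"
  using act_add_left[of "\<ominus>\<^bsub>R\<^esub> r" r m] act_zero[of m] closed M.inv_equality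
  by (simp add: R.l_neg)

lemma act_one: "r \<in> carrier R \<Longrightarrow> \<mu> r \<one>\<^bsub>M\<^esub> = \<one>\<^bsub>M\<^esub>"
  using hom_one[OF hom_right] M.is_group by simp

text \<open>In additive notation this is K b + S. It is applied with K the whole ring and with K the
  ideal J.\<close>

lemma subgroup_add_multiples:
  assumes K: "additive_subgroup K R" and S: "subgroup S M" and b: "b \<in> carrier M"
  shows "subgroup {\<mu> t b \<otimes>\<^bsub>M\<^esub> v | t v. t \<in> K \<and> v \<in> S} M" (is "subgroup ?N M")
proof (rule M.subgroupI)
  note Kc = additive_subgroup.a_Hcarr[OF K] and Sc = subgroup.mem_carrier[OF S]
  show "?N \<subseteq> carrier M"
    using Kc Sc b closed by auto
  show "?N \<noteq> {}"
    using additive_subgroup.zero_closed[OF K] subgroup.one_closed[OF S] by blast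
  fix x assume "x \<in> ?N"
  then obtain t v where x: "t \<in> K" "v \<in> S" "x = \<mu> t b \<otimes>\<^bsub>M\<^esub> v" by blast
  have "inv\<^bsub>M\<^esub> x = \<mu> (\<ominus>\<^bsub>R\<^esub> t) b \<otimes>\<^bsub>M\<^esub> inv\<^bsub>M\<^esub> v"
    using x Kc Sc b closed act_minus by (simp add: M.inv_mult)
  then show "inv\<^bsub>M\<^esub> x \<in> ?N"
    using x additive_subgroup.a_inv_closed[OF K] subgroup.m_inv_closed[OF S] by blast
  fix y assume "y \<in> ?N"
  then obtain s w where y: "s \<in> K" "w \<in> S" "y = \<mu> s b \<otimes>\<^bsub>M\<^esub> w" by blast
  have "x \<otimes>\<^bsub>M\<^esub> y = \<mu> (t \<oplus>\<^bsub>R\<^esub> s) b \<otimes>\<^bsub>M\<^esub> (v \<otimes>\<^bsub>M\<^esub> w)"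
    using x y Kc Sc b closed act_add_left by (simp add: M.m_ac)
  then show "x \<otimes>\<^bsub>M\<^esub> y \<in> ?N"
    using x y additive_subgroup.a_closed[OF K] subgroup.m_closed[OF S] by blast
qed

text \<open>Generators are discarded one at a time. If S contains the others, then M = R b + S, so
  JM lies in J b + S and b = j b + v with v in S. Hence (1 - j) b = v, and inverting 1 - j puts b
  into S. Both M = JM and generation are phrased through the subgroups that contain the given
  elements, so no sums have to be written out.\<close>

lemma nakayama:
  assumes J: "ideal J R" and units: "\<And>j. j \<in> J \<Longrightarrow> \<one>\<^bsub>R\<^esub> \<ominus>\<^bsub>R\<^esub> j \<in> Units R"
    and JM: "\<And>S. \<lbrakk>subgroup S M; \<And>j m. j \<in> J \<Longrightarrow> m \<in> carrier M \<Longrightarrow> \<mu> j m \<in> S\<rbrakk> \<Longrightarrow> carrier M \<subseteq> S"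
    and B: "finite B" "B \<subseteq> carrier M"
    and gen: "\<And>S. \<lbrakk>stable_subgroup S; B \<subseteq> S\<rbrakk> \<Longrightarrow> carrier M \<subseteq> S"
  shows "carrier M = {\<one>\<^bsub>M\<^esub>}"
  using B gen
proof (induction B rule: finite_induct)
  case empty
  have "stable_subgroup {\<one>\<^bsub>M\<^esub>}"
    using M.triv_subgroup act_one by (simp add: stable_subgroup_def)
  then show ?case
    using empty.prems(2) M.one_closed by blast
next
  case (insert b B)
  note b = insert.prems(1)[THEN subsetD, OF insertI1]
  interpret J: ideal J R by (rule J)
  show ?case
  proof (rule insert.IH)
    fix S assume S: "stable_subgroup S" and BS: "B \<subseteq> S"
    then have sub: "subgroup S M" and stab: "\<And>r m. r \<in> carrier R \<Longrightarrow> m \<in> S \<Longrightarrow> \<mu> r m \<in> S"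
      by (auto simp: stable_subgroup_def)
    note Sc = subgroup.mem_carrier[OF sub]
    let ?N = "{\<mu> t b \<otimes>\<^bsub>M\<^esub> v | t v. t \<in> carrier R \<and> v \<in> S}"
    let ?L = "{\<mu> t b \<otimes>\<^bsub>M\<^esub> v | t v. t \<in> J \<and> v \<in> S}"
    have mult: "\<mu> r (\<mu> t b \<otimes>\<^bsub>M\<^esub> v) = \<mu> (r \<otimes>\<^bsub>R\<^esub> t) b \<otimes>\<^bsub>M\<^esub> \<mu> r v"
      if "r \<in> carrier R" "t \<in> carrier R" "v \<in> S" for r t v
      using that Sc b closed act_mult_right assoc by simp
    have "carrier M \<subseteq> ?N"
    proof (rule insert.prems(2))
      have "subgroup ?N M"
        using subgroup_add_multiples[OF ideal.axioms(1)[OF R.oneideal] sub b] .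
      moreover have "\<mu> r m \<in> ?N" if "r \<in> carrier R" "m \<in> ?N" for r m
        using that mult stab R.m_closed by blast
      ultimately show "stable_subgroup ?N"
        by (simp only: stable_subgroup_def) blast
      have "b = \<mu> \<one>\<^bsub>R\<^esub> b \<otimes>\<^bsub>M\<^esub> \<one>\<^bsub>M\<^esub>"
        using unit b by simp
      then have "b \<in> ?N"
        using R.one_closed subgroup.one_closed[OF sub] by blast
      moreover have "v = \<mu> \<zero>\<^bsub>R\<^esub> b \<otimes>\<^bsub>M\<^esub> v" if "v \<in> S" for v
        using act_zero[OF b] Sc[OF that] by simp
      then have "S \<subseteq> ?N"
        using R.zero_closed by blast
      ultimately show "insert b B \<subseteq> ?N"
        using BS by blast
    qed
    have "carrier M \<subseteq> ?L"
    proof (rule JM)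
      show "subgroup ?L M"
        using subgroup_add_multiples[OF J.additive_subgroup_axioms sub b] .
      fix j m assume j: "j \<in> J" and "m \<in> carrier M"
      then obtain t v where tv: "t \<in> carrier R" "v \<in> S" "m = \<mu> t b \<otimes>\<^bsub>M\<^esub> v"
        using \<open>carrier M \<subseteq> ?N\<close> by blast
      then have "\<mu> j m = \<mu> (j \<otimes>\<^bsub>R\<^esub> t) b \<otimes>\<^bsub>M\<^esub> \<mu> j v"
        using mult J.Icarr[OF j] by simp
      then show "\<mu> j m \<in> ?L"
        using J.I_r_closed[OF j tv(1)] stab[OF J.Icarr[OF j] tv(2)] by blast
    qed
    then obtain j v where j: "j \<in> J" and v: "v \<in> S" and eq: "b = \<mu> j b \<otimes>\<^bsub>M\<^esub> v"
      using b by blast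
    let ?u = "\<one>\<^bsub>R\<^esub> \<ominus>\<^bsub>R\<^esub> j"
    note jc = J.Icarr[OF j]
    have "\<mu> ?u b = b \<otimes>\<^bsub>M\<^esub> inv\<^bsub>M\<^esub> \<mu> j b"
      using act_add_left[of "\<one>\<^bsub>R\<^esub>" "\<ominus>\<^bsub>R\<^esub> j" b] act_minus[OF jc b] unit[OF b] b jc by (simp add: a_minus_def)
    also have "\<dots> = inv\<^bsub>M\<^esub> \<mu> j b \<otimes>\<^bsub>M\<^esub> (\<mu> j b \<otimes>\<^bsub>M\<^esub> v)"
      using eq b closed[OF jc b] M.m_comm by simp
    also have "\<dots> = v"
      using closed[OF jc b] Sc[OF v] by (simp add: M.m_assoc[symmetric])
    finally have uv: "\<mu> ?u b = v" .
    obtain w where w: "w \<in> carrier R" "w \<otimes>\<^bsub>R\<^esub> ?u = \<one>\<^bsub>R\<^esub>"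
      using R.Units_l_inv_ex[OF units[OF j]] by blast
    have "b = \<mu> w v"
      using assoc[OF w(1) _ b, of ?u] w(2) unit[OF b] uv jc by simp
    then have "b \<in> S"
      using stab[OF w(1) v] by simp
    then show "carrier M \<subseteq> S"
      using insert.prems(2)[OF S] BS by blast
  qed (use insert.prems(1) in blast)
qed

end

section \<open>Reduction to orbits and the induction on the order of the subgroup\<close>

context finite_group_module
begin

lemma ring_action: "fin_gset G X \<Longrightarrow> ring_action (tval T X) (mval M X) (\<mu> X)"
  using ring.val_cring module.val_comm_group action.pairing_hom_right[of X] action.pairing_hom_left[of X]
    action_assoc action_unit
  by (intro ring_action.intro ring_action_axioms.intro) auto

text \<open>The elements of \<open>M(Y)\<close> all of whose restrictions to \<open>G/H\<close> lie in \<open>S\<close> form a submodule,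
  because transfers from smaller orbits vanish.\<close>

lemma finitely_generated_orbit:
  assumes fg: "finitely_generated G T M \<mu>" and H: "subgroup H G"
    and zero: "\<And>K. \<lbrakk>subgroup K G; card K < card H\<rbrakk>
      \<Longrightarrow> carrier (mval M (coset_gset G K)) = {\<one>\<^bsub>mval M (coset_gset G K)\<^esub>}"
  obtains B where "finite B" "B \<subseteq> carrier (mval M (coset_gset G H))"
    "\<And>S. \<lbrakk>ring_action.stable_subgroup (tval T (coset_gset G H)) (mval M (coset_gset G H)) (\<mu> (coset_gset G H)) S;
        B \<subseteq> S\<rbrakk> \<Longrightarrow> carrier (mval M (coset_gset G H)) \<subseteq> S"
proof -
  let ?H = "coset_gset G H"
  note FH = fin_gset_coset[OF H]
  interpret a: ring_action "tval T ?H" "mval M ?H" "\<mu> ?H"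
    by (rule ring_action[OF FH])
  obtain F where F: "finite F" "F \<subseteq> {(X, m). fin_gset G X \<and> m \<in> carrier (mval M X)}"
    and gen: "\<forall>N. submodule G T M \<mu> N \<and> (\<forall>(X, m) \<in> F. m \<in> N X)
      \<longrightarrow> (\<forall>X. fin_gset G X \<longrightarrow> N X = carrier (mval M X))"
    using fg unfolding finitely_generated_def by (elim exE conjE)
  \<comment> \<open>A generator given at level X contributes its restrictions along all of the
    finitely many maps from G/H to X.\<close>
  define B where "B = (\<Union>(X, m)\<in>F. (\<lambda>h. mres M ?H X h m) ` gmap G ?H X)"
  show thesis
  proof (rule that[of B])
    show "finite B"
      unfolding B_def using F finite_gmap[OF FH] by (intro finite_UN_I) auto
    show "B \<subseteq> carrier (mval M ?H)"
      unfolding B_def using F mdl.res_closed[OF FH] by auto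
    fix S assume S: "a.stable_subgroup S" and BS: "B \<subseteq> S"
    then have sub: "subgroup S (mval M ?H)"
      and stab: "\<And>r m. r \<in> carrier (tval T ?H) \<Longrightarrow> m \<in> S \<Longrightarrow> \<mu> ?H r m \<in> S"
      by (auto simp: a.stable_subgroup_def)
    define N where "N Y = {m \<in> carrier (mval M Y). \<forall>h \<in> gmap G ?H Y. mres M ?H Y h m \<in> S}" for Y
    have sub_N: "submodule G T M \<mu> N"
      unfolding submodule_def
    proof (intro conjI allI impI ballI; (elim conjE)?)
      fix Y assume Y: "fin_gset G Y"
      interpret Y: comm_group "mval M Y" by (rule module.val_comm_group[OF Y])
      interpret TY: ring "tval T Y" by (rule tmb.val_ring[OF Y])
      note hm = hom_mult[OF module.res_hom[OF FH Y]]
      show "subgroup (N Y) (mval M Y)"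
      proof (rule Y.subgroupI)
        show "N Y \<subseteq> carrier (mval M Y)" by (auto simp: N_def)
        show "N Y \<noteq> {}"
          using mdl.res_one[OF FH Y] subgroup.one_closed[OF sub] by (auto simp: N_def intro!: exI[of _ "\<one>\<^bsub>mval M Y\<^esub>"])
        show "inv\<^bsub>mval M Y\<^esub> m \<in> N Y" if m: "m \<in> N Y" for m
        proof -
          have "mres M ?H Y h (inv\<^bsub>mval M Y\<^esub> m) \<in> S" if h: "h \<in> gmap G ?H Y" for h
          proof -
            interpret group_hom "mval M Y" "mval M ?H" "mres M ?H Y h"
              by (intro group_hom.intro group_hom_axioms.intro mdl.val_group module.res_hom FH Y h)
            show ?thesis
              using m h subgroup.m_inv_closed[OF sub] by (simp add: N_def)
          qed
          then show ?thesis using m by (simp add: N_def)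
        qed
        show "m \<otimes>\<^bsub>mval M Y\<^esub> n \<in> N Y" if "m \<in> N Y" "n \<in> N Y" for m n
          using that hm subgroup.m_closed[OF sub] by (simp add: N_def)
      qed
      show "\<mu> Y t m \<in> N Y" if t: "t \<in> carrier (tval T Y)" and m: "m \<in> N Y" for t m
        using m t action.pairing_res[OF FH Y] action_closed[OF Y] stab tmb.tres_closed[OF FH Y]
        by (simp add: N_def)
    next
      fix Y Z f assume Y: "fin_gset G Y" and Z: "fin_gset G Z" and f: "f \<in> gmap G Y Z"
      show "mres M Y Z f ` N Z \<subseteq> N Y"
      proof
        fix m assume "m \<in> mres M Y Z f ` N Z"
        then obtain n where n: "n \<in> N Z" "m = mres M Y Z f n" by blast
        then have nc: "n \<in> carrier (mval M Z)" by (simp add: N_def)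
        have "mres M ?H Y h m \<in> S" if h: "h \<in> gmap G ?H Y" for h
        proof -
          have "mres M ?H Z (compose (pts ?H) f h) n \<in> S"
            using n compose_gmap[OF FH h f] by (simp add: N_def)
          then show ?thesis
            using module.res_comp[OF FH Y Z h f nc] n(2) by simp
        qed
        then show "m \<in> N Y"
          using mdl.res_closed[OF Y Z f nc] n(2) by (simp add: N_def)
      qed
      show "mtr M Y Z f ` N Y \<subseteq> N Z"
      proof
        fix m assume "m \<in> mtr M Y Z f ` N Y"
        then obtain n where n: "n \<in> N Y" "m = mtr M Y Z f n" by blast
        then have nc: "n \<in> carrier (mval M Y)" by (simp add: N_def)
        have "mres M ?H Z h m \<in> S" if h: "h \<in> gmap G ?H Z" for h
        proof -
          obtain W f' g' where pb: "is_pullback G Y Z ?H W f h f' g'"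
            using pullback_exists[OF Y Z FH f h] .
          then have W: "fin_gset G W" and f': "f' \<in> gmap G W ?H" and g': "g' \<in> gmap G W Y"
            by (auto simp: is_pullback_def)
          have "mtr M W ?H f' (mres M W Y g' n) \<in> S"
          proof (rule mdl.tr_mem_if_res_mem[OF H sub zero W f' mdl.res_closed[OF W Y g' nc]])
            fix k assume k: "k \<in> gmap G ?H W"
            have "mres M ?H Y (compose (pts ?H) g' k) n \<in> S"
              using n compose_gmap[OF FH k g'] by (simp add: N_def)
            then show "mres M ?H W k (mres M W Y g' n) \<in> S"
              using module.res_comp[OF FH W Y k g' nc] by simp
          qed
          then show ?thesis
            using module.base_change[OF pb nc] n(2) by simp
        qed
        then show "m \<in> N Z"
          using mdl.tr_closed[OF Y Z f nc] n(2) by (simp add: N_def)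
      qed
    qed
    have F_N: "\<forall>(X, m) \<in> F. m \<in> N X"
      using F(2) BS by (fastforce simp: N_def B_def)
    have "N ?H = carrier (mval M ?H)"
      by (rule gen[rule_format, OF conjI[OF sub_N F_N] FH])
    \<comment> \<open>Testing membership in \<open>N\<close> with the identity of G/H shows that its
      value there lies in \<open>S\<close>.\<close>
    then have "mres M ?H ?H (gmap_id ?H) m \<in> S" if "m \<in> carrier (mval M ?H)" for m
      using that gmap_id_closed[OF FH] by (auto simp: N_def)
    then show "carrier (mval M ?H) \<subseteq> S"
      using module.res_id[OF FH] by auto
  qed
qed

lemma nakayama_zero:
  assumes coh: "mult_cohomological G T" and fg: "finitely_generated G T M \<mu>"
    and JM: "\<And>X. fin_gset G X \<Longrightarrow> ideal_mult G T M \<mu> (jacobson G T) X = carrier (mval M X)"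
  shows "mackey_zero G M"
proof (rule mdl.mackey_zero_if_zero_on_orbits)
  fix H assume "subgroup H G"
  then show "carrier (mval M (coset_gset G H)) = {\<one>\<^bsub>mval M (coset_gset G H)\<^esub>}"
  proof (induction "card H" arbitrary: H rule: less_induct)
    case less
    let ?H = "coset_gset G H"
    note H = less.prems
    note FH = fin_gset_coset[OF H]
    interpret a: ring_action "tval T ?H" "mval M ?H" "\<mu> ?H"
      by (rule ring_action[OF FH])
    obtain B where B: "finite B" "B \<subseteq> carrier (mval M ?H)"
      and gen: "\<And>S. a.stable_subgroup S \<Longrightarrow> B \<subseteq> S \<Longrightarrow> carrier (mval M ?H) \<subseteq> S"
      using finitely_generated_orbit[OF fg H less.hyps] by metis
    show ?case
    proof (rule a.nakayama[OF tmb.jacobson_ideal[OF FH] tmb.jacobson_orbit_unit[OF coh H] _ B gen])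
      fix S assume S: "subgroup S (mval M ?H)"
        and SJ: "\<And>j m. j \<in> jacobson G T ?H \<Longrightarrow> m \<in> carrier (mval M ?H) \<Longrightarrow> \<mu> ?H j m \<in> S"
      \<comment> \<open>At G/H, JM also receives transfers of products j n formed at other levels Y.
        By the induction hypothesis it suffices that the restrictions of j n to G/H lie in
        \<open>S\<close>; these are again products of an element of J(G/H) with an element of
        M(G/H).\<close>
      have "ideal_mult G T M \<mu> (jacobson G T) ?H \<subseteq> S"
      proof (rule ideal_mult_subset[OF FH tmb.jacobson_ideal tmb.jacobson_res tmb.jacobson_tr S])
        fix Y f j n assume Y: "fin_gset G Y" and f: "f \<in> gmap G Y ?H"
          and j: "j \<in> jacobson G T Y" and n: "n \<in> carrier (mval M Y)"
        have jc: "j \<in> carrier (tval T Y)"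
          using j by (simp add: jacobson_def)
        show "mtr M Y ?H f (\<mu> Y j n) \<in> S"
        proof (rule mdl.tr_mem_if_res_mem[OF H S less.hyps Y f action_closed[OF Y jc n]])
          fix h assume h: "h \<in> gmap G ?H Y"
          show "mres M ?H Y h (\<mu> Y j n) \<in> S"
            using action.pairing_res[OF FH Y h _ n] jc SJ[OF tmb.jacobson_res[OF FH Y h j] mdl.res_closed[OF FH Y h n]]
            by simp
        qed
      qed
      then show "carrier (mval M ?H) \<subseteq> S"
        using JM[OF FH] by simp
    qed
  qed
qed

end

theorem theorem2:
  fixes G :: "('g, 'b) monoid_scheme" and T :: "('g, 'r) tambara" and M :: "('g, 'm) mackey"
    and \<mu> :: "'g gset \<Rightarrow> 'r \<Rightarrow> 'm \<Rightarrow> 'm"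
  assumes "group G" and "finite (carrier G)"
    and "tambara_functor G T" and "mult_cohomological G T"
    and "tambara_module G T M \<mu>"
    and "finitely_generated G T M \<mu>"
    and "\<And>X. fin_gset G X \<Longrightarrow> ideal_mult G T M \<mu> (jacobson G T) X = carrier (mval M X)"
  shows "mackey_zero G M"
proof -
  interpret finite_group_module G T M \<mu>
    using assms(1,2,5) by (simp add: finite_group_module_def finite_group_def finite_group_axioms_def)
  show ?thesis
    using nakayama_zero assms by blast
qed

end
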